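(* Let $a,b>0$ and $h\in C^{2,1}([0,1])$ (i.e. $h\in C^2([0,1])$ with $h''$ Lipschitz; $h^{(3)}$ is understood almost everywhere). Then for every $n\ge1$ $$\left|\mathbb E[h(W_n)]-\mathbb E[h(Z)]-\frac1n\mathbb E[\mathrm e_1(Z)h'(Z)]\right|\le\frac{C_2(a,b)}{n^2}\|h^{(2)}\|+\frac{C_3(a,b)}{n^2}\|h^{(3)}\|,\qquad \mathrm e_1(z)=\frac{(a+b)z-a}{2},$$ where $$C_2(a,b)=c_{p,\eta}^{2,2}\Big\{\frac{\max(a,b)}6+D(a,b)\,|b-a|\Big\},\qquad C_3(a,b)=c_{p,\eta}^{3,3}\Big\{\mathsf M(a,b)+\frac{\max(a,b)}2D(a,b)\Big\},$$ $$\mathsf M(a,b)=\frac1{48}+\frac{\max(a,b)}{24},\qquad D(a,b)=c_{p,\eta}^{2,2}\Big(\frac1{12}+\frac{\max(a,b)}6\Big)+c_{p,\eta}^{1,2}\frac{ab}{a+b}.$$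
   Context: Pólya–Eggenberger urn: initially the urn contains $\tilde a$ red and $\tilde b$ blue balls; at each step a ball is drawn uniformly at random and returned together with $c$ additional balls of the same colour. Put $a=\tilde a/c$, $b=\tilde b/c$; $S_n$ is the number of red balls drawn in the first $n$ steps and $W_n=S_n/n$. $Z\sim\mathrm{Beta}(a,b)$ with density $p(x)=x^{a-1}(1-x)^{b-1}/B(a,b)$ on $(0,1)$. $\|\cdot\|$ is the essential supremum norm. Constants. $\eta(x)=x(1-x)$. Let $P(x)=\int_0^xp$, $\overline P(x)=\int_x^1p$, $\underline m_{p,\eta}=P/(\eta p)$, $\overline m_{p,\eta}=\overline P/(\eta p)$; $\underline P_0=\overline P_0=p$ and $\underline P_j(x)=\int_0^x\underline P_{j-1}$, $\overline P_j(x)=\int_x^1\overline P_{j-1}$ for $j\ge1$. Let $U_{p,\eta}^{i,j}=|\overline m_{p,\eta}^{(i)}|\,\underline P_{j+1}+|\underline m_{p,\eta}^{(i)}|\,\overline P_{j+1}$ (superscripts in parentheses are derivatives). For $(i,j)\in\{(2,2),(3,3),(1,2)\}$, $c_{p,\eta}^{i,j}=\sup_{0<x<1}U_{p,\eta}^{i,j}(x)$; in particular $c_{p,\eta}^{1,2}=\frac1{2(a+b+1)}$. *)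

theory Defs
  imports "HOL-Probability.Probability" "HOL-Probability.Essential_Supremum"
begin

section \<open>The Polya--Eggenberger urn\<close>

text \<open>
  Joint law of the first \<open>n\<close> draws (most recent first, \<open>True\<close> meaning red) from an urn with
  initially \<open>r\<close> red and \<open>s\<close> blue balls, \<open>c\<close> balls of the drawn colour being added at each step.
  The contents are real numbers, so that all real \<open>a = r / c > 0\<close> and \<open>b = s / c > 0\<close> are covered;
  for integer contents the probability below is that of a uniformly drawn ball being red.
\<close>

primrec polya_draws :: "real \<Rightarrow> real \<Rightarrow> real \<Rightarrow> nat \<Rightarrow> bool list pmf" where
  "polya_draws r s c 0 = return_pmf []"
| "polya_draws r s c (Suc n) =
     bind_pmf (polya_draws r s c n) (\<lambda>xs.
       map_pmf (\<lambda>x. x # xs)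
         (bernoulli_pmf ((r + c * real (count_list xs True)) / (r + s + c * real n))))"

definition red_proportion :: "nat \<Rightarrow> bool list \<Rightarrow> real" where
  "red_proportion n xs = real (count_list xs True) / real n"

section \<open>The Beta distribution\<close>

definition beta_density :: "real \<Rightarrow> real \<Rightarrow> real \<Rightarrow> real" where
  "beta_density a b x =
     (if 0 < x \<and> x < 1 then x powr (a - 1) * (1 - x) powr (b - 1) / Beta a b else 0)"

text \<open>
  Test functions are only constrained on \<open>[0,1]\<close>; \<open>Z\<close> is therefore a random element of \<open>[0,1]\<close>
  rather than of \<open>\<real>\<close>, so that \<open>h \<circ> Z\<close> is measurable for every continuous \<open>h\<close> on \<open>[0,1]\<close>.
\<close>

definition beta_distributed :: "'w measure \<Rightarrow> real \<Rightarrow> real \<Rightarrow> ('w \<Rightarrow> real) \<Rightarrow> bool" where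
  "beta_distributed M a b Z \<longleftrightarrow>
     distributed M (restrict_space lborel {0..1}) Z (\<lambda>x. ennreal (beta_density a b x))"

section \<open>Smooth functions on the unit interval\<close>

text \<open>Derivatives on \<open>[0,1]\<close>, one-sided at the end points.\<close>

definition deriv01 :: "(real \<Rightarrow> real) \<Rightarrow> real \<Rightarrow> real" where
  "deriv01 f x = vector_derivative f (at x within {0..1})"

definition C2_1 :: "(real \<Rightarrow> real) \<Rightarrow> bool" where
  "C2_1 h \<longleftrightarrow>
     h differentiable_on {0..1} \<and>
     deriv01 h differentiable_on {0..1} \<and>
     continuous_on {0..1} ((deriv01 ^^ 2) h) \<and>
     (\<exists>L. L-lipschitz_on {0..1} ((deriv01 ^^ 2) h))"

text \<open>
  Lebesgue measure (rather than \<open>lborel\<close>) is used because \<open>esssup\<close> is infinite for non-measurable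
  functions, whereas \<open>h'''\<close> is only meaningful up to a null set.
\<close>

definition ess_norm :: "(real \<Rightarrow> real) \<Rightarrow> real" where
  "ess_norm f = real_of_ereal (esssup (lebesgue_on {0..1}) (\<lambda>x. ereal \<bar>f x\<bar>))"

section \<open>The constants\<close>

definition eta :: "real \<Rightarrow> real" where
  "eta x = x * (1 - x)"

primrec P_lower :: "(real \<Rightarrow> real) \<Rightarrow> nat \<Rightarrow> real \<Rightarrow> real" where
  "P_lower p 0 = p"
| "P_lower p (Suc j) = (\<lambda>x. integral {0..x} (P_lower p j))"

primrec P_upper :: "(real \<Rightarrow> real) \<Rightarrow> nat \<Rightarrow> real \<Rightarrow> real" where
  "P_upper p 0 = p"
| "P_upper p (Suc j) = (\<lambda>x. integral {x..1} (P_upper p j))"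

definition m_lower :: "(real \<Rightarrow> real) \<Rightarrow> (real \<Rightarrow> real) \<Rightarrow> real \<Rightarrow> real" where
  "m_lower p \<eta> x = integral {0..x} p / (\<eta> x * p x)"

definition m_upper :: "(real \<Rightarrow> real) \<Rightarrow> (real \<Rightarrow> real) \<Rightarrow> real \<Rightarrow> real" where
  "m_upper p \<eta> x = integral {x..1} p / (\<eta> x * p x)"

definition U :: "(real \<Rightarrow> real) \<Rightarrow> (real \<Rightarrow> real) \<Rightarrow> nat \<Rightarrow> nat \<Rightarrow> real \<Rightarrow> real" where
  "U p \<eta> i j x =
     \<bar>(deriv ^^ i) (m_upper p \<eta>) x\<bar> * P_lower p (j + 1) x
   + \<bar>(deriv ^^ i) (m_lower p \<eta>) x\<bar> * P_upper p (j + 1) x"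

text \<open>
  For the Beta density, \<open>U p eta i j\<close> is bounded on \<open>(0,1)\<close> whenever \<open>i \<le> j\<close>: it is
  \<open>O(x ^ (j - i)) + O(1)\<close> at \<open>0\<close>, and symmetrically at \<open>1\<close>.  The real supremum is thus meaningful
  for the pairs \<open>(2,2)\<close>, \<open>(3,3)\<close>, \<open>(1,2)\<close> used below.
\<close>

definition c_const :: "real \<Rightarrow> real \<Rightarrow> nat \<Rightarrow> nat \<Rightarrow> real" where
  "c_const a b i j = (SUP x\<in>{0<..<1}. U (beta_density a b) eta i j x)"

definition M_const :: "real \<Rightarrow> real \<Rightarrow> real" where
  "M_const a b = 1 / 48 + max a b / 24"

definition D_const :: "real \<Rightarrow> real \<Rightarrow> real" where
  "D_const a b =
     c_const a b 2 2 * (1 / 12 + max a b / 6) + c_const a b 1 2 * (a * b / (a + b))"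

definition C2_const :: "real \<Rightarrow> real \<Rightarrow> real" where
  "C2_const a b = c_const a b 2 2 * (max a b / 6 + D_const a b * \<bar>b - a\<bar>)"

definition C3_const :: "real \<Rightarrow> real \<Rightarrow> real" where
  "C3_const a b = c_const a b 3 3 * (M_const a b + max a b / 2 * D_const a b)"

definition e1 :: "real \<Rightarrow> real \<Rightarrow> real \<Rightarrow> real" where
  "e1 a b z = ((a + b) * z - a) / 2"

end

theory Submission
  imports Defs
begin

text \<open>
  Write \<open>p\<close> for the Beta density, \<open>\<eta> x = x (1 - x)\<close> and \<open>\<tau> x = a - (a + b) x\<close>, so that
  \<open>(\<eta> p)' = \<tau> p\<close>.  Let \<open>f\<close> solve the Stein equation \<open>\<eta> f' + \<tau> f = h - E h(Z)\<close>.  The urn satisfies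
  the discrete identity \<open>E ((n - S) (a + S) G(S)) = E (S (b + n - S) G(S - 1))\<close>; with
  \<open>G(k) = f((k + 1/2) / n)\<close> it shows that \<open>E h(W) - E h(Z)\<close> is the expectation of a finite-difference
  error, which a Taylor expansion identifies as \<open>- E (\<kappa>(W) f'(W)) / (2 n)\<close> with
  \<open>\<kappa> x = a + (b - a) x\<close>, up to \<open>O(1 / n\<^sup>2)\<close>.  Integration by parts gives
  \<open>E (\<kappa>(Z) f'(Z)) = E (\<tau>(Z) h'(Z))\<close>, which is the first-order term of the theorem, and a second
  application of the Stein equation, to the test function \<open>\<kappa> f'\<close>, controls
  \<open>E (\<kappa>(W) f'(W)) - E (\<kappa>(Z) f'(Z))\<close>.

  The derivatives of \<open>f\<close> are bounded through
  \<open>f\<^sup>(\<^sup>i\<^sup>) = m\<^sub>u\<^sup>(\<^sup>i\<^sup>) A - m\<^sub>l\<^sup>(\<^sup>i\<^sup>) B\<close> for \<open>i = 1, 2\<close>, with \<open>A x = \<integral>\<^sub>0\<^sup>x P\<^sub>2 h''\<close> and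
  \<open>B x = \<integral>\<^sub>x\<^sup>1 Q\<^sub>2 h''\<close>, where \<open>P\<^sub>j\<close> and \<open>Q\<^sub>j\<close> are the lower and upper iterated integrals of \<open>p\<close>
  and \<open>m\<^sub>l\<close>, \<open>m\<^sub>u\<close> the corresponding Mills ratios.  Differentiating the first-order equation of
  \<open>m\<^sub>l\<close> and \<open>m\<^sub>u\<close> repeatedly gives \<open>\<Lambda>\<^sub>k P\<^sub>k\<^sub>+\<^sub>1 = \<eta>\<^sup>k\<^sup>+\<^sup>1 p m\<^sub>l\<^sup>(\<^sup>k\<^sup>)\<close>
  and its mirror image, hence the signs of these derivatives, the cancellations in \<open>f\<^sup>(\<^sup>i\<^sup>)\<close> and the
  finiteness of the suprema in the constants.
\<close>

section \<open>Almost everywhere differentiability of Lipschitz functions\<close>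

text \<open>An open interval is the ball about its midpoint, so this is the Vitali covering theorem
  for balls. The intervals need only contain the point rather than be centred at it; keeping only
  those inside \<open>G\<close> keeps the union there.\<close>

lemma vitali_intervals:
  fixes S G :: "real set"
  assumes "open G" "S \<subseteq> G"
    and fine: "\<And>x d. x \<in> S \<Longrightarrow> 0 < d \<Longrightarrow> \<exists>u v. u < x \<and> x < v \<and> v - u < d \<and> Q u v"
  obtains C where "countable C" "\<And>u v. (u, v) \<in> C \<Longrightarrow> u < v \<and> Q u v"
    "disjoint_family_on (\<lambda>(u, v). {u<..<v}) C"
    "(\<Union>(u, v)\<in>C. {u<..<v}) \<subseteq> G" "negligible (S - (\<Union>(u, v)\<in>C. {u<..<v}))"
proof -
  define K where "K = {(u, v). u < v \<and> Q u v \<and> {u<..<v} \<subseteq> G}"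
  define c where "c = (\<lambda>(u, v). (u + v) / 2 :: real)"
  define r where "r = (\<lambda>(u, v). (v - u) / 2 :: real)"
  have ball: "ball (c i) (r i) = (case i of (u, v) \<Rightarrow> {u<..<v})" for i
    by (cases i) (auto simp: c_def r_def ball_eq_greaterThanLessThan field_simps)
  have fine': "\<exists>i. i \<in> K \<and> x \<in> ball (c i) (r i) \<and> r i < d" if x: "x \<in> S" "0 < d" for x d
  proof -
    obtain e where e: "e > 0" "ball x e \<subseteq> G"
      using assms x by (meson open_contains_ball subsetD)
    obtain u v where uv: "u < x" "x < v" "v - u < min d e" "Q u v"
      using fine[OF x(1), of "min d e"] x e by auto
    have "{u<..<v} \<subseteq> ball x e"
      using uv by (auto simp: ball_eq_greaterThanLessThan)
    then have "(u, v) \<in> K" using uv e by (auto simp: K_def)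
    then show ?thesis using uv x unfolding ball
      by (intro exI[of _ "(u, v)"]) (auto simp: r_def)
  qed
  obtain C where
    C: "countable C" "C \<subseteq> K" "pairwise (\<lambda>i j. disjnt (ball (c i) (r i)) (ball (c j) (r j))) C"
      "negligible (S - (\<Union>i \<in> C. ball (c i) (r i)))"
    using Vitali_covering_theorem_balls[of S K c r, OF fine'] by blast
  show ?thesis
  proof (rule that[of C])
    show "disjoint_family_on (\<lambda>(u, v). {u<..<v}) C"
      using C(3) unfolding ball disjoint_family_on_def pairwise_def disjnt_def by blast
    show "u < v \<and> Q u v" if "(u, v) \<in> C" for u v
      using C(2) that by (auto simp: K_def)
    show "(\<Union>(u, v)\<in>C. {u<..<v}) \<subseteq> G"
      using C(2) by (force simp: K_def)
    show "negligible (S - (\<Union>(u, v)\<in>C. {u<..<v}))"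
      using C(4) by (simp only: ball)
  qed (fact C(1))
qed

section \<open>Stieltjes measures and secant slopes of monotone functions\<close>

lemma emeasure_interval_measure_open:
  assumes "mono F" "continuous_on UNIV F" "u < v"
  shows "emeasure (interval_measure F) {u<..<v} = ennreal (F v - F u)"
proof -
  have F: "\<And>x y. x \<le> y \<Longrightarrow> F x \<le> F y" "\<And>a. continuous (at_right a) F" "isCont F v"
    using assms by (auto simp: mono_def continuous_on_eq_continuous_at intro: continuous_at_imp_continuous_at_within)
  have v: "emeasure (interval_measure F) {v} = 0"
    using emeasure_interval_measure_Icc[of v v F] assms F
    by (simp add: continuous_on_subset[OF assms(2)])
  have "emeasure (interval_measure F) ({u<..v} - {v}) = emeasure (interval_measure F) {u<..v} - emeasure (interval_measure F) {v}"
    by (rule emeasure_Diff) (use assms v in auto)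
  moreover have "{u<..v} - {v} = {u<..<v}" using assms by auto
  ultimately show ?thesis using assms F v by (simp add: emeasure_interval_measure_Ioc)
qed

lemma emeasure_UN_mono_countable:
  assumes "countable C" "disjoint_family_on X C" "\<And>i. i \<in> C \<Longrightarrow> X i \<in> sets M"
    "sets N = sets M" "\<And>i. i \<in> C \<Longrightarrow> c * emeasure M (X i) \<le> d * emeasure N (X i)"
  shows "c * emeasure M (\<Union>i\<in>C. X i) \<le> d * emeasure N (\<Union>i\<in>C. X i)"
proof -
  have "c * emeasure M (\<Union>i\<in>C. X i) = (\<integral>\<^sup>+i. c * emeasure M (X i) \<partial>count_space C)"
    using assms by (subst emeasure_UN_countable) (auto simp: nn_integral_cmult)
  also have "\<dots> \<le> (\<integral>\<^sup>+i. d * emeasure N (X i) \<partial>count_space C)"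
    using assms by (intro nn_integral_mono) auto
  also have "\<dots> = d * emeasure N (\<Union>i\<in>C. X i)"
    using assms by (subst emeasure_UN_countable) (auto simp: nn_integral_cmult)
  finally show ?thesis .
qed

lemma emeasure_lborel_negligible_Diff:
  assumes "S \<in> sets borel" "T \<in> sets borel" "negligible (S - T)"
  shows "emeasure lborel S \<le> emeasure lborel T"
proof -
  have "S - T \<in> null_sets lborel"
    using assms by (auto simp: negligible_iff_null_sets null_sets_def)
  have "emeasure lborel S \<le> emeasure lborel ((S - T) \<union> T)" 
    using assms by (intro emeasure_mono) auto
  also have "\<dots> \<le> emeasure lborel (S - T) + emeasure lborel T"
    using assms by (intro emeasure_subadditive) auto
  finally show ?thesis using \<open>S - T \<in> null_sets lborel\<close> by (auto simp: null_sets_def)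
qed

text \<open>Vitali selects disjoint intervals with secant slope above \<open>\<beta>\<close>. Each
  has Stieltjes measure at least \<open>\<beta>\<close> times its length, they lie in
  \<open>G\<close>, and they cover \<open>S\<close> up to a null set.\<close>

lemma interval_measure_lower_bound:
  fixes F :: "real \<Rightarrow> real" and S :: "real set"
  assumes F: "mono F" "continuous_on UNIV F" and "0 \<le> \<beta>"
    and S: "open G" "S \<subseteq> G" "S \<in> sets borel"
    and fine: "\<And>x d. x \<in> S \<Longrightarrow> 0 < d \<Longrightarrow>
      \<exists>u v. u < x \<and> x < v \<and> v - u < d \<and> \<beta> * (v - u) < F v - F u"
  shows "ennreal \<beta> * emeasure lborel S \<le> emeasure (interval_measure F) G"
proof -
  obtain C where C: "countable C" "\<And>u v. (u, v) \<in> C \<Longrightarrow> u < v \<and> \<beta> * (v - u) < F v - F u"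
    "disjoint_family_on (\<lambda>(u, v). {u<..<v}) C"
    "(\<Union>(u, v)\<in>C. {u<..<v}) \<subseteq> G" "negligible (S - (\<Union>(u, v)\<in>C. {u<..<v}))"
    using vitali_intervals[OF S(1,2) fine] by metis
  let ?T = "\<Union>(u, v)\<in>C. {u<..<v}"
  have T: "open ?T" by (auto intro!: open_UN)
  have "ennreal \<beta> * emeasure lborel S \<le> ennreal \<beta> * emeasure lborel ?T"
    using emeasure_lborel_negligible_Diff[OF S(3) _ C(5)] T by (simp add: mult_left_mono)
  also have "\<dots> \<le> 1 * emeasure (interval_measure F) ?T"
    using C assms
    by (intro emeasure_UN_mono_countable)
      (auto simp: emeasure_interval_measure_open less_imp_le simp flip: ennreal_mult' intro!: ennreal_leI)
  also have "\<dots> \<le> emeasure (interval_measure F) G"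
    using C S by (auto intro!: emeasure_mono)
  finally show ?thesis .
qed

text \<open>Flat secants selected inside an open \<open>G\<close> slightly larger than
  \<open>S\<close> give a union \<open>?T\<close> of Stieltjes measure at most
  \<open>\<alpha> * (?l + e)\<close>; steep secants inside \<open>?T\<close> give at least
  \<open>\<beta> * ?l\<close>. Small \<open>e\<close> forces \<open>?l = 0\<close>.\<close>

lemma null_sets_distinct_derivates:
  fixes F :: "real \<Rightarrow> real" and S :: "real set"
  assumes F: "mono F" "continuous_on UNIV F" and "0 \<le> \<alpha>" "\<alpha> < \<beta>"
    and S: "S \<subseteq> {a<..<b}" "S \<in> sets borel"
    and lo: "\<And>x d. x \<in> S \<Longrightarrow> 0 < d \<Longrightarrow>
      \<exists>u v. u < x \<and> x < v \<and> v - u < d \<and> F v - F u < \<alpha> * (v - u)"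
    and hi: "\<And>x d. x \<in> S \<Longrightarrow> 0 < d \<Longrightarrow>
      \<exists>u v. u < x \<and> x < v \<and> v - u < d \<and> \<beta> * (v - u) < F v - F u"
  shows "S \<in> null_sets lborel"
proof -
  let ?l = "measure lborel S"
  have "emeasure lborel S \<le> emeasure lborel {a<..<b}"
    using S(1) by (intro emeasure_mono) simp_all
  then have fin: "emeasure lborel S < \<infinity>"
    by (cases "a \<le> b") (auto intro: le_less_trans)
  then have l: "emeasure lborel S = ennreal ?l" by (simp add: emeasure_eq_ennreal_measure)
  have main: "\<beta> * ?l \<le> \<alpha> * (?l + e)" if e: "e > 0" for e
  proof -
    obtain G where G: "open G" "S \<subseteq> G" "emeasure lebesgue (G - S) < ennreal e"
      using sets_lebesgue_outer_open[of S e] S e by (metis sets_completionI_sets sets_lborel)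
    obtain C where C: "countable C" "\<And>u v. (u, v) \<in> C \<Longrightarrow> u < v \<and> F v - F u < \<alpha> * (v - u)"
      "disjoint_family_on (\<lambda>(u, v). {u<..<v}) C"
      "(\<Union>(u, v)\<in>C. {u<..<v}) \<subseteq> G" "negligible (S - (\<Union>(u, v)\<in>C. {u<..<v}))"
      using vitali_intervals[OF G(1,2) lo] by metis
    let ?T = "\<Union>(u, v)\<in>C. {u<..<v}"
    have T: "open ?T" by (auto intro!: open_UN)
    have "emeasure lborel S \<le> emeasure lborel (S \<inter> ?T)"
      by (rule emeasure_lborel_negligible_Diff) (use S T C(5) in \<open>auto simp: Diff_Int\<close>)
    then have "ennreal \<beta> * emeasure lborel S \<le> ennreal \<beta> * emeasure lborel (S \<inter> ?T)"
      by (simp add: mult_left_mono)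
    \<comment> \<open>The steep secants are taken inside \<open>?T\<close>, by a second Vitali
      selection, so that both estimates concern the same open set.\<close>
    also have "\<dots> \<le> emeasure (interval_measure F) ?T"
      using assms T by (intro interval_measure_lower_bound) auto
    also have "\<dots> \<le> ennreal \<alpha> * emeasure lborel ?T"
    proof -
      have "1 * emeasure (interval_measure F) ?T \<le> ennreal \<alpha> * emeasure lborel ?T"
        using C assms
        by (intro emeasure_UN_mono_countable)
          (auto simp: emeasure_interval_measure_open less_imp_le simp flip: ennreal_mult' intro!: ennreal_leI)
      then show ?thesis by simp
    qed
    also have "\<dots> \<le> ennreal \<alpha> * emeasure lborel G"
      using C G by (intro mult_left_mono emeasure_mono) auto
    also have "emeasure lborel G \<le> emeasure lborel S + emeasure lborel (G - S)"
    proof -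
      have "emeasure lborel (S \<union> (G - S)) \<le> emeasure lborel S + emeasure lborel (G - S)"
        using S G by (intro emeasure_subadditive) auto
      moreover have "S \<union> (G - S) = G" using G by auto
      ultimately show ?thesis by simp
    qed
    also have "\<dots> \<le> ennreal ?l + ennreal e"
      using G S l by (intro add_mono) auto
    finally show ?thesis using assms e
      by (simp add: l mult_left_mono flip: ennreal_mult' ennreal_plus)
  qed
  have "?l = 0"
  proof (rule ccontr)
    assume "?l \<noteq> 0"
    then have "?l > 0" by (simp add: less_le)
    \<comment> \<open>Makes \<open>\<alpha> * e\<close> at most half of
      \<open>(\<beta> - \<alpha>) * ?l\<close>; the summand 1 avoids a zero denominator.\<close>
    define e where "e = (\<beta> - \<alpha>) * ?l / (2 * (\<alpha> + 1))"
    have e: "e > 0" using assms \<open>?l > 0\<close> by (simp add: e_def)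
    have "\<alpha> * e \<le> (\<beta> - \<alpha>) * ?l / 2"
      using assms \<open>?l > 0\<close> by (simp add: e_def field_simps)
    then have "(\<beta> - \<alpha>) * ?l \<le> (\<beta> - \<alpha>) * ?l / 2"
      using main[OF e] by (simp add: algebra_simps)
    moreover have "(\<beta> - \<alpha>) * ?l > 0" using assms \<open>?l > 0\<close> by simp
    ultimately show False by simp
  qed
  then show ?thesis using l S by (auto simp: null_sets_def)
qed

text \<open>In a rising secant from \<open>x\<close> to a nearby point, the end at \<open>x\<close>
  can be moved slightly to the other side of \<open>x\<close>, continuity preserving the strict
  inequality. This turns difference quotients at \<open>x\<close> into the straddling intervals of
  the Vitali argument.\<close>

lemma secants_straddling:
  fixes H :: "real \<Rightarrow> real"
  assumes H: "continuous_on UNIV H"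
    and "\<exists>\<^sub>F y in at x. (H y - H x) / (y - x) > 0" and "d > 0"
  shows "\<exists>u v. u < x \<and> x < v \<and> v - u < d \<and> H u < H v"
proof -
  obtain y where y: "y \<noteq> x" "dist y x < d / 2" "(H y - H x) / (y - x) > 0"
  proof -
    have "\<exists>y. y \<noteq> x \<and> dist y x < d / 2 \<and> (H y - H x) / (y - x) > 0"
      using assms(2) unfolding frequently_def eventually_at using \<open>d > 0\<close> by (metis half_gt_zero UNIV_I)
    then show ?thesis using that by blast
  qed
  have lim: "(H \<longlongrightarrow> H x) (at x)"
    using H by (auto simp: continuous_on_eq_continuous_at isCont_def)
  show ?thesis
  proof (cases "x < y")
    case True
    then have "H x < H y" using y by (simp add: zero_less_divide_iff)
    then have "eventually (\<lambda>u. H u < H y) (at_left x)"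
      using order_tendstoD(2)[OF lim] by (auto simp: eventually_at_split)
    moreover have "eventually (\<lambda>u. u \<in> {x - d / 2<..<x}) (at_left x)"
      by (rule eventually_at_left_real) (use assms in auto)
    ultimately have "eventually (\<lambda>u. H u < H y \<and> u \<in> {x - d / 2<..<x}) (at_left x)"
      by (rule eventually_conj)
    then obtain u where "H u < H y" "x - d / 2 < u" "u < x"
      using eventually_happens[of _ "at_left x"] by (auto simp: trivial_limit_at_left_real)
    then show ?thesis using True y by (intro exI[of _ u] exI[of _ y]) (auto simp: dist_real_def)
  next
    case False
    then have "H y < H x" using y by (simp add: zero_less_divide_iff)
    then have "eventually (\<lambda>v. H y < H v) (at_right x)"
      using order_tendstoD(1)[OF lim] by (auto simp: eventually_at_split)
    moreover have "eventually (\<lambda>u. u \<in> {x<..<x + d / 2}) (at_right x)"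
      by (rule eventually_at_right_real) (use assms in auto)
    ultimately have "eventually (\<lambda>v. H y < H v \<and> v \<in> {x<..<x + d / 2}) (at_right x)"
      by (rule eventually_conj)
    then obtain v where "H y < H v" "x < v" "v < x + d / 2"
      using eventually_happens[of _ "at_right x"] by (auto simp: trivial_limit_at_right_real)
    then show ?thesis using False y by (intro exI[of _ y] exI[of _ v]) (auto simp: dist_real_def)
  qed
qed

text \<open>For each mesh \<open>1 / (n + 1)\<close> the points lying in some admissible interval
  form a union of open intervals, whatever \<open>P\<close> is; the set is the countable
  intersection of these.\<close>

lemma borel_fine_straddling:
  "{x :: real. \<forall>d>0. \<exists>u v. u < x \<and> x < v \<and> v - u < d \<and> P u v} \<in> sets borel"
proof -
  let ?O = "\<lambda>n. \<Union>(u, v)\<in>{(u, v). v - u < inverse (real (Suc n)) \<and> P u v}. {u<..<v}"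
  have "(\<Inter>n. ?O n) \<in> sets borel"
    by (intro sets.countable_INT') (auto intro!: borel_open open_UN)
  also have "(\<Inter>n. ?O n) = {x. \<forall>d>0. \<exists>u v. u < x \<and> x < v \<and> v - u < d \<and> P u v}"
  proof (intro set_eqI iffI; clarsimp)
    fix x d :: real
    assume x: "\<forall>n. \<exists>u v. v - u < inverse (1 + real n) \<and> P u v \<and> u < x \<and> x < v" and "d > 0"
    obtain n where "inverse (real (Suc n)) < d" using reals_Archimedean[OF \<open>d > 0\<close>] by blast
    moreover obtain u v where "v - u < inverse (1 + real n)" "P u v" "u < x" "x < v" using x by blast
    ultimately show "\<exists>u<x. \<exists>v>x. v - u < d \<and> P u v"
      by (intro exI[of _ u] conjI exI[of _ v]) (auto simp: add.commute)
  next
    fix x and n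
    assume "\<forall>d>0. \<exists>u<x. \<exists>v>x. v - u < d \<and> P u v"
    then show "\<exists>u v. v - u < inverse (1 + real n) \<and> P u v \<and> u < x \<and> x < v"
      by (auto dest!: spec[of _ "inverse (1 + real n)"])
  qed
  finally show ?thesis .
qed

lemma secant_diff_linear:
  fixes F :: "real \<Rightarrow> real"
  assumes "y \<noteq> x"
  shows "(c * y - F y - (c * x - F x)) / (y - x) = c - (F y - F x) / (y - x)"
    "(F y - c * y - (F x - c * x)) / (y - x) = (F y - F x) / (y - x) - c"
  using assms by (auto simp: field_simps)

text \<open>Lebesgue's argument: where the lower and upper derivates differ, two rationals separate
  them, so the exceptional set is a countable union of null sets. The Lipschitz bound keeps the
  common value finite.\<close>

lemma mono_lipschitz_AE_differentiable:
  fixes F :: "real \<Rightarrow> real"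
  assumes "mono F" and L: "L-lipschitz_on UNIV F"
  obtains N where "N \<in> null_sets lborel" "\<And>x. x \<in> {a<..<b} - N \<Longrightarrow> F differentiable (at x)"
proof -
  have cont: "continuous_on UNIV F" using L by (rule lipschitz_on_continuous_on)
  define lo where "lo \<alpha> = {x. \<forall>d>0. \<exists>u v. u < x \<and> x < v \<and> v - u < d \<and> F v - F u < \<alpha> * (v - u)}" for \<alpha>
  define hi where "hi \<beta> = {x. \<forall>d>0. \<exists>u v. u < x \<and> x < v \<and> v - u < d \<and> \<beta> * (v - u) < F v - F u}" for \<beta>
  define I where "I = {(\<alpha>, \<beta>). \<alpha> \<in> \<rat> \<and> \<beta> \<in> \<rat> \<and> 0 \<le> \<alpha> \<and> \<alpha> < (\<beta>::real)}"
  define N where "N = (\<Union>(\<alpha>, \<beta>)\<in>I. {a<..<b} \<inter> lo \<alpha> \<inter> hi \<beta>)"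
  have "I \<subseteq> \<rat> \<times> \<rat>" by (auto simp: I_def)
  then have "countable I" by (rule countable_subset) (auto intro: countable_SIGMA countable_rat)
  moreover have "{a<..<b} \<inter> lo \<alpha> \<inter> hi \<beta> \<in> null_sets lborel" if "(\<alpha>, \<beta>) \<in> I" for \<alpha> \<beta>
  proof (rule null_sets_distinct_derivates[OF assms(1) cont, of \<alpha> \<beta> _ a b])
    show "{a<..<b} \<inter> lo \<alpha> \<inter> hi \<beta> \<in> sets borel"
      unfolding lo_def hi_def by (intro sets.Int borel_fine_straddling) auto
  qed (use that in \<open>auto simp: I_def lo_def hi_def\<close>)
  ultimately have "N \<in> null_sets lborel"
    unfolding N_def by (intro null_sets_UN') auto
  moreover have "F differentiable (at x)" if x: "x \<in> {a<..<b} - N" for x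
  proof -
    define q where "q y = (F y - F x) / (y - x)" for y
    have q0: "ereal (q y) \<ge> 0" for y
      using \<open>mono F\<close> unfolding q_def by (auto simp: mono_def zero_le_divide_iff) (meson linear)
    have qL: "ereal (q y) \<le> ereal L" for y
    proof -
      have "\<bar>F y - F x\<bar> \<le> L * \<bar>y - x\<bar>" using lipschitz_onD[OF L, of y x] by (simp add: dist_real_def)
      then have "\<bar>q y\<bar> \<le> L" using lipschitz_on_nonneg[OF L]
        by (cases "y = x") (auto simp: q_def field_simps)
      then show ?thesis by auto
    qed
    let ?l = "Liminf (at x) (\<lambda>y. ereal (q y))" and ?u = "Limsup (at x) (\<lambda>y. ereal (q y))"
    have lu: "?l \<le> ?u" by (rule Liminf_le_Limsup) simp
    have l0: "0 \<le> ?l" by (intro Liminf_bounded always_eventually allI q0)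
    have uL: "?u \<le> ereal L" by (intro Limsup_bounded always_eventually allI qL)
    have "\<not> ?l < ?u"
    proof
      assume "?l < ?u"
      then obtain \<alpha> where \<alpha>: "?l < ereal (real_of_rat \<alpha>)" "ereal (real_of_rat \<alpha>) < ?u"
        using ereal_dense3 by blast
      then obtain \<beta> where \<beta>: "ereal (real_of_rat \<alpha>) < ereal (real_of_rat \<beta>)" "ereal (real_of_rat \<beta>) < ?u"
        using ereal_dense3 by blast
      have fl: "\<exists>\<^sub>F y in at x. q y < real_of_rat \<alpha>"
      proof (rule ccontr)
        assume "\<not> ?thesis"
        then have "ereal (real_of_rat \<alpha>) \<le> ?l"
          by (intro Liminf_bounded) (simp add: not_frequently not_less)
        then show False using \<alpha> by simp
      qed
      have fu: "\<exists>\<^sub>F y in at x. real_of_rat \<beta> < q y"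
      proof (rule ccontr)
        assume "\<not> ?thesis"
        then have "?u \<le> ereal (real_of_rat \<beta>)"
          by (intro Limsup_bounded) (simp add: not_frequently not_less)
        then show False using \<beta> by simp
      qed
      have ne: "\<forall>\<^sub>F y in at x. y \<noteq> x" by (simp add: eventually_at_filter)
      \<comment> \<open>Tilting by a linear function turns a slope below
        \<open>real_of_rat \<alpha>\<close> into a positive slope, the form that
        \<open>secants_straddling\<close> takes.\<close>
      have "x \<in> lo (real_of_rat \<alpha>)"
      proof -
        have *: "\<exists>\<^sub>F y in at x. (real_of_rat \<alpha> * y - F y - (real_of_rat \<alpha> * x - F x)) / (y - x) > 0"
          using frequently_rev_mp[OF fl eventually_mono[OF ne]]
          by (auto simp: secant_diff_linear q_def)
        have "continuous_on UNIV (\<lambda>s. real_of_rat \<alpha> * s - F s)" by (intro continuous_intros cont)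
        from secants_straddling[OF this *] show ?thesis
          unfolding lo_def by (simp add: algebra_simps)
      qed
      moreover have "x \<in> hi (real_of_rat \<beta>)"
      proof -
        have *: "\<exists>\<^sub>F y in at x. (F y - real_of_rat \<beta> * y - (F x - real_of_rat \<beta> * x)) / (y - x) > 0"
          using frequently_rev_mp[OF fu eventually_mono[OF ne]]
          by (auto simp: secant_diff_linear q_def)
        have "continuous_on UNIV (\<lambda>s. F s - real_of_rat \<beta> * s)" by (intro continuous_intros cont)
        from secants_straddling[OF this *] show ?thesis
          unfolding hi_def by (simp add: algebra_simps)
      qed
      moreover have "(real_of_rat \<alpha>, real_of_rat \<beta>) \<in> I"
        using \<beta> le_less_trans[OF l0 \<alpha>(1)] by (simp add: I_def)
      ultimately show False using x by (auto simp: N_def)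
    qed
    then have eq: "?l = ?u" using lu by simp
    have "0 \<le> ?u" using l0 lu by (rule order_trans)
    then obtain D where D: "?u = ereal D" using uL by (cases ?u) auto
    have "((\<lambda>y. ereal (q y)) \<longlongrightarrow> ereal D) (at x)"
      using eq D by (intro Liminf_eq_Limsup) auto
    then have "(F has_field_derivative D) (at x)"
      by (simp add: has_field_derivative_iff q_def)
    then show ?thesis by (auto simp: differentiable_def has_field_derivative_def)
  qed
  ultimately show ?thesis by (rule that)
qed

text \<open>Adding \<open>L * x\<close> makes \<open>g\<close> monotone without affecting
  differentiability.\<close>

lemma lipschitz_AE_differentiable:
  fixes g :: "real \<Rightarrow> real"
  assumes L: "L-lipschitz_on UNIV g"
  obtains N where "N \<in> null_sets lborel" "\<And>x. x \<in> {a<..<b} - N \<Longrightarrow> g differentiable (at x)"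
proof -
  let ?F = "\<lambda>x. g x + L * x"
  have "mono ?F"
  proof
    fix x y :: real assume "x \<le> y"
    moreover have "\<bar>g x - g y\<bar> \<le> L * \<bar>x - y\<bar>" using lipschitz_onD[OF L, of x y] by (simp add: dist_real_def)
    ultimately show "?F x \<le> ?F y" by (auto simp: algebra_simps)
  qed
  moreover have "(L + \<bar>L\<bar> * 1)-lipschitz_on UNIV ?F"
    by (intro lipschitz_intros L) (auto intro: lipschitz_on_id)
  ultimately obtain N where N: "N \<in> null_sets lborel" "\<And>x. x \<in> {a<..<b} - N \<Longrightarrow> ?F differentiable (at x)"
    using mono_lipschitz_AE_differentiable by metis
  have "g differentiable (at x)" if "x \<in> {a<..<b} - N" for x
  proof -
    have "(\<lambda>x. ?F x - L * x) differentiable (at x)"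
      by (rule differentiable_diff[OF N(2)[OF that]]) simp
    moreover have "(\<lambda>x. ?F x - L * x) = g" by auto
    ultimately show ?thesis by (simp only:)
  qed
  with N(1) show ?thesis by (rule that)
qed

text \<open>A mean value inequality with an exceptional null set. For
  \<open>C = max L (K + 1)\<close> the function \<open>C * x - g x\<close> is monotone with
  derivative at least \<open>C - K\<close> off \<open>N\<close>, so its increment over the interval
  is at least \<open>(C - K - e) * (v - u)\<close> for every small \<open>e\<close>.\<close>

lemma lipschitz_AE_deriv_le:
  fixes g :: "real \<Rightarrow> real"
  assumes L: "L-lipschitz_on UNIV g" and "N \<in> null_sets lborel"
    and D: "\<And>x. x \<in> {u<..<v} - N \<Longrightarrow> \<exists>D. (g has_field_derivative D) (at x) \<and> D \<le> K" and "u < v"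
  shows "g v - g u \<le> K * (v - u)"
proof -
  \<comment> \<open>The bound \<open>L\<close> gives monotonicity, and \<open>K + 1\<close> keeps
    the slope \<open>?\<beta>\<close> used below positive for \<open>e < 1\<close>.\<close>
  define F where "F = (\<lambda>x. (max L (K + 1)) * x - g x)"
  have g: "\<bar>g x - g y\<bar> \<le> max L (K + 1) * \<bar>x - y\<bar>" for x y
    using lipschitz_onD[OF L, of x y] mult_right_mono[of L "max L (K + 1)" "\<bar>x - y\<bar>"]
    by (simp add: dist_real_def)
  have F: "mono F"
  proof
    fix x y :: real assume "x \<le> y"
    then show "F x \<le> F y" using g[of x y] unfolding F_def by (auto simp: algebra_simps)
  qed
  have cont: "continuous_on UNIV F"
    unfolding F_def by (intro continuous_intros lipschitz_on_continuous_on[OF L])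
  have "g v - g u \<le> (K + e) * (v - u)" if e: "0 < e" "e < 1" for e
  proof -
    let ?\<beta> = "max L (K + 1) - K - e"
    have "ennreal ?\<beta> * emeasure lborel ({u<..<v} - N) \<le> emeasure (interval_measure F) {u<..<v}"
    proof (rule interval_measure_lower_bound[OF F cont])
      fix x d :: real assume x: "x \<in> {u<..<v} - N" and "0 < d"
      obtain D' where D': "(g has_field_derivative D') (at x)" "D' \<le> K" using D[OF x] by blast
      have "((\<lambda>s. F s - ?\<beta> * s) has_field_derivative (max L (K + 1) - D' - ?\<beta>)) (at x)"
        unfolding F_def by (auto intro!: derivative_eq_intros D')
      then have "((\<lambda>y. (F y - ?\<beta> * y - (F x - ?\<beta> * x)) / (y - x)) \<longlongrightarrow> max L (K + 1) - D' - ?\<beta>) (at x)"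
        by (simp add: has_field_derivative_iff)
      then have "\<forall>\<^sub>F y in at x. (F y - ?\<beta> * y - (F x - ?\<beta> * x)) / (y - x) > 0"
        by (rule order_tendstoD) (use D' e in auto)
      then have "\<exists>\<^sub>F y in at x. (F y - ?\<beta> * y - (F x - ?\<beta> * x)) / (y - x) > 0"
        by (intro eventually_frequently) auto
      moreover have "continuous_on UNIV (\<lambda>s. F s - ?\<beta> * s)" by (intro continuous_intros cont)
      ultimately have "\<exists>u v. u < x \<and> x < v \<and> v - u < d \<and> F u - ?\<beta> * u < F v - ?\<beta> * v"
        using \<open>0 < d\<close> by (intro secants_straddling)
      then show "\<exists>u v. u < x \<and> x < v \<and> v - u < d \<and> ?\<beta> * (v - u) < F v - F u"
        by (simp add: algebra_simps)
    qed (use e assms in auto)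
    also have "emeasure lborel ({u<..<v} - N) = emeasure lborel {u<..<v}"
      using assms by (intro emeasure_Diff_null_set) auto
    finally have "ennreal (?\<beta> * (v - u)) \<le> ennreal (F v - F u)"
      using assms e by (simp add: emeasure_interval_measure_open F cont ennreal_mult')
    moreover have "F v - F u \<ge> 0" using F \<open>u < v\<close> by (simp add: mono_def)
    ultimately have "?\<beta> * (v - u) \<le> F v - F u" by simp
    then show ?thesis unfolding F_def by (simp add: algebra_simps)
  qed
  note main = this
  show ?thesis
  proof (rule field_le_epsilon)
    fix e :: real assume "e > 0"
    define d where "d = min (1 / 2) (e / (v - u))"
    have d: "0 < d" "d < 1" "d * (v - u) \<le> e" using \<open>e > 0\<close> \<open>u < v\<close>
      by (auto simp: d_def min_def field_simps)
    then show "g v - g u \<le> K * (v - u) + e" using main[of d] by (simp add: algebra_simps)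
  qed
qed

section \<open>The essential supremum norm\<close>

text \<open>\<open>real_of_ereal\<close> is faithful only on finite values. The bound
  \<open>C\<close> excludes infinity, and since \<open>[0,1]\<close> has nonzero measure the
  essential supremum of a nonnegative function is nonnegative.\<close>

lemma ess_norm_AE:
  assumes f: "f \<in> borel_measurable (lebesgue_on {0..1})"
    and C: "AE x in lebesgue_on {0..1}. \<bar>f x\<bar> \<le> C"
  shows "AE x in lebesgue_on {0..1}. \<bar>f x\<bar> \<le> ess_norm f"
proof -
  let ?s = "esssup (lebesgue_on {0..1}) (\<lambda>x. ereal \<bar>f x\<bar>)"
  have m: "(\<lambda>x. ereal \<bar>f x\<bar>) \<in> borel_measurable (lebesgue_on {0..1})" using f by measurable
  have "?s \<le> ereal C" using m C by (intro esssup_I) auto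
  moreover have "0 \<le> ?s"
  proof -
    have "emeasure (lebesgue_on {0..1::real}) (space (lebesgue_on {0..1})) \<noteq> 0"
      by (simp add: emeasure_restrict_space)
    from esssup_const[OF this, of "0::ereal"] show ?thesis
      using esssup_mono[of "\<lambda>x. 0" "lebesgue_on {0..1}" "\<lambda>x. ereal \<bar>f x\<bar>"] by auto
  qed
  ultimately obtain r where r: "?s = ereal r" "r \<ge> 0" by (cases ?s) auto
  then have e: "ess_norm f = r" by (simp add: ess_norm_def)
  show "AE x in lebesgue_on {0..1}. \<bar>f x\<bar> \<le> ess_norm f"
    using esssup_AE[of "\<lambda>x. ereal \<bar>f x\<bar>" "lebesgue_on {0..1}"] unfolding r e by simp
qed

lemma AE_lebesgue_on_imp_null_set:
  assumes "AE x in lebesgue_on {a..b}. P x"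
  obtains N :: "real set" where "N \<in> null_sets lborel" "\<And>x. x \<in> {a..b} - N \<Longrightarrow> P x"
proof -
  have "AE x in lebesgue. x \<in> {a..b} \<longrightarrow> P x"
    using assms by (subst (asm) AE_restrict_space_iff) auto
  then have "AE x in lborel. x \<in> {a..b} \<longrightarrow> P x"
    by (simp add: AE_completion_iff)
  then obtain N where "N \<in> null_sets lborel" "{x. \<not> (x \<in> {a..b} \<longrightarrow> P x)} \<subseteq> N"
    unfolding eventually_ae_filter by auto
  then show ?thesis by (intro that[of N]) auto
qed

text \<open>The essential bound holds off a null set, whose complement is dense; continuity carries
  it to every point, end points included.\<close>

lemma ess_norm_continuous:
  assumes g: "continuous_on {0..1} g"
    and x: "x \<in> {0..1}"
  shows "\<bar>g x\<bar> \<le> ess_norm g"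
proof -
  have "bounded (g ` {0..1})" using compact_continuous_image[OF g] compact_imp_bounded by auto
  then obtain C where C: "\<And>x. x \<in> {0..1} \<Longrightarrow> \<bar>g x\<bar> \<le> C"
    unfolding bounded_real by blast
  have m: "g \<in> borel_measurable (lebesgue_on {0..1})"
    by (rule continuous_imp_measurable_on_sets_lebesgue[OF g]) auto
  have "AE x in lebesgue_on {0..1}. \<bar>g x\<bar> \<le> C" using C by (intro AE_I2) auto
  note * = ess_norm_AE[OF m this]
  obtain N where N: "N \<in> null_sets lborel" "\<And>x. x \<in> {0..1} - N \<Longrightarrow> \<bar>g x\<bar> \<le> ess_norm g"
    using AE_lebesgue_on_imp_null_set[OF *] by metis
  have "closure ({0<..<1} - N) = {0..1::real}"
  proof -
    have "negligible N" using N by (auto simp: negligible_iff_null_sets null_sets_completionI)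
    then have "{0<..<1} \<subseteq> closure ({0<..<1} - N)"
    proof (intro subsetI, unfold closure_approachable, intro allI impI)
      fix x e :: real assume x: "x \<in> {0<..<1}" "e > 0"
      have "\<not> negligible ({0<..<1} \<inter> ball x e)"
        using x by (intro open_not_negligible) auto
      then have "\<not> {0<..<1} \<inter> ball x e \<subseteq> N" using \<open>negligible N\<close> negligible_subset by blast
      then obtain y where "y \<in> {0<..<1} - N" "y \<in> ball x e" by blast
      then show "\<exists>y\<in>{0<..<1} - N. dist y x < e" by (intro bexI[of _ y]) (simp_all add: dist_commute)
    qed
    then have "closure {0<..<1} \<subseteq> closure ({0<..<1::real} - N)" by (rule closure_minimal) auto
    moreover have "closure ({0<..<1::real} - N) \<subseteq> closure {0<..<1}" by (rule closure_mono) auto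
    ultimately show ?thesis by auto
  qed
  then show ?thesis
    using continuous_on_closure_norm_le[of "{0<..<1} - N" g "ess_norm g" x] g N(2) x by auto
qed

section \<open>Lipschitz functions and the essential supremum of their derivative\<close>

lemma deriv01_interior:
  fixes g :: "real \<Rightarrow> real"
  assumes "0 < x" "x < 1" "(g has_field_derivative D) (at x)"
  shows "deriv01 g x = D"
  using assms unfolding deriv01_def
  by (simp add: at_within_Icc_at vector_derivative_at has_real_derivative_iff_has_vector_derivative)

text \<open>The derivative exists almost everywhere, is measurable and is bounded by
  \<open>L\<close>, so its essential norm is a genuine almost everywhere bound;
  \<open>lipschitz_AE_deriv_le\<close> for \<open>g\<close> and for its negative concludes. This
  makes the norm of the third derivative a Lipschitz constant of the second.\<close>

lemma lipschitz_ess_norm_deriv01: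
  assumes L: "L-lipschitz_on {0..1} g" and xy: "x \<in> {0..1}" "y \<in> {0..1}"
  shows "\<bar>g y - g x\<bar> \<le> ess_norm (deriv01 g) * \<bar>y - x\<bar>"
proof -
  \<comment> \<open>Clamping the argument to \<open>[0,1]\<close> extends \<open>g\<close> to the
    whole line with the same Lipschitz constant.\<close>
  define G where "G = (\<lambda>x. g (max 0 (min 1 x)))"
  have G_eq: "G x = g x" if "x \<in> {0..1}" for x using that by (simp add: G_def)
  have LG: "L-lipschitz_on UNIV G"
  proof (rule lipschitz_onI)
    fix x y :: real
    have "dist (G x) (G y) \<le> L * dist (max 0 (min 1 x)) (max 0 (min 1 y))"
      unfolding G_def by (rule lipschitz_onD[OF L]) auto
    also have "\<dots> \<le> L * dist x y"
      by (rule mult_left_mono[OF _ lipschitz_on_nonneg[OF L]]) (auto simp: dist_real_def)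
    finally show "dist (G x) (G y) \<le> L * dist x y" .
  qed (rule lipschitz_on_nonneg[OF L])
  obtain N where N: "N \<in> null_sets lborel" "\<And>x. x \<in> {0<..<1} - N \<Longrightarrow> G differentiable (at x)"
    using lipschitz_AE_differentiable[OF LG] by metis
  have dG: "(G has_field_derivative deriv01 g x) (at x)" if "x \<in> {0<..<1} - N" for x
  proof -
    have "G differentiable (at x)" using N(2) that by blast
    then obtain D where D: "(G has_field_derivative D) (at x)"
      by (auto elim: real_differentiableE)
    have "(g has_field_derivative D) (at x)"
      by (rule has_field_derivative_transform_within_open[OF D, of "{0<..<1}"]) (use that G_eq in auto)
    then show ?thesis using D that deriv01_interior by auto
  qed
  \<comment> \<open>The limit of these continuous quotients is a Borel version of the derivative.
    Where \<open>g\<close> is not differentiable the value of \<open>deriv01 g\<close> is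
    uncontrolled, but that set is null and Lebesgue measure is complete.\<close>
  define q where "q n x = real (Suc n) * (G (x + 1 / real (Suc n)) - G x)" for n x
  define f0 where "f0 x = (if x \<in> {0<..<1} then lim (\<lambda>n. q n x) else 0)" for x
  have contG: "continuous_on UNIV G" by (rule lipschitz_on_continuous_on[OF LG])
  have "continuous_on UNIV (q n)" for n
    unfolding q_def by (intro continuous_intros continuous_on_compose2[OF contG]) auto
  then have "q n \<in> borel_measurable borel" for n
    by (rule borel_measurable_continuous_onI)
  then have "f0 \<in> borel_measurable borel"
    unfolding f0_def by measurable
  then have f0: "f0 \<in> borel_measurable lebesgue"
    by (simp add: measurable_completion)
  have q_lim: "(\<lambda>n. q n x) \<longlonglongrightarrow> deriv01 g x" if "x \<in> {0<..<1} - N" for x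
  proof -
    have "((\<lambda>h. (G (x + h) - G x) / h) \<longlongrightarrow> deriv01 g x) (at 0)"
      using dG[OF that] by (simp add: DERIV_def)
    moreover have "filterlim (\<lambda>n. 1 / real (Suc n)) (at 0) sequentially"
      by (rule filterlim_atI[OF LIMSEQ_Suc[OF lim_1_over_n]]) auto
    ultimately have "(\<lambda>n. (G (x + 1 / real (Suc n)) - G x) / (1 / real (Suc n))) \<longlonglongrightarrow> deriv01 g x"
      by (rule filterlim_compose)
    then show ?thesis by (simp add: q_def mult.commute)
  qed
  have "AE x in lebesgue. f0 x = (if x \<in> {0..1} then deriv01 g x else 0)"
  proof -
    have "N \<union> {0, 1} \<in> null_sets lborel"
      using N(1) by (intro null_sets.Un) (auto intro: finite_imp_null_set_lborel)
    moreover have "f0 x = (if x \<in> {0..1} then deriv01 g x else 0)" if x: "x \<notin> N \<union> {0, 1}" for x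
    proof (cases "x \<in> {0<..<1}")
      case True
      then have "lim (\<lambda>n. q n x) = deriv01 g x" using q_lim x by (intro limI) auto
      then show ?thesis using True by (simp add: f0_def)
    next
      case False
      then show ?thesis using x by (auto simp: f0_def)
    qed
    ultimately have "AE x in lborel. f0 x = (if x \<in> {0..1} then deriv01 g x else 0)"
      by (intro AE_I'[of "N \<union> {0, 1}"]) blast+
    then show ?thesis by (simp add: AE_completion_iff)
  qed
  then have "(\<lambda>x. if x \<in> {0..1} then deriv01 g x else 0) \<in> borel_measurable lebesgue"
    by (rule borel_measurable_AE[OF f0])
  then have m: "deriv01 g \<in> borel_measurable (lebesgue_on {0..1})"
    by (rule borel_measurable_if_D)
  have q_le: "\<bar>q n x\<bar> \<le> L" for n x
  proof -
    have "\<bar>q n x\<bar> = real (Suc n) * \<bar>G (x + 1 / real (Suc n)) - G x\<bar>"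
      by (simp add: q_def abs_mult)
    also have "\<dots> \<le> real (Suc n) * (L * (1 / real (Suc n)))"
      using lipschitz_onD[OF LG, of "x + 1 / real (Suc n)" x]
      by (intro mult_left_mono) (auto simp: dist_real_def)
    also have "\<dots> = L" by simp
    finally show ?thesis .
  qed
  have "AE x in lebesgue_on {0..1}. \<bar>deriv01 g x\<bar> \<le> L"
  proof -
    have "N \<union> {0, 1} \<in> null_sets lborel"
      using N(1) by (intro null_sets.Un) (auto intro: finite_imp_null_set_lborel)
    moreover have "\<bar>deriv01 g x\<bar> \<le> L" if "x \<in> {0..1}" "x \<notin> N \<union> {0, 1}" for x
    proof -
      have "(\<lambda>n. \<bar>q n x\<bar>) \<longlonglongrightarrow> \<bar>deriv01 g x\<bar>" using that q_lim by (intro tendsto_rabs) auto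
      then show ?thesis by (rule LIMSEQ_le_const2) (use q_le in auto)
    qed
    ultimately have "AE x in lborel. x \<in> {0..1} \<longrightarrow> \<bar>deriv01 g x\<bar> \<le> L"
      by (intro AE_I'[of "N \<union> {0, 1}"]) blast+
    then show ?thesis by (subst AE_restrict_space_iff) (auto simp: AE_completion_iff)
  qed
  note ess = ess_norm_AE[OF m this]
  obtain N' where N': "N' \<in> null_sets lborel" "\<And>x. x \<in> {0..1} - N' \<Longrightarrow> \<bar>deriv01 g x\<bar> \<le> ess_norm (deriv01 g)"
    using AE_lebesgue_on_imp_null_set[OF ess] by metis
  have null: "N \<union> N' \<in> null_sets lborel" using N(1) N'(1) by auto
  have main: "\<bar>g v - g u\<bar> \<le> ess_norm (deriv01 g) * (v - u)" if "0 \<le> u" "u < v" "v \<le> 1" for u v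
  proof -
    have "G v - G u \<le> ess_norm (deriv01 g) * (v - u)"
    proof (rule lipschitz_AE_deriv_le[OF LG null _ \<open>u < v\<close>])
      fix x assume "x \<in> {u<..<v} - (N \<union> N')"
      then show "\<exists>D. (G has_field_derivative D) (at x) \<and> D \<le> ess_norm (deriv01 g)"
        using that dG[of x] N'(2)[of x] by (intro exI[of _ "deriv01 g x"]) auto
    qed
    moreover have "(- G v) - (- G u) \<le> ess_norm (deriv01 g) * (v - u)"
    proof (rule lipschitz_AE_deriv_le[OF _ null _ \<open>u < v\<close>])
      show "L-lipschitz_on UNIV (\<lambda>x. - G x)" using LG by (rule lipschitz_intros)
      fix x assume "x \<in> {u<..<v} - (N \<union> N')"
      then show "\<exists>D. ((\<lambda>x. - G x) has_field_derivative D) (at x) \<and> D \<le> ess_norm (deriv01 g)"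
        using that dG[of x] N'(2)[of x]
        by (intro exI[of _ "- deriv01 g x"]) (auto intro!: derivative_eq_intros)
    qed
    ultimately show ?thesis using that by (simp add: G_eq abs_le_iff)
  qed
  show ?thesis
    using main[of x y] main[of y x] xy by (cases x y rule: linorder_cases) (auto simp: abs_minus_commute)
qed

section \<open>Iterated integrals of the Beta density and derivatives of its Mills ratios\<close>

text \<open>The scheme of the identities below: compare derivatives on the open interval and the
  limit at one end. The filter \<open>F\<close> covers both ends at once.\<close>

lemma zero_deriv_tendsto_zero:
  fixes f :: "real \<Rightarrow> real"
  assumes "\<And>x. x \<in> {0<..<1} \<Longrightarrow> (f has_real_derivative 0) (at x)"
    and "(f \<longlongrightarrow> 0) F" "F \<noteq> bot" "eventually (\<lambda>x. x \<in> {0<..<1}) F" and x: "x \<in> {0<..<1}"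
  shows "f x = 0"
proof -
  have "\<exists>c. \<forall>y\<in>{0<..<1}. f y = c"
    using assms(1) by (intro has_field_derivative_zero_constant) (auto intro: has_field_derivative_at_within)
  then obtain c where c: "\<And>y. y \<in> {0<..<1} \<Longrightarrow> f y = c" by blast
  have "(f \<longlongrightarrow> c) F"
    by (rule tendsto_eventually) (use assms(4) c in \<open>auto elim: eventually_mono\<close>)
  then have "c = 0" using assms tendsto_unique by blast
  then show ?thesis using c x by simp
qed

lemma eventually_Ioo_endpoints:
  "eventually (\<lambda>x. x \<in> {0<..<1::real}) (at_right 0)" "eventually (\<lambda>x. x \<in> {0<..<1::real}) (at_left 1)"
  by (rule eventually_at_right_real eventually_at_left_real, simp)+

lemma nonneg_from_left_endpoint:
  fixes f :: "real \<Rightarrow> real"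
  assumes x: "0 < x" and d: "\<And>t. 0 < t \<Longrightarrow> t \<le> x \<Longrightarrow> \<exists>D. (f has_real_derivative D) (at t) \<and> 0 \<le> D"
    and lim: "(f \<longlongrightarrow> 0) (at_right 0)"
  shows "0 \<le> f x"
proof (rule tendsto_upperbound[OF lim])
  have "eventually (\<lambda>e. e \<in> {0<..<x}) (at_right 0)"
    using x by (rule eventually_at_right_real)
  then show "eventually (\<lambda>e. f e \<le> f x) (at_right 0)"
    by eventually_elim (rule DERIV_nonneg_imp_nondecreasing, use d in auto)
qed (simp add: trivial_limit_at_right_real)

lemma nonneg_from_right_endpoint:
  fixes f :: "real \<Rightarrow> real"
  assumes x: "x < 1" and d: "\<And>t. x \<le> t \<Longrightarrow> t < 1 \<Longrightarrow> \<exists>D. (f has_real_derivative D) (at t) \<and> D \<le> 0"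
    and lim: "(f \<longlongrightarrow> 0) (at_left 1)"
  shows "0 \<le> f x"
proof (rule tendsto_upperbound[OF lim])
  have "eventually (\<lambda>e. e \<in> {x<..<1}) (at_left 1)"
    using x by (rule eventually_at_left_real)
  then show "eventually (\<lambda>e. f e \<le> f x) (at_left 1)"
    by eventually_elim (rule DERIV_nonpos_imp_nonincreasing, use d in auto)
qed (simp add: trivial_limit_at_left_real)

lemma has_real_derivative_integral_lower:
  fixes f :: "real \<Rightarrow> real"
  assumes "f integrable_on {0..1}" "isCont f x" "x \<in> {0<..<1}"
  shows "((\<lambda>x. integral {0..x} f) has_real_derivative f x) (at x)"
proof -
  have "((\<lambda>u. integral {0..u} f) has_vector_derivative f x) (at x within ({0..1} - {}))"
    by (rule integral_has_vector_derivative_continuous_at)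
      (use assms in \<open>auto intro: continuous_at_imp_continuous_at_within\<close>)
  then show ?thesis
    using assms by (simp add: at_within_Icc_at has_real_derivative_iff_has_vector_derivative)
qed

lemma integral_upper_eq:
  fixes f :: "real \<Rightarrow> real"
  assumes "f integrable_on {0..1}" "x \<in> {0..1}"
  shows "integral {x..1} f = integral {0..1} f - integral {0..x} f"
  using Henstock_Kurzweil_Integration.integral_combine[where a=0 and c=x and b=1 and f=f] assms by auto

lemma has_real_derivative_integral_upper:
  fixes f :: "real \<Rightarrow> real"
  assumes "f integrable_on {0..1}" "isCont f x" "x \<in> {0<..<1}"
  shows "((\<lambda>x. integral {x..1} f) has_real_derivative - f x) (at x)"
proof -
  have "((\<lambda>x. integral {0..1} f - integral {0..x} f) has_real_derivative - f x) (at x)"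
    by (auto intro!: derivative_eq_intros has_real_derivative_integral_lower assms)
  then show ?thesis
    by (rule has_field_derivative_transform_within_open[of _ _ _ "{0<..<1}"])
      (use assms integral_upper_eq[OF assms(1), symmetric] in simp_all)
qed

lemma continuous_on_integral_lower_upper:
  fixes f :: "real \<Rightarrow> real"
  assumes "f integrable_on {0..1}"
  shows "continuous_on {0..1} (\<lambda>x. integral {0..x} f)" "continuous_on {0..1} (\<lambda>x. integral {x..1} f)"
proof -
  show *: "continuous_on {0..1} (\<lambda>x. integral {0..x} f)"
    by (rule indefinite_integral_continuous_1[OF assms])
  show "continuous_on {0..1} (\<lambda>x. integral {x..1} f)"
    by (rule continuous_on_eq[of _ "\<lambda>x. integral {0..1} f - integral {0..x} f"])
      (use integral_upper_eq[OF assms, symmetric] in \<open>auto intro!: continuous_intros *\<close>)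
qed

lemma tendsto_endpoints:
  fixes f :: "real \<Rightarrow> real"
  assumes "continuous_on {0..1} f"
  shows "(f \<longlongrightarrow> f 0) (at_right 0)" "(f \<longlongrightarrow> f 1) (at_left 1)"
proof -
  have "(f \<longlongrightarrow> f 0) (at 0 within {0..1})" "(f \<longlongrightarrow> f 1) (at 1 within {0..1})"
    using assms by (auto simp: continuous_on_def)
  then show "(f \<longlongrightarrow> f 0) (at_right 0)" "(f \<longlongrightarrow> f 1) (at_left 1)"
    by (simp_all add: at_within_Icc_at_right at_within_Icc_at_left)
qed

lemma isCont_Ioo: "continuous_on {0..1} f \<Longrightarrow> x \<in> {0<..<1} \<Longrightarrow> isCont f x" for f :: "real \<Rightarrow> real"
  by (rule continuous_on_interior[of "{0..1}"]) auto

lemma tendsto_mult_bounded_Ioo: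
  fixes P u :: "real \<Rightarrow> real"
  assumes "(P \<longlongrightarrow> 0) F" "eventually (\<lambda>x. x \<in> {0<..<1}) F" "\<And>x. x \<in> {0<..<1} \<Longrightarrow> \<bar>u x\<bar> \<le> C"
  shows "((\<lambda>x. P x * u x) \<longlongrightarrow> 0) F"
proof (rule Lim_null_comparison)
  show "((\<lambda>x. \<bar>P x\<bar> * C) \<longlongrightarrow> 0) F"
    using tendsto_mult[OF tendsto_rabs[OF assms(1)] tendsto_const[of C]] by simp
  show "\<forall>\<^sub>F x in F. norm (P x * u x) \<le> \<bar>P x\<bar> * C"
    using assms(2) by eventually_elim (auto simp: abs_mult intro!: mult_left_mono assms(3))
qed

text \<open>Both \<open>G - F\<close> and \<open>G + F\<close> are nondecreasing on
  \<open>(0, x]\<close> and tend to 0 at 0. This estimates an integral from 0 knowing only its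
  derivative.\<close>

lemma dominated_from_0:
  fixes F G F' G' :: "real \<Rightarrow> real"
  assumes x: "x \<in> {0<..<1}" and F: "\<And>t. t \<in> {0<..<1} \<Longrightarrow> (F has_real_derivative F' t) (at t)" "(F \<longlongrightarrow> 0) (at_right 0)"
    and G: "\<And>t. t \<in> {0<..<1} \<Longrightarrow> (G has_real_derivative G' t) (at t)" "(G \<longlongrightarrow> 0) (at_right 0)"
    and le: "\<And>t. t \<in> {0<..<1} \<Longrightarrow> t \<le> x \<Longrightarrow> \<bar>F' t\<bar> \<le> G' t"
  shows "\<bar>F x\<bar> \<le> G x"
proof -
  have "0 \<le> G x - F x"
  proof (rule nonneg_from_left_endpoint[where f = "\<lambda>x. G x - F x"])
    show "\<exists>D. ((\<lambda>x. G x - F x) has_real_derivative D) (at t) \<and> 0 \<le> D" if "0 < t" "t \<le> x" for t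
      using DERIV_diff[OF G(1) F(1), of t] le[of t] that x by force
    show "((\<lambda>x. G x - F x) \<longlongrightarrow> 0) (at_right 0)" using tendsto_diff[OF G(2) F(2)] by simp
  qed (use x in auto)
  moreover have "0 \<le> G x + F x"
  proof (rule nonneg_from_left_endpoint[where f = "\<lambda>x. G x + F x"])
    show "\<exists>D. ((\<lambda>x. G x + F x) has_real_derivative D) (at t) \<and> 0 \<le> D" if "0 < t" "t \<le> x" for t
      using DERIV_add[OF G(1) F(1), of t] le[of t] that x by force
    show "((\<lambda>x. G x + F x) \<longlongrightarrow> 0) (at_right 0)" using tendsto_add[OF G(2) F(2)] by simp
  qed (use x in auto)
  ultimately show ?thesis by linarith
qed

lemma dominated_from_1:
  fixes F G F' G' :: "real \<Rightarrow> real"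
  assumes x: "x \<in> {0<..<1}" and F: "\<And>t. t \<in> {0<..<1} \<Longrightarrow> (F has_real_derivative F' t) (at t)" "(F \<longlongrightarrow> 0) (at_left 1)"
    and G: "\<And>t. t \<in> {0<..<1} \<Longrightarrow> (G has_real_derivative G' t) (at t)" "(G \<longlongrightarrow> 0) (at_left 1)"
    and le: "\<And>t. t \<in> {0<..<1} \<Longrightarrow> x \<le> t \<Longrightarrow> \<bar>F' t\<bar> \<le> - G' t"
  shows "\<bar>F x\<bar> \<le> G x"
proof -
  have "0 \<le> G x - F x"
  proof (rule nonneg_from_right_endpoint[where f = "\<lambda>x. G x - F x"])
    show "\<exists>D. ((\<lambda>x. G x - F x) has_real_derivative D) (at t) \<and> D \<le> 0" if "x \<le> t" "t < 1" for t
      using DERIV_diff[OF G(1) F(1), of t] le[of t] that x by force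
    show "((\<lambda>x. G x - F x) \<longlongrightarrow> 0) (at_left 1)" using tendsto_diff[OF G(2) F(2)] by simp
  qed (use x in auto)
  moreover have "0 \<le> G x + F x"
  proof (rule nonneg_from_right_endpoint[where f = "\<lambda>x. G x + F x"])
    show "\<exists>D. ((\<lambda>x. G x + F x) has_real_derivative D) (at t) \<and> D \<le> 0" if "x \<le> t" "t < 1" for t
      using DERIV_add[OF G(1) F(1), of t] le[of t] that x by force
    show "((\<lambda>x. G x + F x) \<longlongrightarrow> 0) (at_left 1)" using tendsto_add[OF G(2) F(2)] by simp
  qed (use x in auto)
  ultimately show ?thesis by linarith
qed

section \<open>The Beta density and its iterated integrals\<close>

locale beta_stein =
  fixes a b :: real
  assumes a: "0 < a" and b: "0 < b"
begin

abbreviation "p \<equiv> beta_density a b"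
abbreviation "I \<equiv> {0<..<1::real}"

definition tau :: "real \<Rightarrow> real" where "tau x = a - (a + b) * x"
definition q :: "real \<Rightarrow> real" where "q x = eta x * p x"
text \<open>Minus the eigenvalue of the Jacobi operator \<open>\<eta> y'' + \<tau> y'\<close> on
  polynomials of degree \<open>k\<close>; here it is the coefficient that \<open>k\<close>
  differentiations of \<open>\<eta> m' + \<tau> m\<close> produce.\<close>

definition lam :: "nat \<Rightarrow> real" where "lam k = real k * (a + b + real k - 1)"

abbreviation "ml k \<equiv> (deriv ^^ k) (m_lower p eta)"
abbreviation "mu k \<equiv> (deriv ^^ k) (m_upper p eta)"

lemma eta_pos: "x \<in> I \<Longrightarrow> 0 < eta x"
  by (simp add: eta_def)

lemma Beta_pos: "0 < Beta a b"
  using a b by (simp add: Beta_def Gamma_real_pos)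

lemma p_pos: "x \<in> I \<Longrightarrow> 0 < p x"
  using Beta_pos by (simp add: beta_density_def)

lemma p_nonneg: "0 \<le> p x"
  using p_pos[of x] by (cases "x \<in> I") (auto simp: beta_density_def)

lemma q_pos: "x \<in> I \<Longrightarrow> 0 < q x"
  by (simp add: q_def eta_pos p_pos)

lemma p_has_integral: "(p has_integral 1) {0..1}"
proof -
  have "((\<lambda>t. t powr (a - 1) * (1 - t) powr (b - 1) / Beta a b) has_integral Beta a b / Beta a b) {0..1}"
    by (intro has_integral_divide has_integral_Beta_real a b)
  then show ?thesis
    using Beta_pos by (subst has_integral_cong[where g = "\<lambda>t. t powr (a - 1) * (1 - t) powr (b - 1) / Beta a b"]) (auto simp: beta_density_def)
qed

lemma p_integrable: "p integrable_on {0..1}"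
  using p_has_integral by blast

lemma isCont_p: "x \<in> I \<Longrightarrow> isCont p x"
proof -
  assume x: "x \<in> I"
  have "continuous_on I (\<lambda>x. x powr (a - 1) * (1 - x) powr (b - 1) / Beta a b)"
    by (intro continuous_intros) (use a b Beta_pos in auto)
  then have "continuous_on I p"
    by (rule continuous_on_eq) (auto simp: beta_density_def)
  then show ?thesis using x by (simp add: continuous_on_eq_continuous_at)
qed

text \<open>Multiplying by \<open>\<eta>\<close> raises the exponents to \<open>a\<close> and
  \<open>b\<close>. These are positive, so \<open>q\<close> is continuous up to the end points,
  where \<open>p\<close> may be unbounded.\<close>

lemma q_eq: "x \<in> {0..1} \<Longrightarrow> q x = x powr a * (1 - x) powr b / Beta a b"
  by (auto simp: q_def eta_def beta_density_def powr_diff)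

lemma q_endpoints [simp]: "q 0 = 0" "q 1 = 0"
  by (simp_all add: q_def eta_def)

lemma q_continuous: "continuous_on {0..1} q"
proof (rule continuous_on_eq)
  show "continuous_on {0..1} (\<lambda>x. x powr a * (1 - x) powr b / Beta a b)"
    by (intro continuous_intros continuous_on_powr') (use a b Beta_pos in auto)
qed (simp add: q_eq)

lemma q_deriv: "x \<in> I \<Longrightarrow> (q has_real_derivative tau x * p x) (at x)"
proof -
  assume x: "x \<in> I"
  have "((\<lambda>x. x powr a * (1 - x) powr b / Beta a b) has_real_derivative tau x * p x) (at x)"
    using x Beta_pos by (auto intro!: derivative_eq_intros simp: tau_def beta_density_def powr_diff divide_simps)
      (simp add: algebra_simps)
  then show ?thesis
    by (rule has_field_derivative_transform_within_open[of _ _ _ I]) (use x q_eq in auto)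
qed

text \<open>Since \<open>p\<close> may be unbounded at the end points, the induction carries
  integrability and interior continuity of the integrand; after one integration, continuity on the
  closed interval supplies both.\<close>

lemma P_lower_Suc:
  "continuous_on {0..1} (P_lower p (Suc j))"
  "x \<in> I \<Longrightarrow> (P_lower p (Suc j) has_real_derivative P_lower p j x) (at x)"
proof -
  have "continuous_on {0..1} (P_lower p (Suc j)) \<and> P_lower p j integrable_on {0..1} \<and> (\<forall>x\<in>I. isCont (P_lower p j) x)"
  proof (induction j)
    case 0
    then show ?case using p_integrable isCont_p by (auto intro: continuous_on_integral_lower_upper)
  next
    case (Suc j)
    then have c: "continuous_on {0..1} (P_lower p (Suc j))" by blast
    have i: "P_lower p (Suc j) integrable_on {0..1}" by (rule integrable_continuous_real[OF c])
    have "continuous_on {0..1} (P_lower p (Suc (Suc j)))"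
      unfolding P_lower.simps(2)[of p "Suc j"] by (rule continuous_on_integral_lower_upper(1)[OF i])
    then show ?case using i isCont_Ioo[OF c] by blast
  qed
  note * = this
  show "continuous_on {0..1} (P_lower p (Suc j))" using * by blast
  show "(P_lower p (Suc j) has_real_derivative P_lower p j x) (at x)" if "x \<in> I"
  proof -
    have "P_lower p j integrable_on {0..1}" "isCont (P_lower p j) x" using * that by simp_all
    from has_real_derivative_integral_lower[OF this that] show ?thesis by simp
  qed
qed

lemma P_upper_Suc:
  "continuous_on {0..1} (P_upper p (Suc j))"
  "x \<in> I \<Longrightarrow> (P_upper p (Suc j) has_real_derivative - P_upper p j x) (at x)"
proof -
  have "continuous_on {0..1} (P_upper p (Suc j)) \<and> P_upper p j integrable_on {0..1} \<and> (\<forall>x\<in>I. isCont (P_upper p j) x)"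
  proof (induction j)
    case 0
    then show ?case using p_integrable isCont_p by (auto intro: continuous_on_integral_lower_upper)
  next
    case (Suc j)
    then have c: "continuous_on {0..1} (P_upper p (Suc j))" by blast
    have i: "P_upper p (Suc j) integrable_on {0..1}" by (rule integrable_continuous_real[OF c])
    have "continuous_on {0..1} (P_upper p (Suc (Suc j)))"
      unfolding P_upper.simps(2)[of p "Suc j"] by (rule continuous_on_integral_lower_upper(2)[OF i])
    then show ?case using i isCont_Ioo[OF c] by blast
  qed
  note * = this
  show "continuous_on {0..1} (P_upper p (Suc j))" using * by blast
  show "(P_upper p (Suc j) has_real_derivative - P_upper p j x) (at x)" if "x \<in> I"
  proof -
    have "P_upper p j integrable_on {0..1}" "isCont (P_upper p j) x" using * that by simp_all
    from has_real_derivative_integral_upper[OF this that] show ?thesis by simp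
  qed
qed

lemma P_tendsto_0:
  "(P_lower p (Suc j) \<longlongrightarrow> 0) (at_right 0)" "(P_upper p (Suc j) \<longlongrightarrow> 0) (at_left 1)"
  using tendsto_endpoints(1)[OF P_lower_Suc(1)[of j]] tendsto_endpoints(2)[OF P_upper_Suc(1)[of j]] by simp_all

lemma q_tendsto_0: "(q \<longlongrightarrow> 0) (at_right 0)" "(q \<longlongrightarrow> 0) (at_left 1)"
  using tendsto_endpoints[OF q_continuous] by simp_all

lemma P_nonneg: "x \<in> I \<Longrightarrow> 0 \<le> P_lower p j x" "x \<in> I \<Longrightarrow> 0 \<le> P_upper p j x"
proof (induction j arbitrary: x)
  case (Suc j)
  { case 1
    show ?case
    proof (rule nonneg_from_left_endpoint[OF _ _ P_tendsto_0(1)])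
      show "\<exists>D. (P_lower p (Suc j) has_real_derivative D) (at t) \<and> 0 \<le> D" if "0 < t" "t \<le> x" for t
        using that 1 P_lower_Suc(2)[of t j] Suc.IH(1)[of t] by auto
    qed (use 1 in auto) }
  { case 2
    show ?case
    proof (rule nonneg_from_right_endpoint[OF _ _ P_tendsto_0(2)])
      show "\<exists>D. (P_upper p (Suc j) has_real_derivative D) (at t) \<and> D \<le> 0" if "x \<le> t" "t < 1" for t
        using that 2 P_upper_Suc(2)[of t j] Suc.IH(2)[of t] by (intro exI[of _ "- P_upper p j t"]) auto
    qed (use 2 in auto) }
qed (auto simp: p_nonneg)

lemma P_sum: "x \<in> {0..1} \<Longrightarrow> P_lower p 1 x + P_upper p 1 x = 1"
  using integral_upper_eq[OF p_integrable, of x] p_has_integral by (auto simp: integral_unique)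

text \<open>Both sides have derivative \<open>(a + b) * P_lower p 1\<close>, because
  \<open>q' = \<tau> p\<close> cancels the term from differentiating \<open>P_lower p 1\<close>, and
  both vanish at 0.\<close>

lemma P_lower_2: "x \<in> I \<Longrightarrow> (a + b) * P_lower p 2 x = q x - tau x * P_lower p 1 x"
proof -
  assume x: "x \<in> I"
  have "(a + b) * P_lower p 2 x - (q x - tau x * P_lower p 1 x) = 0"
  proof (rule zero_deriv_tendsto_zero[OF _ _ _ eventually_Ioo_endpoints(1) x])
    fix t assume t: "t \<in> I"
    note d = P_lower_Suc(2)[OF t, of 0] P_lower_Suc(2)[OF t, of 1] q_deriv[OF t]
    show "((\<lambda>x. (a + b) * P_lower p 2 x - (q x - tau x * P_lower p 1 x)) has_real_derivative 0) (at t)"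
      unfolding tau_def using d
      by (auto intro!: derivative_eq_intros simp: numeral_2_eq_2 tau_def simp del: P_lower.simps(2)) (simp add: algebra_simps)
  next
    have "((\<lambda>x. (a + b) * P_lower p 2 x - (q x - (a - (a + b) * x) * P_lower p 1 x))
       \<longlongrightarrow> (a + b) * 0 - (0 - (a - (a + b) * 0) * 0)) (at_right 0)"
      using P_tendsto_0(1)[of 0] P_tendsto_0(1)[of 1] q_tendsto_0
      by (intro tendsto_intros) (auto simp: numeral_2_eq_2 simp del: P_lower.simps(2))
    then show "((\<lambda>x. (a + b) * P_lower p 2 x - (q x - tau x * P_lower p 1 x)) \<longlongrightarrow> 0) (at_right 0)"
      by (simp add: tau_def)
  qed (simp add: trivial_limit_at_right_real)
  then show ?thesis by simp
qed

lemma P_upper_2: "x \<in> I \<Longrightarrow> (a + b) * P_upper p 2 x = q x + tau x * P_upper p 1 x"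
proof -
  assume x: "x \<in> I"
  have "(a + b) * P_upper p 2 x - (q x + tau x * P_upper p 1 x) = 0"
  proof (rule zero_deriv_tendsto_zero[OF _ _ _ eventually_Ioo_endpoints(2) x])
    fix t assume t: "t \<in> I"
    note d = P_upper_Suc(2)[OF t, of 0] P_upper_Suc(2)[OF t, of 1] q_deriv[OF t]
    show "((\<lambda>x. (a + b) * P_upper p 2 x - (q x + tau x * P_upper p 1 x)) has_real_derivative 0) (at t)"
      unfolding tau_def using d
      by (auto intro!: derivative_eq_intros simp: numeral_2_eq_2 tau_def simp del: P_upper.simps(2)) (simp add: algebra_simps)
  next
    have "((\<lambda>x. (a + b) * P_upper p 2 x - (q x + (a - (a + b) * x) * P_upper p 1 x))
       \<longlongrightarrow> (a + b) * 0 - (0 + (a - (a + b) * 1) * 0)) (at_left 1)"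
      using P_tendsto_0(2)[of 0] P_tendsto_0(2)[of 1] q_tendsto_0
      by (intro tendsto_intros) (auto simp: numeral_2_eq_2 simp del: P_upper.simps(2))
    then show "((\<lambda>x. (a + b) * P_upper p 2 x - (q x + tau x * P_upper p 1 x)) \<longlongrightarrow> 0) (at_left 1)"
      by (simp add: tau_def)
  qed (simp add: trivial_limit_at_left_real)
  then show ?thesis by simp
qed

text \<open>Right-hand side of the \<open>k\<close>-fold differentiated equation \<open>\<eta> m' + \<tau> m = s\<close>.\<close>

definition src :: "real \<Rightarrow> (real \<Rightarrow> real) \<Rightarrow> nat \<Rightarrow> real \<Rightarrow> real" where
  "src s m k x = (case k of 0 \<Rightarrow> s | Suc j \<Rightarrow> lam k * (deriv ^^ j) m x)"

text \<open>Solved for its leading term, the equation of order \<open>k - 1\<close> expresses the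
  \<open>k\<close>-th derivative of \<open>m\<close> through lower ones. Hence that derivative is
  differentiable, and differentiating the expression gives the equation of order
  \<open>k\<close>.\<close>

lemma iterated_deriv_ode:
  assumes m: "\<And>x. x \<in> I \<Longrightarrow> (m has_real_derivative (s - tau x * m x) / eta x) (at x)"
  shows "\<forall>x\<in>I. ((deriv ^^ k) m has_real_derivative (deriv ^^ Suc k) m x) (at x) \<and>
    eta x * (deriv ^^ Suc k) m x + (tau x + real k * (1 - 2 * x)) * (deriv ^^ k) m x = src s m k x"
proof (induction k rule: less_induct)
  case (less k)
  let ?D = "\<lambda>k. (deriv ^^ k) m"
  have IH: "(?D j has_real_derivative ?D (Suc j) x) (at x)"
    "eta x * ?D (Suc j) x + (tau x + real j * (1 - 2 * x)) * ?D j x = src s m j x"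
    if "j < k" "x \<in> I" for j x using less.IH[OF that(1)] that(2) by auto
  show ?case
  proof (cases k)
    case 0
    then show ?thesis using m DERIV_imp_deriv[OF m] eta_pos by (fastforce simp: src_def)
  next
    case (Suc j)
    \<comment> \<open>The source of order \<open>j\<close> involves the derivative of order
      \<open>j - 1\<close>, hence the course-of-values induction.\<close>
    have src': "(src s m j has_real_derivative lam j * ?D j x) (at x)" if x: "x \<in> I" for x
    proof (cases j)
      case 0
      then show ?thesis by (simp add: src_def[abs_def] lam_def)
    next
      case (Suc i)
      have "((\<lambda>x. lam j * ?D i x) has_real_derivative lam j * ?D j x) (at x)"
        using IH(1)[of i x] x Suc \<open>k = Suc j\<close> by (auto intro!: derivative_eq_intros)
      then show ?thesis using Suc by (simp add: src_def[abs_def])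
    qed
    have eq: "?D k x = (src s m j x - (tau x + real j * (1 - 2 * x)) * ?D j x) / eta x" if "x \<in> I" for x
      using IH(2)[of j x] that eta_pos[OF that] Suc by (simp add: field_simps)
    have *: "(?D k has_real_derivative
        (lam j * ?D j x - ((- (a + b) - 2 * real j) * ?D j x + (tau x + real j * (1 - 2 * x)) * ?D k x)
          - (1 - 2 * x) * ?D k x) / eta x) (at x)" if x: "x \<in> I" for x
    proof (rule has_field_derivative_transform_within_open[of _ _ _ I])
      let ?N = "\<lambda>x. src s m j x - (tau x + real j * (1 - 2 * x)) * ?D j x"
      let ?N' = "lam j * ?D j x - ((- (a + b) - 2 * real j) * ?D j x + (tau x + real j * (1 - 2 * x)) * ?D k x)"
      have "((\<lambda>x. tau x + real j * (1 - 2 * x)) has_real_derivative - (a + b) - 2 * real j) (at x)"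
        unfolding tau_def by (auto intro!: derivative_eq_intros)
      note dN = DERIV_diff[OF src'[OF x] DERIV_mult'[OF this IH(1)[of j x]]]
      have N: "(?N has_real_derivative ?N') (at x)"
        using dN Suc x by (simp add: algebra_simps del: funpow.simps)
      have e: "(eta has_real_derivative 1 - 2 * x) (at x)"
        unfolding eta_def[abs_def] by (auto intro!: derivative_eq_intros)
      have "((\<lambda>x. ?N x / eta x) has_real_derivative (?N' * eta x - ?N x * (1 - 2 * x)) / (eta x * eta x)) (at x)"
        using DERIV_divide[OF N e] eta_pos[OF x] by simp
      moreover have n: "?N x = ?D k x * eta x" using eq[OF x] eta_pos[OF x] by simp
      moreover have "(A * eta x - ?D k x * eta x * t) / (eta x * eta x) = (A - t * ?D k x) / eta x" for A t
        using eta_pos[OF x] by (simp add: field_simps del: funpow.simps)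
      ultimately show "((\<lambda>x. ?N x / eta x) has_real_derivative (?N' - (1 - 2 * x) * ?D k x) / eta x) (at x)"
        by metis
    qed (use x eq in auto)
    show ?thesis
    proof (intro ballI conjI)
      fix x assume x: "x \<in> I"
      have D: "?D (Suc k) x = (lam j * ?D j x - ((- (a + b) - 2 * real j) * ?D j x + (tau x + real j * (1 - 2 * x)) * ?D k x)
          - (1 - 2 * x) * ?D k x) / eta x"
        using DERIV_imp_deriv[OF *[OF x]] by simp
      show "(?D k has_real_derivative ?D (Suc k) x) (at x)"
        using *[OF x] unfolding D .
      show "eta x * ?D (Suc k) x + (tau x + real k * (1 - 2 * x)) * ?D k x = src s m k x"
      proof -
        have "eta x * ?D (Suc k) x = lam j * ?D j x - ((- (a + b) - 2 * real j) * ?D j x + (tau x + real j * (1 - 2 * x)) * ?D k x)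
          - (1 - 2 * x) * ?D k x"
          using eta_pos[OF x] unfolding D by simp
        \<comment> \<open>The coefficients accumulate by
          \<open>lam (Suc j) = lam j + (a + b) + 2 * j\<close>.\<close>
        then show ?thesis by (simp add: src_def lam_def Suc algebra_simps del: funpow.simps)
      qed
    qed
  qed
qed

text \<open>The quotient rule for \<open>P_lower p 1 / q\<close> with \<open>q' = \<tau> p\<close>
  gives \<open>\<eta> m' + \<tau> m = 1\<close>; for the upper ratio the constant is
  \<open>- 1\<close>.\<close>

lemma m_lower_deriv:
  assumes x: "x \<in> I"
  shows "(m_lower p eta has_real_derivative (1 - tau x * m_lower p eta x) / eta x) (at x)"
proof -
  have e: "m_lower p eta = (\<lambda>x. P_lower p (Suc 0) x / q x)"
    by (simp add: m_lower_def[abs_def] q_def)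
  have "(m_lower p eta has_real_derivative (p x * q x - P_lower p (Suc 0) x * (tau x * p x)) / (q x * q x)) (at x)"
    unfolding e using DERIV_divide[OF P_lower_Suc(2)[OF x, of 0] q_deriv[OF x]] q_pos[OF x] by simp
  moreover have "(p x * q x - P_lower p (Suc 0) x * (tau x * p x)) / (q x * q x) = (1 - tau x * m_lower p eta x) / eta x"
    unfolding e using eta_pos[OF x] p_pos[OF x] by (simp add: q_def field_simps)
  ultimately show ?thesis by simp
qed

lemma m_upper_deriv:
  assumes x: "x \<in> I"
  shows "(m_upper p eta has_real_derivative (- 1 - tau x * m_upper p eta x) / eta x) (at x)"
proof -
  have e: "m_upper p eta = (\<lambda>x. P_upper p (Suc 0) x / q x)"
    by (simp add: m_upper_def[abs_def] q_def)
  have "(m_upper p eta has_real_derivative (- p x * q x - P_upper p (Suc 0) x * (tau x * p x)) / (q x * q x)) (at x)"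
    unfolding e using DERIV_divide[OF P_upper_Suc(2)[OF x, of 0] q_deriv[OF x]] q_pos[OF x] by simp
  moreover have "(- p x * q x - P_upper p (Suc 0) x * (tau x * p x)) / (q x * q x) = (- 1 - tau x * m_upper p eta x) / eta x"
    unfolding e using eta_pos[OF x] p_pos[OF x] by (simp add: q_def field_simps)
  ultimately show ?thesis by simp
qed

lemmas ml_deriv = iterated_deriv_ode[OF m_lower_deriv, THEN bspec, THEN conjunct1]
lemmas mu_deriv = iterated_deriv_ode[OF m_upper_deriv, THEN bspec, THEN conjunct1]

section \<open>Derivatives of the Mills ratios as multiples of iterated integrals\<close>

text \<open>\<open>q \<eta>^k\<close> is an integrating factor of the equation of order
  \<open>k\<close>: its logarithmic derivative is
  \<open>(\<tau> + k (1 - 2 x)) / \<eta>\<close>.\<close>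

lemma weighted_deriv:
  assumes m: "\<And>x. x \<in> I \<Longrightarrow> (m has_real_derivative (s - tau x * m x) / eta x) (at x)" and x: "x \<in> I"
  shows "((\<lambda>x. q x * eta x ^ k * (deriv ^^ k) m x) has_real_derivative q x * eta x ^ k / eta x * src s m k x) (at x)"
proof -
  let ?D = "(deriv ^^ k) m" and ?D' = "(deriv ^^ Suc k) m"
  note D = iterated_deriv_ode[OF m, THEN bspec[OF _ x], of k]
  have e: "(eta has_real_derivative 1 - 2 * x) (at x)"
    unfolding eta_def[abs_def] by (auto intro!: derivative_eq_intros)
  have *: "((\<lambda>x. q x * eta x ^ k * ?D x) has_real_derivative
     q x * eta x ^ k * ?D' x + (q x * (real k * ((1 - 2 * x) * eta x ^ (k - Suc 0))) + tau x * p x * eta x ^ k) * ?D x) (at x)"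
    using DERIV_mult'[OF DERIV_mult'[OF q_deriv[OF x] DERIV_power[OF e, of k]] conjunct1[OF D]] by simp
  \<comment> \<open>At \<open>k = 0\<close> the truncated exponent is harmless because the factor
    \<open>real k\<close> vanishes.\<close>
  have k: "real k * eta x ^ (k - Suc 0) = real k * (eta x ^ k / eta x)"
    using eta_pos[OF x] by (cases k) auto
  have "q x * eta x ^ k * ?D' x + (q x * (real k * ((1 - 2 * x) * eta x ^ (k - Suc 0))) + tau x * p x * eta x ^ k) * ?D x
    = q x * eta x ^ k * ?D' x + (q x * (1 - 2 * x) * (real k * eta x ^ (k - Suc 0)) + tau x * p x * eta x ^ k) * ?D x"
    by (simp add: algebra_simps)
  also have "\<dots> = q x * eta x ^ k / eta x * (eta x * ?D' x + (tau x + real k * (1 - 2 * x)) * ?D x)"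
    unfolding k using eta_pos[OF x] by (simp add: q_def field_simps del: funpow.simps)
  also have "\<dots> = q x * eta x ^ k / eta x * src s m k x"
    using conjunct2[OF D] by (simp only:)
  finally show ?thesis using * by simp
qed

text \<open>Multiplying the differentiated equation by the weight expresses each weighted derivative
  through the two preceding ones with polynomial coefficients, so the limit 0 propagates from
  \<open>q\<close> and \<open>q m\<close>.\<close>

lemma weighted_tendsto:
  assumes m: "\<And>x. x \<in> I \<Longrightarrow> (m has_real_derivative (s - tau x * m x) / eta x) (at x)"
    and F: "((\<lambda>x. x) \<longlongrightarrow> c) F" "eventually (\<lambda>x. x \<in> I) F" "(q \<longlongrightarrow> 0) F" "((\<lambda>x. q x * m x) \<longlongrightarrow> 0) F"
  shows "((\<lambda>x. q x * eta x ^ k * (deriv ^^ k) m x) \<longlongrightarrow> 0) F"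
proof (induction k rule: induct_nat_012)
  case 0
  show ?case using F by simp
next
  case 1
  have "((\<lambda>x. s * q x - (a - (a + b) * x) * (q x * m x)) \<longlongrightarrow> s * 0 - (a - (a + b) * c) * 0) F"
    by (intro tendsto_intros F)
  then have "((\<lambda>x. s * q x - (a - (a + b) * x) * (q x * m x)) \<longlongrightarrow> 0) F" by simp
  then show ?case
  proof (rule Lim_transform_eventually)
    show "\<forall>\<^sub>F x in F. s * q x - (a - (a + b) * x) * (q x * m x) = q x * eta x ^ Suc 0 * (deriv ^^ Suc 0) m x"
      using F(2)
    proof eventually_elim
      case (elim x)
      have "eta x * deriv m x = s - tau x * m x"
        using iterated_deriv_ode[OF m, THEN bspec[OF _ elim], of 0] by (simp add: src_def)
      then have "q x * (eta x * deriv m x) = q x * (s - tau x * m x)" by (simp only:)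
      then show ?case by (simp add: tau_def algebra_simps)
    qed
  qed
next
  case (ge2 k)
  let ?W = "\<lambda>k x. q x * eta x ^ k * (deriv ^^ k) m x"
  let ?G = "\<lambda>x. lam (Suc k) * ((x * (1 - x)) * ?W k x) - (a - (a + b) * x + real (Suc k) * (1 - 2 * x)) * ?W (Suc k) x"
  have "(?G \<longlongrightarrow> lam (Suc k) * ((c * (1 - c)) * 0) - (a - (a + b) * c + real (Suc k) * (1 - 2 * c)) * 0) F"
    by (intro tendsto_intros F ge2)
  then have "(?G \<longlongrightarrow> 0) F" by simp
  then show ?case
  proof (rule Lim_transform_eventually)
    show "\<forall>\<^sub>F x in F. ?G x = ?W (Suc (Suc k)) x"
      using F(2)
    proof eventually_elim
      case (elim x)
      have "eta x * (deriv ^^ Suc (Suc k)) m x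
          = lam (Suc k) * (deriv ^^ k) m x - (tau x + real (Suc k) * (1 - 2 * x)) * (deriv ^^ Suc k) m x"
        using iterated_deriv_ode[OF m, THEN bspec[OF _ elim], of "Suc k"] by (simp add: src_def del: funpow.simps)
      then have "q x * eta x ^ Suc k * (eta x * (deriv ^^ Suc (Suc k)) m x)
          = q x * eta x ^ Suc k * (lam (Suc k) * (deriv ^^ k) m x - (tau x + real (Suc k) * (1 - 2 * x)) * (deriv ^^ Suc k) m x)"
        by (simp only:)
      then show ?case by (simp add: tau_def eta_def algebra_simps del: funpow.simps of_nat_Suc)
    qed
  qed
qed

definition Lam :: "nat \<Rightarrow> real" where "Lam k = (\<Prod>i<k. lam (Suc i))"

lemma Lam_simps [simp]: "Lam 0 = 1" "Lam (Suc k) = Lam k * lam (Suc k)"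
  by (simp_all add: Lam_def)

lemma lam_pos: "0 < lam (Suc k)"
  using a b by (simp add: lam_def add_pos_nonneg)

lemma Lam_pos: "0 < Lam k"
  by (simp add: Lam_def prod_pos lam_pos)

lemma q_m: "x \<in> I \<Longrightarrow> q x * m_lower p eta x = P_lower p (Suc 0) x" "x \<in> I \<Longrightarrow> q x * m_upper p eta x = P_upper p (Suc 0) x"
  using q_pos[of x] by (simp_all add: m_lower_def m_upper_def flip: q_def)

lemma tendsto_endpoint_id: "((\<lambda>x. x) \<longlongrightarrow> 0) (at_right (0::real))" "((\<lambda>x. x) \<longlongrightarrow> 1) (at_left (1::real))"
  by (auto intro: tendsto_ident_at)

text \<open>By \<open>weighted_deriv\<close> the left side has derivative \<open>lam k\<close> times
  the weighted derivative of order \<open>k - 1\<close>, which the induction hypothesis turns into a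
  multiple of \<open>P_lower p k\<close>; both sides vanish at 0.\<close>

lemma weighted_ml: "x \<in> I \<Longrightarrow> q x * eta x ^ k * ml k x = Lam k * P_lower p (Suc k) x"
proof (induction k arbitrary: x)
  case 0
  then show ?case using q_m by simp
next
  case (Suc k)
  have "((\<lambda>x. q x * m_lower p eta x) \<longlongrightarrow> 0) (at_right 0)"
    by (rule Lim_transform_eventually[OF P_tendsto_0(1)[of 0]])
      (use eventually_Ioo_endpoints(1) q_m(1) in \<open>auto elim: eventually_mono\<close>)
  note lim = weighted_tendsto[OF m_lower_deriv tendsto_endpoint_id(1) eventually_Ioo_endpoints(1) q_tendsto_0(1) this, of "Suc k"]
  have "q x * eta x ^ Suc k * ml (Suc k) x - Lam (Suc k) * P_lower p (Suc (Suc k)) x = 0"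
  proof (rule zero_deriv_tendsto_zero[OF _ _ _ eventually_Ioo_endpoints(1) Suc.prems])
    fix t assume t: "t \<in> I"
    have "q t * eta t ^ Suc k / eta t * src 1 (m_lower p eta) (Suc k) t = lam (Suc k) * (q t * eta t ^ k * ml k t)"
      using eta_pos[OF t] by (simp add: src_def)
    also have "\<dots> = Lam (Suc k) * P_lower p (Suc k) t"
      unfolding Suc.IH[OF t] by simp
    finally show "((\<lambda>x. q x * eta x ^ Suc k * ml (Suc k) x - Lam (Suc k) * P_lower p (Suc (Suc k)) x) has_real_derivative 0) (at t)"
      using DERIV_diff[OF weighted_deriv[OF m_lower_deriv t, of "Suc k"] DERIV_cmult[OF P_lower_Suc(2)[OF t, of "Suc k"], of "Lam (Suc k)"]]
      by (simp only: diff_self)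
  next
    show "((\<lambda>x. q x * eta x ^ Suc k * ml (Suc k) x - Lam (Suc k) * P_lower p (Suc (Suc k)) x) \<longlongrightarrow> 0) (at_right 0)"
      using tendsto_diff[OF lim tendsto_mult_left[OF P_tendsto_0(1)[of "Suc k"], of "Lam (Suc k)"]] by (simp only: diff_self mult_zero_right)
  qed (simp add: trivial_limit_at_right_real)
  then show ?case by (rule eq_iff_diff_eq_0[THEN iffD2])
qed

text \<open>The mirror image, anchored at 1. Each integral over \<open>[x,1]\<close> contributes a
  sign when differentiated, hence the power of \<open>- 1\<close>.\<close>

lemma weighted_mu: "x \<in> I \<Longrightarrow> q x * eta x ^ k * mu k x = (- 1) ^ k * Lam k * P_upper p (Suc k) x"
proof (induction k arbitrary: x)
  case 0
  then show ?case using q_m by simp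
next
  case (Suc k)
  have "((\<lambda>x. q x * m_upper p eta x) \<longlongrightarrow> 0) (at_left 1)"
    by (rule Lim_transform_eventually[OF P_tendsto_0(2)[of 0]])
      (use eventually_Ioo_endpoints(2) q_m(2) in \<open>auto elim: eventually_mono\<close>)
  note lim = weighted_tendsto[OF m_upper_deriv tendsto_endpoint_id(2) eventually_Ioo_endpoints(2) q_tendsto_0(2) this, of "Suc k"]
  let ?c = "(- 1) ^ Suc k * Lam (Suc k)"
  have "q x * eta x ^ Suc k * mu (Suc k) x - ?c * P_upper p (Suc (Suc k)) x = 0"
  proof (rule zero_deriv_tendsto_zero[OF _ _ _ eventually_Ioo_endpoints(2) Suc.prems])
    fix t assume t: "t \<in> I"
    have "q t * eta t ^ Suc k / eta t * src (- 1) (m_upper p eta) (Suc k) t = lam (Suc k) * (q t * eta t ^ k * mu k t)"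
      using eta_pos[OF t] by (simp add: src_def)
    also have "\<dots> = ?c * - P_upper p (Suc k) t"
      unfolding Suc.IH[OF t] by simp
    finally show "((\<lambda>x. q x * eta x ^ Suc k * mu (Suc k) x - ?c * P_upper p (Suc (Suc k)) x) has_real_derivative 0) (at t)"
      using DERIV_diff[OF weighted_deriv[OF m_upper_deriv t, of "Suc k"] DERIV_cmult[OF P_upper_Suc(2)[OF t, of "Suc k"], of ?c]]
      by (simp only: diff_self)
  next
    show "((\<lambda>x. q x * eta x ^ Suc k * mu (Suc k) x - ?c * P_upper p (Suc (Suc k)) x) \<longlongrightarrow> 0) (at_left 1)"
      using tendsto_diff[OF lim tendsto_mult_left[OF P_tendsto_0(2)[of "Suc k"], of ?c]] by (simp only: diff_self mult_zero_right)
  qed (simp add: trivial_limit_at_left_real)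
  then show ?case by (rule eq_iff_diff_eq_0[THEN iffD2])
qed

lemma ml_eq: "x \<in> I \<Longrightarrow> ml k x = Lam k * P_lower p (Suc k) x / (q x * eta x ^ k)"
  using weighted_ml[of x k] q_pos[of x] eta_pos[of x] by (simp add: eq_divide_eq mult.commute del: P_lower.simps)

lemma mu_eq: "x \<in> I \<Longrightarrow> mu k x = (- 1) ^ k * Lam k * P_upper p (Suc k) x / (q x * eta x ^ k)"
  using weighted_mu[of x k] q_pos[of x] eta_pos[of x] by (simp add: eq_divide_eq mult.commute del: P_upper.simps)

lemma ml_nonneg: "x \<in> I \<Longrightarrow> 0 \<le> ml k x"
  using q_pos[of x] eta_pos[of x] P_nonneg(1)[of x "Suc k"] Lam_pos[of k]
  by (subst ml_eq) (auto intro!: divide_nonneg_nonneg mult_nonneg_nonneg simp del: P_lower.simps)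

lemma mu_sign: "x \<in> I \<Longrightarrow> 0 \<le> (- 1) ^ k * mu k x"
proof -
  assume x: "x \<in> I"
  have "(- 1) ^ k * (- 1) ^ k = (1::real)" by (simp flip: power_mult_distrib)
  moreover have "(- 1) ^ k * mu k x = ((- 1) ^ k * (- 1) ^ k) * (Lam k * P_upper p (Suc k) x / (q x * eta x ^ k))"
    unfolding mu_eq[OF x] by (simp del: P_upper.simps)
  moreover have "0 \<le> Lam k * P_upper p (Suc k) x / (q x * eta x ^ k)"
    using q_pos[OF x] eta_pos[OF x] P_nonneg(2)[OF x, of "Suc k"] Lam_pos[of k]
    by (intro divide_nonneg_nonneg mult_nonneg_nonneg) auto
  ultimately show ?thesis by simp
qed

text \<open>Both products equal the same multiple of
  \<open>P_lower p (Suc k) * P_upper p (Suc k)\<close> up to sign. This is what cancels when the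
  Stein solution is differentiated.\<close>

lemma mu_P_lower: "x \<in> I \<Longrightarrow> mu k x * P_lower p (Suc k) x = (- 1) ^ k * (ml k x * P_upper p (Suc k) x)"
  by (simp add: ml_eq mu_eq del: P_upper.simps P_lower.simps)

text \<open>The two summands coincide by \<open>mu_P_lower\<close>, so either may be estimated.
  \<open>ml k\<close> is nondecreasing and is controlled by its value at \<open>1/2\<close> on the
  left half; the modulus of \<open>mu k\<close> is nonincreasing and is controlled in the same way
  on the right half.\<close>

lemma U_diag_bdd_above: "bdd_above (U p eta k k ` I)"
proof -
  have "bounded (P_lower p (Suc k) ` {0..1})" "bounded (P_upper p (Suc k) ` {0..1})"
    using compact_continuous_image[OF P_lower_Suc(1)] compact_continuous_image[OF P_upper_Suc(1)]
    by (auto intro: compact_imp_bounded simp del: P_lower.simps P_upper.simps)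
  then obtain c d where c: "\<And>x. x \<in> {0..1} \<Longrightarrow> \<bar>P_lower p (Suc k) x\<bar> \<le> c"
      and d: "\<And>x. x \<in> {0..1} \<Longrightarrow> \<bar>P_upper p (Suc k) x\<bar> \<le> d"
    unfolding bounded_real by blast
  have eq: "\<bar>mu k x\<bar> * P_lower p (Suc k) x = ml k x * P_upper p (Suc k) x" if x: "x \<in> I" for x
  proof -
    have "\<bar>mu k x\<bar> * P_lower p (Suc k) x = \<bar>mu k x * P_lower p (Suc k) x\<bar>"
      using P_nonneg(1)[OF x, of "Suc k"] by (simp only: abs_mult abs_of_nonneg)
    also have "\<dots> = \<bar>ml k x * P_upper p (Suc k) x\<bar>"
      unfolding mu_P_lower[OF x] abs_mult by (simp only: power_abs abs_minus_cancel abs_one power_one mult_1)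
    also have "\<dots> = ml k x * P_upper p (Suc k) x"
      using P_nonneg(2)[OF x, of "Suc k"] ml_nonneg[OF x, of k] by (simp only: abs_mult abs_of_nonneg)
    finally show ?thesis .
  qed
  have U: "U p eta k k x = 2 * (ml k x * P_upper p (Suc k) x)" "U p eta k k x = 2 * (\<bar>mu k x\<bar> * P_lower p (Suc k) x)"
    if x: "x \<in> I" for x
    using eq[OF x] ml_nonneg[OF x, of k] by (simp_all add: U_def del: P_lower.simps P_upper.simps)
  have "U p eta k k x \<le> max (2 * (ml k (1/2) * d)) (2 * (\<bar>mu k (1/2)\<bar> * c))" if x: "x \<in> I" for x
  proof (cases "x \<le> 1/2")
    case True
    have "ml k x \<le> ml k (1/2)"
    proof (rule DERIV_nonneg_imp_nondecreasing[OF True])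
      fix t :: real assume "x \<le> t" "t \<le> 1/2"
      then have t: "t \<in> I" using x by auto
      show "\<exists>D. (ml k has_real_derivative D) (at t) \<and> 0 \<le> D"
        using ml_deriv[OF _ t, of k] ml_nonneg[OF t, of "Suc k"] by blast
    qed
    moreover have "P_upper p (Suc k) x \<le> d" "0 \<le> P_upper p (Suc k) x" using d[of x] x P_nonneg(2)[OF x, of "Suc k"]
      by (auto simp del: P_upper.simps)
    ultimately have "ml k x * P_upper p (Suc k) x \<le> ml k (1/2) * d"
      using ml_nonneg[of "1/2" k] by (intro mult_mono) auto
    then show ?thesis unfolding U(1)[OF x] by simp
  next
    case False
    then have x': "1/2 \<le> x" by simp
    have "(- 1) ^ k * mu k x \<le> (- 1) ^ k * mu k (1/2)"
    proof (rule DERIV_nonpos_imp_nonincreasing[OF x'])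
      fix t :: real assume "1/2 \<le> t" "t \<le> x"
      then have t: "t \<in> I" using x by auto
      have "((\<lambda>x. (- 1) ^ k * mu k x) has_real_derivative (- 1) ^ k * mu (Suc k) t) (at t)"
        by (rule DERIV_cmult[OF mu_deriv[OF _ t]])
      moreover have "(- 1) ^ k * mu (Suc k) t \<le> 0" using mu_sign[OF t, of "Suc k"] by (simp del: funpow.simps)
      ultimately show "\<exists>D. ((\<lambda>x. (- 1) ^ k * mu k x) has_real_derivative D) (at t) \<and> D \<le> 0" by blast
    qed
    moreover have "\<bar>mu k x\<bar> = (- 1) ^ k * mu k x" if "x \<in> I" for x
    proof -
      have "\<bar>mu k x\<bar> = \<bar>(- 1) ^ k * mu k x\<bar>" by (simp add: abs_mult power_abs)
      then show ?thesis using mu_sign[OF that, of k] by (simp only: abs_of_nonneg)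
    qed
    ultimately have "\<bar>mu k x\<bar> \<le> \<bar>mu k (1/2)\<bar>" using x by simp
    moreover have "P_lower p (Suc k) x \<le> c" "0 \<le> P_lower p (Suc k) x" using c[of x] x P_nonneg(1)[OF x, of "Suc k"]
      by (auto simp del: P_lower.simps)
    ultimately have "\<bar>mu k x\<bar> * P_lower p (Suc k) x \<le> \<bar>mu k (1/2)\<bar> * c"
      by (intro mult_mono) auto
    then show ?thesis unfolding U(2)[OF x] by simp
  qed
  then show ?thesis by (rule bdd_aboveI2)
qed

lemma P_lower_derivs:
  assumes "x \<in> I"
  shows "(P_lower p 1 has_real_derivative p x) (at x)" "(P_lower p 2 has_real_derivative P_lower p 1 x) (at x)"
    "(P_lower p 3 has_real_derivative P_lower p 2 x) (at x)" "(P_lower p 4 has_real_derivative P_lower p 3 x) (at x)"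
  using P_lower_Suc(2)[OF assms, of 0] P_lower_Suc(2)[OF assms, of "Suc 0"] P_lower_Suc(2)[OF assms, of "Suc (Suc 0)"]
    P_lower_Suc(2)[OF assms, of "Suc (Suc (Suc 0))"] P_lower.simps(1)[of p]
  by (simp_all only: eval_nat_numeral One_nat_def BitM.simps numeral_One)

lemma P_upper_derivs:
  assumes "x \<in> I"
  shows "(P_upper p 1 has_real_derivative - p x) (at x)" "(P_upper p 2 has_real_derivative - P_upper p 1 x) (at x)"
    "(P_upper p 3 has_real_derivative - P_upper p 2 x) (at x)" "(P_upper p 4 has_real_derivative - P_upper p 3 x) (at x)"
  using P_upper_Suc(2)[OF assms, of 0] P_upper_Suc(2)[OF assms, of "Suc 0"] P_upper_Suc(2)[OF assms, of "Suc (Suc 0)"]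
    P_upper_Suc(2)[OF assms, of "Suc (Suc (Suc 0))"] P_upper.simps(1)[of p]
  by (simp_all only: eval_nat_numeral One_nat_def BitM.simps numeral_One)

lemma P_tendsto_0':
  "0 < j \<Longrightarrow> (P_lower p j \<longlongrightarrow> 0) (at_right 0)" "0 < j \<Longrightarrow> (P_upper p j \<longlongrightarrow> 0) (at_left 1)"
  using P_tendsto_0[of "j - 1"] by simp_all

lemma ml_derivs:
  assumes "x \<in> I"
  shows "(ml 0 has_real_derivative ml 1 x) (at x)" "(ml 1 has_real_derivative ml 2 x) (at x)"
    "(ml 2 has_real_derivative ml 3 x) (at x)" "(ml 3 has_real_derivative ml 4 x) (at x)"
  using ml_deriv[OF _ assms, of 0] ml_deriv[OF _ assms, of 1] ml_deriv[OF _ assms, of 2] ml_deriv[OF _ assms, of 3]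
  by (simp_all only: eval_nat_numeral One_nat_def BitM.simps numeral_One)

lemma mu_derivs:
  assumes "x \<in> I"
  shows "(mu 0 has_real_derivative mu 1 x) (at x)" "(mu 1 has_real_derivative mu 2 x) (at x)"
    "(mu 2 has_real_derivative mu 3 x) (at x)" "(mu 3 has_real_derivative mu 4 x) (at x)"
  using mu_deriv[OF _ assms, of 0] mu_deriv[OF _ assms, of 1] mu_deriv[OF _ assms, of 2] mu_deriv[OF _ assms, of 3]
  by (simp_all only: eval_nat_numeral One_nat_def BitM.simps numeral_One)

lemma mu_P_lower_numeral:
  assumes "x \<in> I"
  shows "mu 0 x * P_lower p 1 x = ml 0 x * P_upper p 1 x" "mu 1 x * P_lower p 2 x = - (ml 1 x * P_upper p 2 x)"
    "mu 2 x * P_lower p 3 x = ml 2 x * P_upper p 3 x"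
proof -
  have "mu k x * P_lower p (Suc k) x = (- 1) ^ k * (ml k x * P_upper p (Suc k) x)" for k
    using mu_P_lower[OF assms] .
  from this[of 0] this[of "Suc 0"] this[of "Suc (Suc 0)"]
  show "mu 0 x * P_lower p 1 x = ml 0 x * P_upper p 1 x" "mu 1 x * P_lower p 2 x = - (ml 1 x * P_upper p 2 x)"
    "mu 2 x * P_lower p 3 x = ml 2 x * P_upper p 3 x"
    by (simp_all add: eval_nat_numeral del: P_lower.simps P_upper.simps funpow.simps)
qed

lemma ml_mu_ode:
  assumes "x \<in> I"
  shows "eta x * ml 1 x + tau x * ml 0 x = 1" "eta x * mu 1 x + tau x * mu 0 x = - 1"
  using iterated_deriv_ode[OF m_lower_deriv, THEN bspec[OF _ assms], of 0]
    iterated_deriv_ode[OF m_upper_deriv, THEN bspec[OF _ assms], of 0] by (simp_all add: src_def)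

text \<open>The Stein solution for the test function \<open>x\<close> is the constant \<open>- 1 / (a + b)\<close>.\<close>

lemma stein_linear:
  assumes x: "x \<in> I"
  shows "mu 0 x * P_lower p 2 x + ml 0 x * P_upper p 2 x = 1 / (a + b)"
proof -
  have "q x * mu 0 x = P_upper p 1 x" "q x * ml 0 x = P_lower p 1 x" using q_m[OF x] by simp_all
  moreover have "(a + b) * (mu 0 x * P_lower p 2 x + ml 0 x * P_upper p 2 x)
      = mu 0 x * ((a + b) * P_lower p 2 x) + ml 0 x * ((a + b) * P_upper p 2 x)"
    by (simp add: algebra_simps)
  moreover have "\<dots> = q x * mu 0 x + q x * ml 0 x - tau x * (mu 0 x * P_lower p 1 x - ml 0 x * P_upper p 1 x)"
    unfolding P_lower_2[OF x] P_upper_2[OF x] by (simp only: algebra_simps)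
  moreover have "P_upper p 1 x + P_lower p 1 x = 1" using P_sum[of x] x by (simp only: add.commute) auto
  ultimately have "(a + b) * (mu 0 x * P_lower p 2 x + ml 0 x * P_upper p 2 x) = 1"
    using mu_P_lower_numeral(1)[OF x] by (simp only: diff_self mult_zero_right diff_zero)
  then show ?thesis using a b by (simp add: field_simps)
qed

text \<open>The Stein solution for a cubic test function has vanishing third derivative.\<close>

lemma stein_cubic:
  assumes x: "x \<in> I"
  shows "mu 3 x * P_lower p 3 x + mu 2 x * P_lower p 2 x = ml 3 x * P_upper p 3 x - ml 2 x * P_upper p 2 x"
proof (rule DERIV_unique)
  show "((\<lambda>x. mu 2 x * P_lower p 3 x) has_real_derivative mu 3 x * P_lower p 3 x + mu 2 x * P_lower p 2 x) (at x)"
    using DERIV_mult'[OF mu_derivs(3)[OF x] P_lower_derivs(3)[OF x]] by (simp add: algebra_simps)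
  have "((\<lambda>x. ml 2 x * P_upper p 3 x) has_real_derivative ml 3 x * P_upper p 3 x - ml 2 x * P_upper p 2 x) (at x)"
    using DERIV_mult'[OF ml_derivs(3)[OF x] P_upper_derivs(3)[OF x]] by (simp add: algebra_simps)
  then show "((\<lambda>x. mu 2 x * P_lower p 3 x) has_real_derivative ml 3 x * P_upper p 3 x - ml 2 x * P_upper p 2 x) (at x)"
    by (rule has_field_derivative_transform_within_open[of _ _ _ I]) (use x mu_P_lower_numeral(3) in auto)
qed

text \<open>By the signs of \<open>ml 1\<close> and \<open>mu 1\<close> the function is
  \<open>?G\<close>. Its derivative is zero: the terms pair off by
  \<open>mu_P_lower_numeral\<close>, so it is even constant.\<close>

lemma U_12_bdd_above: "bdd_above (U p eta 1 2 ` I)"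
proof -
  let ?G = "\<lambda>x. ml 1 x * P_upper p 3 x - mu 1 x * P_lower p 3 x"
  have "\<exists>c. \<forall>x\<in>I. ?G x = c"
  proof (rule has_field_derivative_zero_constant)
    fix x assume x: "x \<in> I"
    have "(?G has_real_derivative 0) (at x)"
      using DERIV_diff[OF DERIV_mult'[OF ml_derivs(2)[OF x] P_upper_derivs(3)[OF x]] DERIV_mult'[OF mu_derivs(2)[OF x] P_lower_derivs(3)[OF x]]]
        mu_P_lower_numeral[OF x] by (simp add: algebra_simps)
    then show "(?G has_real_derivative 0) (at x within I)" by (rule has_field_derivative_at_within)
  qed simp
  then obtain c where c: "\<And>x. x \<in> I \<Longrightarrow> ?G x = c" by blast
  have "U p eta 1 2 x \<le> c" if x: "x \<in> I" for x
  proof -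
    have "\<bar>mu 1 x\<bar> = - mu 1 x" "\<bar>ml 1 x\<bar> = ml 1 x"
      using mu_sign[OF x, of 1] ml_nonneg[OF x, of 1] by (simp_all del: funpow.simps)
    moreover have "(2::nat) + 1 = 3" by simp
    ultimately have "U p eta 1 2 x = - mu 1 x * P_lower p 3 x + ml 1 x * P_upper p 3 x"
      unfolding U_def by (simp only:)
    then show ?thesis using c[OF x] by simp
  qed
  then show ?thesis by (rule bdd_aboveI2)
qed

text \<open>The real \<open>SUP\<close> is an upper bound only for a family bounded above, which
  \<open>U_12_bdd_above\<close> and \<open>U_diag_bdd_above\<close> provide.\<close>

lemma c_const_upper:
  "x \<in> I \<Longrightarrow> U p eta 1 2 x \<le> c_const a b 1 2" "x \<in> I \<Longrightarrow> U p eta k k x \<le> c_const a b k k"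
  unfolding c_const_def by (rule cSUP_upper, assumption, rule U_12_bdd_above U_diag_bdd_above)+

lemma U_nonneg: "x \<in> I \<Longrightarrow> 0 \<le> U p eta i j x"
  unfolding U_def by (intro add_nonneg_nonneg mult_nonneg_nonneg P_nonneg abs_ge_zero)

lemma c_const_nonneg: "0 \<le> c_const a b k k"
  using c_const_upper(2)[of "1/2"] U_nonneg[of "1/2"] by (auto intro: order_trans)

text \<open>\<open>u'\<close> is bounded and \<open>\<eta>\<close> vanishes at the end points, so
  the term \<open>\<eta> u'\<close> tends to 0 there and the equation forces \<open>u\<close>
  towards \<open>G / T\<close>.\<close>

lemma endpoint_extension_continuous:
  assumes G: "continuous_on {0..1} G" and T: "continuous_on {0..1} T" "T 0 \<noteq> 0" "T 1 \<noteq> 0"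
    and u: "\<And>x. x \<in> I \<Longrightarrow> isCont u x" and u': "\<And>x. x \<in> I \<Longrightarrow> \<bar>u' x\<bar> \<le> C"
    and eq: "\<And>x. x \<in> I \<Longrightarrow> eta x * u' x + T x * u x = G x"
  shows "continuous_on {0..1} (\<lambda>x. if x \<in> I then u x else G x / T x)" (is "continuous_on _ ?u")
  unfolding continuous_on_def
proof
  fix x :: real assume x: "x \<in> {0..1}"
  show "(?u \<longlongrightarrow> ?u x) (at x within {0..1})"
  proof (cases "x \<in> I")
    case True
    then have "(u \<longlongrightarrow> u x) (at x)" using u isCont_def by blast
    then have "(?u \<longlongrightarrow> u x) (at x)"
      by (rule Lim_transform_within_open[of _ _ _ _ I]) (use True in auto)
    then show ?thesis using True by (auto intro: tendsto_within_subset)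
  next
    case False
    then have x01: "x = 0 \<or> x = 1" using x by auto
    then have Tx: "T x \<noteq> 0" using T by auto
    have lG: "(G \<longlongrightarrow> G x) (at x within {0..1})" and lT: "(T \<longlongrightarrow> T x) (at x within {0..1})"
      using G T x by (auto simp: continuous_on_def)
    have "((\<lambda>y. C * (y * (1 - y))) \<longlongrightarrow> C * (x * (1 - x))) (at x within {0..1})" by (intro tendsto_intros)
    then have lC: "((\<lambda>y. C * (y * (1 - y))) \<longlongrightarrow> 0) (at x within {0..1})" using x01 by auto
    have le: "((\<lambda>y. if y \<in> I then eta y * u' y else 0) \<longlongrightarrow> 0) (at x within {0..1})"
    proof (rule Lim_null_comparison[OF _ lC], unfold eventually_at_filter, rule always_eventually, intro allI impI)
      fix y :: real assume "y \<in> {0..1}"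
      then show "norm (if y \<in> I then eta y * u' y else 0) \<le> C * (y * (1 - y))"
        using u'[of y] u'[of "1/2"] eta_pos[of y] by (auto simp: abs_mult eta_def mult.commute intro!: mult_left_mono)
    qed
    have lim: "((\<lambda>y. (G y - (if y \<in> I then eta y * u' y else 0)) / T y) \<longlongrightarrow> (G x - 0) / T x) (at x within {0..1})"
      by (intro tendsto_intros lG le lT Tx)
    have "eventually (\<lambda>y. T y \<noteq> 0) (at x within {0..1})"
      using lT Tx by (rule tendsto_imp_eventually_ne)
    moreover have "eventually (\<lambda>y. y \<in> {0..1}) (at x within {0..1})" by (simp add: eventually_at_filter)
    ultimately have ev: "\<forall>\<^sub>F y in at x within {0..1}. (G y - (if y \<in> I then eta y * u' y else 0)) / T y = ?u y"
    proof eventually_elim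
      case (elim y)
      then show ?case using eq[of y] by (auto simp: field_simps)
    qed
    have "(?u \<longlongrightarrow> (G x - 0) / T x) (at x within {0..1})"
      by (rule Lim_transform_eventually[OF lim ev])
    moreover have "?u x = (G x - 0) / T x" using False by auto
    ultimately show ?thesis by (simp only:)
  qed
qed

lemma p_mult_integrable:
  assumes "continuous_on {0..1} u"
  shows "(\<lambda>x. p x * u x) absolutely_integrable_on {0..1}"
proof -
  have "p absolutely_integrable_on {0..1}"
    by (rule nonnegative_absolutely_integrable_1[OF p_integrable]) (simp add: p_nonneg)
  then have "(\<lambda>x. u x * p x) absolutely_integrable_on {0..1}"
    using compact_imp_bounded[OF compact_continuous_image[OF assms]]
    by (intro absolutely_integrable_bounded_measurable_product_real continuous_imp_measurable_on_sets_lebesgue assms) auto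
  then show ?thesis by (simp add: mult.commute)
qed

text \<open>The integrand is the derivative of \<open>q * G\<close>, and \<open>q\<close> vanishes
  at both end points.\<close>

lemma stein_operator_has_integral_0:
  assumes "continuous_on {0..1} G" "\<And>x. x \<in> I \<Longrightarrow> (G has_real_derivative G1 x) (at x)"
  shows "((\<lambda>x. p x * (eta x * G1 x + tau x * G x)) has_integral 0) {0..1}"
proof -
  have "((\<lambda>x. p x * (eta x * G1 x + tau x * G x)) has_integral q 1 * G 1 - q 0 * G 0) {0..1}"
  proof (rule fundamental_theorem_of_calculus_interior)
    show "continuous_on {0..1} (\<lambda>x. q x * G x)" by (intro continuous_intros q_continuous assms)
    fix x :: real assume x: "x \<in> {0<..<1}"
    have "((\<lambda>x. q x * G x) has_real_derivative q x * G1 x + tau x * p x * G x) (at x)"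
      by (intro DERIV_mult' q_deriv assms x)
    then show "((\<lambda>x. q x * G x) has_vector_derivative p x * (eta x * G1 x + tau x * G x)) (at x)"
      by (simp add: has_real_derivative_iff_has_vector_derivative q_def algebra_simps)
  qed simp
  then show ?thesis by simp
qed

end

section \<open>The Stein equation of the Beta distribution\<close>

text \<open>Derivatives are taken in the open interval because the locale is used twice: for
  \<open>h\<close>, and for \<open>\<kappa> f1\<close>, where \<open>f1\<close> comes from the first
  Stein solution and the second derivative involves \<open>f3\<close>, controlled only in the
  interior.\<close>

locale stein_problem = beta_stein +
  fixes g g1 g2 :: "real \<Rightarrow> real" and B :: real
  assumes g_cont: "continuous_on {0..1} g"
    and g_deriv: "x \<in> {0<..<1} \<Longrightarrow> (g has_real_derivative g1 x) (at x)"
    and g1_deriv: "x \<in> {0<..<1} \<Longrightarrow> (g1 has_real_derivative g2 x) (at x)"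
    and g2_cont: "continuous_on {0<..<1} g2"
    and g2_bound: "x \<in> {0<..<1} \<Longrightarrow> \<bar>g2 x\<bar> \<le> B"
begin

definition mean :: real where "mean = integral {0..1} (\<lambda>x. p x * g x)"

text \<open>
  \<open>LA\<close> and \<open>UB\<close> are the integrals of \<open>P_lower p 2 * g2\<close> over \<open>[0, x]\<close> and of \<open>P_upper p 2 * g2\<close> over
  \<open>[x, 1]\<close>, integrated by parts twice so that nothing is required of \<open>g1\<close> and \<open>g2\<close> at the end points.
\<close>

definition LA :: "real \<Rightarrow> real" where
  "LA x = P_lower p 2 x * g1 x - P_lower p 1 x * g x + integral {0..x} (\<lambda>t. p t * g t)"

definition UB :: "real \<Rightarrow> real" where
  "UB x = - P_upper p 2 x * g1 x - P_upper p 1 x * g x + integral {x..1} (\<lambda>t. p t * g t)"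

text \<open>The Stein solution \<open>(1 / q) \<integral> p (g - mean)\<close> over
  \<open>[0,x]\<close>, written with the Mills ratios and integrated by parts until only the second
  derivative of \<open>g\<close> is integrated. By \<open>stein_linear\<close> the boundary terms
  combine to \<open>- g1 / (a + b)\<close>.\<close>

definition f_int :: "real \<Rightarrow> real" where "f_int x = mu 0 x * LA x - ml 0 x * UB x - g1 x / (a + b)"
definition f1_int :: "real \<Rightarrow> real" where "f1_int x = mu 1 x * LA x - ml 1 x * UB x"
definition f2 :: "real \<Rightarrow> real" where "f2 x = mu 2 x * LA x - ml 2 x * UB x"
definition f3 :: "real \<Rightarrow> real" where
  "f3 x = mu 3 x * LA x - ml 3 x * UB x + g2 x * (mu 2 x * P_lower p 2 x + ml 2 x * P_upper p 2 x)"

lemma pg_integrable: "(\<lambda>x. p x * g x) integrable_on {0..1}"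
  by (rule set_lebesgue_integral_eq_integral(1)[OF p_mult_integrable[OF g_cont]])

lemma isCont_pg: "x \<in> I \<Longrightarrow> isCont (\<lambda>x. p x * g x) x"
  by (intro continuous_intros isCont_p isCont_Ioo[OF g_cont])

lemma LA_deriv: assumes x: "x \<in> I" shows "(LA has_real_derivative P_lower p 2 x * g2 x) (at x)"
proof -
  note d = DERIV_add[OF DERIV_diff[OF DERIV_mult'[OF P_lower_derivs(2)[OF x] g1_deriv[OF x]] DERIV_mult'[OF P_lower_derivs(1)[OF x] g_deriv[OF x]]]
    has_real_derivative_integral_lower[OF pg_integrable isCont_pg[OF x] x]]
  have "P_lower p 2 x * g2 x + P_lower p 1 x * g1 x - (P_lower p 1 x * g1 x + p x * g x) + p x * g x = P_lower p 2 x * g2 x"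
    by simp
  then show ?thesis unfolding LA_def[abs_def] using d by (simp only:)
qed

lemma UB_deriv: assumes x: "x \<in> I" shows "(UB has_real_derivative - (P_upper p 2 x * g2 x)) (at x)"
proof -
  note d = DERIV_add[OF DERIV_diff[OF DERIV_mult'[OF DERIV_minus[OF P_upper_derivs(2)[OF x]] g1_deriv[OF x]] DERIV_mult'[OF P_upper_derivs(1)[OF x] g_deriv[OF x]]]
    has_real_derivative_integral_upper[OF pg_integrable isCont_pg[OF x] x]]
  have "- P_upper p 2 x * g2 x + - (- P_upper p 1 x) * g1 x - (P_upper p 1 x * g1 x + - p x * g x) + - (p x * g x)
     = - (P_upper p 2 x * g2 x)"
    by (simp only: algebra_simps)
  then show ?thesis unfolding UB_def[abs_def] using d by (simp only:)
qed

section \<open>Boundary limits and bounds of the two integrals\<close>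

text \<open>The mean value inequality from \<open>1/2\<close>. Boundedness makes the terms
  \<open>P_lower p 2 * g1\<close> at 0 and \<open>P_upper p 2 * g1\<close> at 1 vanish in the
  limit.\<close>

lemma g1_bounded: obtains C where "\<And>x. x \<in> I \<Longrightarrow> \<bar>g1 x\<bar> \<le> C"
proof -
  have B0: "0 \<le> B" using g2_bound[of "1/2"] by auto
  have "\<bar>g1 x\<bar> \<le> \<bar>g1 (1/2)\<bar> + B" if x: "x \<in> I" for x
  proof -
    have "norm (g1 x - g1 (1/2)) \<le> B * norm (x - 1/2)"
      by (rule field_differentiable_bound[of I g1 g2])
        (use x g1_deriv g2_bound in \<open>auto intro: has_field_derivative_at_within\<close>)
    also have "\<dots> \<le> B * 1" using x B0 by (intro mult_left_mono) auto
    finally show ?thesis by simp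
  qed
  then show ?thesis by (rule that)
qed

lemma LA_tendsto_0: "(LA \<longlongrightarrow> 0) (at_right 0)"
proof -
  obtain C where C: "\<And>x. x \<in> I \<Longrightarrow> \<bar>g1 x\<bar> \<le> C" using g1_bounded by blast
  have "((\<lambda>x. P_lower p 2 x * g1 x) \<longlongrightarrow> 0) (at_right 0)"
    by (rule tendsto_mult_bounded_Ioo[OF P_tendsto_0'(1) eventually_Ioo_endpoints(1) C]) simp
  moreover have "((\<lambda>x. integral {0..x} (\<lambda>t. p t * g t)) \<longlongrightarrow> 0) (at_right 0)"
    using tendsto_endpoints(1)[OF continuous_on_integral_lower_upper(1)[OF pg_integrable]] by simp
  ultimately have "(LA \<longlongrightarrow> 0 - 0 * g 0 + 0) (at_right 0)"
    unfolding LA_def[abs_def] by (intro tendsto_intros P_tendsto_0'(1) tendsto_endpoints(1)[OF g_cont]) auto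
  then show ?thesis by simp
qed

lemma UB_tendsto_0: "(UB \<longlongrightarrow> 0) (at_left 1)"
proof -
  obtain C where C: "\<And>x. x \<in> I \<Longrightarrow> \<bar>g1 x\<bar> \<le> C" using g1_bounded by blast
  have "((\<lambda>x. - P_upper p 2 x * g1 x) \<longlongrightarrow> 0) (at_left 1)"
    using tendsto_minus[OF tendsto_mult_bounded_Ioo[OF P_tendsto_0'(2)[of 2] eventually_Ioo_endpoints(2) C]] by simp
  moreover have "((\<lambda>x. integral {x..1} (\<lambda>t. p t * g t)) \<longlongrightarrow> 0) (at_left 1)"
    using tendsto_endpoints(2)[OF continuous_on_integral_lower_upper(2)[OF pg_integrable]] by simp
  ultimately have "(UB \<longlongrightarrow> 0 - 0 * g 1 + 0) (at_left 1)"
    unfolding UB_def[abs_def] by (intro tendsto_intros P_tendsto_0'(2) tendsto_endpoints(2)[OF g_cont]) auto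
  then show ?thesis by simp
qed

lemma LA_bound: assumes x: "x \<in> I" shows "\<bar>LA x\<bar> \<le> B * P_lower p 3 x"
proof (rule dominated_from_0[OF x LA_deriv LA_tendsto_0])
  show "((\<lambda>x. B * P_lower p 3 x) has_real_derivative B * P_lower p 2 t) (at t)" if "t \<in> I" for t
    by (rule DERIV_cmult[OF P_lower_derivs(3)[OF that]])
  show "((\<lambda>x. B * P_lower p 3 x) \<longlongrightarrow> 0) (at_right 0)"
    using tendsto_mult_left[OF P_tendsto_0'(1)[of 3], of B] by simp
  show "\<bar>P_lower p 2 t * g2 t\<bar> \<le> B * P_lower p 2 t" if "t \<in> I" for t
    using mult_right_mono[OF g2_bound[OF that] P_nonneg(1)[OF that, of 2]] P_nonneg(1)[OF that, of 2]
    by (simp add: abs_mult mult.commute)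
qed

lemma UB_bound: assumes x: "x \<in> I" shows "\<bar>UB x\<bar> \<le> B * P_upper p 3 x"
proof (rule dominated_from_1[OF x UB_deriv UB_tendsto_0])
  show "((\<lambda>x. B * P_upper p 3 x) has_real_derivative B * - P_upper p 2 t) (at t)" if "t \<in> I" for t
    by (rule DERIV_cmult[OF P_upper_derivs(3)[OF that]])
  show "((\<lambda>x. B * P_upper p 3 x) \<longlongrightarrow> 0) (at_left 1)"
    using tendsto_mult_left[OF P_tendsto_0'(2)[of 3], of B] by simp
  show "\<bar>- (P_upper p 2 t * g2 t)\<bar> \<le> - (B * - P_upper p 2 t)" if "t \<in> I" for t
    using mult_right_mono[OF g2_bound[OF that] P_nonneg(2)[OF that, of 2]] P_nonneg(2)[OF that, of 2]
    by (simp add: abs_mult mult.commute)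
qed

text \<open>The left side is the modulus of the integral of
  \<open>P_lower p 2 t * (g2 t - g2 x)\<close> over \<open>[0,x]\<close>, and integrating
  \<open>P_lower p 2 t * (x - t)\<close> gives \<open>P_lower p 4 x\<close>.\<close>

lemma LA_lipschitz_bound:
  assumes x: "x \<in> I" and K: "\<And>x y. x \<in> I \<Longrightarrow> y \<in> I \<Longrightarrow> \<bar>g2 x - g2 y\<bar> \<le> K * \<bar>x - y\<bar>"
  shows "\<bar>LA x - g2 x * P_lower p 3 x\<bar> \<le> K * P_lower p 4 x"
proof -
  have "\<bar>LA x - g2 x * P_lower p 3 x\<bar> \<le> K * (P_lower p 3 x * (x - x) + P_lower p 4 x)"
  \<comment> \<open>With \<open>x\<close> fixed, \<open>G\<close> is the primitive of
    \<open>K * (P_lower p 2 t * (x - t))\<close> that vanishes at 0; at \<open>t = x\<close> only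
    the fourth iterated integral remains.\<close>
  proof (rule dominated_from_0[OF x, where F = "\<lambda>t. LA t - g2 x * P_lower p 3 t" and G = "\<lambda>t. K * (P_lower p 3 t * (x - t) + P_lower p 4 t)"])
    fix t assume t: "t \<in> I"
    show "((\<lambda>t. LA t - g2 x * P_lower p 3 t) has_real_derivative P_lower p 2 t * g2 t - g2 x * P_lower p 2 t) (at t)"
      by (rule DERIV_diff[OF LA_deriv[OF t] DERIV_cmult[OF P_lower_derivs(3)[OF t]]])
    have "((\<lambda>t. x - t) has_real_derivative - 1) (at t)" by (auto intro!: derivative_eq_intros)
    from DERIV_cmult[OF DERIV_add[OF DERIV_mult'[OF P_lower_derivs(3)[OF t] this] P_lower_derivs(4)[OF t]], of K]
    show "((\<lambda>t. K * (P_lower p 3 t * (x - t) + P_lower p 4 t)) has_real_derivative K * (P_lower p 2 t * (x - t))) (at t)"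
      by simp
    assume "t \<le> x"
    have "\<bar>P_lower p 2 t * g2 t - g2 x * P_lower p 2 t\<bar> = P_lower p 2 t * \<bar>g2 t - g2 x\<bar>"
    proof -
      have "P_lower p 2 t * g2 t - g2 x * P_lower p 2 t = P_lower p 2 t * (g2 t - g2 x)"
        by (simp add: algebra_simps)
      then show ?thesis using P_nonneg(1)[OF t, of 2] by (simp only: abs_mult abs_of_nonneg)
    qed
    also have "\<dots> \<le> P_lower p 2 t * (K * \<bar>t - x\<bar>)"
      by (rule mult_left_mono[OF K[OF t x] P_nonneg(1)[OF t]])
    finally show "\<bar>P_lower p 2 t * g2 t - g2 x * P_lower p 2 t\<bar> \<le> K * (P_lower p 2 t * (x - t))"
      using \<open>t \<le> x\<close> by (simp add: mult_ac)
  next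
    have "((\<lambda>t. LA t - g2 x * P_lower p 3 t) \<longlongrightarrow> 0 - g2 x * 0) (at_right 0)"
      by (intro tendsto_intros LA_tendsto_0 P_tendsto_0') auto
    then show "((\<lambda>t. LA t - g2 x * P_lower p 3 t) \<longlongrightarrow> 0) (at_right 0)" by simp
    have "((\<lambda>t. K * (P_lower p 3 t * (x - t) + P_lower p 4 t)) \<longlongrightarrow> K * (0 * (x - 0) + 0)) (at_right 0)"
      by (intro tendsto_intros P_tendsto_0') auto
    then show "((\<lambda>t. K * (P_lower p 3 t * (x - t) + P_lower p 4 t)) \<longlongrightarrow> 0) (at_right 0)" by simp
  qed
  then show ?thesis by simp
qed

lemma UB_lipschitz_bound:
  assumes x: "x \<in> I" and K: "\<And>x y. x \<in> I \<Longrightarrow> y \<in> I \<Longrightarrow> \<bar>g2 x - g2 y\<bar> \<le> K * \<bar>x - y\<bar>"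
  shows "\<bar>UB x - g2 x * P_upper p 3 x\<bar> \<le> K * P_upper p 4 x"
proof -
  have "\<bar>UB x - g2 x * P_upper p 3 x\<bar> \<le> K * (P_upper p 3 x * (x - x) + P_upper p 4 x)"
  proof (rule dominated_from_1[OF x, where F = "\<lambda>t. UB t - g2 x * P_upper p 3 t" and G = "\<lambda>t. K * (P_upper p 3 t * (t - x) + P_upper p 4 t)"])
    fix t assume t: "t \<in> I"
    show "((\<lambda>t. UB t - g2 x * P_upper p 3 t) has_real_derivative - (P_upper p 2 t * g2 t) - g2 x * - P_upper p 2 t) (at t)"
      by (rule DERIV_diff[OF UB_deriv[OF t] DERIV_cmult[OF P_upper_derivs(3)[OF t]]])
    have "((\<lambda>t. t - x) has_real_derivative 1) (at t)" by (auto intro!: derivative_eq_intros)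
    from DERIV_cmult[OF DERIV_add[OF DERIV_mult'[OF P_upper_derivs(3)[OF t] this] P_upper_derivs(4)[OF t]], of K]
    show "((\<lambda>t. K * (P_upper p 3 t * (t - x) + P_upper p 4 t)) has_real_derivative - (K * (P_upper p 2 t * (t - x)))) (at t)"
      by simp
    assume "x \<le> t"
    have "\<bar>- (P_upper p 2 t * g2 t) - g2 x * - P_upper p 2 t\<bar> = \<bar>P_upper p 2 t * (g2 x - g2 t)\<bar>"
      by (simp add: algebra_simps)
    also have "\<dots> = P_upper p 2 t * \<bar>g2 x - g2 t\<bar>"
      using P_nonneg(2)[OF t, of 2] by (simp add: abs_mult)
    also have "\<dots> \<le> P_upper p 2 t * (K * \<bar>x - t\<bar>)"
      by (rule mult_left_mono[OF K[OF x t] P_nonneg(2)[OF t]])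
    finally show "\<bar>- (P_upper p 2 t * g2 t) - g2 x * - P_upper p 2 t\<bar> \<le> - (- (K * (P_upper p 2 t * (t - x))))"
      using \<open>x \<le> t\<close> by (simp add: mult_ac)
  next
    have "((\<lambda>t. UB t - g2 x * P_upper p 3 t) \<longlongrightarrow> 0 - g2 x * 0) (at_left 1)"
      by (intro tendsto_intros UB_tendsto_0 P_tendsto_0') auto
    then show "((\<lambda>t. UB t - g2 x * P_upper p 3 t) \<longlongrightarrow> 0) (at_left 1)" by simp
    have "((\<lambda>t. K * (P_upper p 3 t * (t - x) + P_upper p 4 t)) \<longlongrightarrow> K * (0 * (1 - x) + 0)) (at_left 1)"
      by (intro tendsto_intros P_tendsto_0') auto
    then show "((\<lambda>t. K * (P_upper p 3 t * (t - x) + P_upper p 4 t)) \<longlongrightarrow> 0) (at_left 1)" by simp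
  qed
  then show ?thesis by simp
qed

section \<open>Derivatives of the Stein solution, and the Stein equation\<close>

text \<open>The terms with \<open>g2\<close> add up to \<open>g2 / (a + b)\<close> by
  \<open>stein_linear\<close>, which cancels the derivative of the last summand of
  \<open>f_int\<close>.\<close>

lemma f_int_deriv: assumes x: "x \<in> I" shows "(f_int has_real_derivative f1_int x) (at x)"
proof -
  have "(f_int has_real_derivative
     mu 0 x * (P_lower p 2 x * g2 x) + mu 1 x * LA x - (ml 0 x * - (P_upper p 2 x * g2 x) + ml 1 x * UB x) - g2 x / (a + b)) (at x)"
    unfolding f_int_def[abs_def]
    by (intro DERIV_diff DERIV_mult' DERIV_cdivide mu_derivs ml_derivs LA_deriv UB_deriv g1_deriv x)
  moreover have "mu 0 x * (P_lower p 2 x * g2 x) - ml 0 x * - (P_upper p 2 x * g2 x) = g2 x / (a + b)"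
  proof -
    have "mu 0 x * (P_lower p 2 x * g2 x) - ml 0 x * - (P_upper p 2 x * g2 x) = (mu 0 x * P_lower p 2 x + ml 0 x * P_upper p 2 x) * g2 x"
      by (simp add: algebra_simps del: funpow.simps P_lower.simps P_upper.simps)
    then show ?thesis unfolding stein_linear[OF x] by simp
  qed
  ultimately show ?thesis by (simp add: f1_int_def algebra_simps)
qed

text \<open>The terms with \<open>g2\<close> cancel by \<open>mu_P_lower_numeral\<close>. At the
  next order they no longer do, and \<open>g2\<close> survives in \<open>f3\<close>.\<close>

lemma f1_int_deriv: assumes x: "x \<in> I" shows "(f1_int has_real_derivative f2 x) (at x)"
proof -
  have "(f1_int has_real_derivative
     mu 1 x * (P_lower p 2 x * g2 x) + mu 2 x * LA x - (ml 1 x * - (P_upper p 2 x * g2 x) + ml 2 x * UB x)) (at x)"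
    unfolding f1_int_def[abs_def]
    by (intro DERIV_diff DERIV_mult' mu_derivs ml_derivs LA_deriv UB_deriv x)
  moreover have "mu 1 x * (P_lower p 2 x * g2 x) = ml 1 x * - (P_upper p 2 x * g2 x)"
    using arg_cong[OF mu_P_lower_numeral(2)[OF x], of "\<lambda>y. y * g2 x"] by (simp only: mult.assoc mult_minus_left mult_minus_right)
  ultimately show ?thesis by (simp add: f2_def algebra_simps)
qed

lemma f2_deriv: assumes x: "x \<in> I" shows "(f2 has_real_derivative f3 x) (at x)"
proof -
  have "(f2 has_real_derivative
     mu 2 x * (P_lower p 2 x * g2 x) + mu 3 x * LA x - (ml 2 x * - (P_upper p 2 x * g2 x) + ml 3 x * UB x)) (at x)"
    unfolding f2_def[abs_def]
    by (intro DERIV_diff DERIV_mult' mu_derivs ml_derivs LA_deriv UB_deriv x)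
  then show ?thesis by (simp add: f3_def algebra_simps)
qed

lemma f3_cont: "continuous_on I f3"
  unfolding f3_def
  by (intro continuous_intros g2_cont)
    (auto intro!: continuous_at_imp_continuous_on ballI DERIV_isCont
      dest: mu_derivs ml_derivs LA_deriv UB_deriv P_lower_derivs P_upper_derivs)

text \<open>The first-order equations of the Mills ratios reduce the left side to
  \<open>- LA - UB - \<tau> g1 / (a + b)\<close>, and the definitions of \<open>LA\<close> and
  \<open>UB\<close> do the rest.\<close>

lemma stein_equation_int: assumes x: "x \<in> I" shows "eta x * f1_int x + tau x * f_int x = g x - mean"
proof -
  have "eta x * f1_int x + tau x * f_int x
     = (eta x * mu 1 x + tau x * mu 0 x) * LA x - (eta x * ml 1 x + tau x * ml 0 x) * UB x - tau x * g1 x / (a + b)"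
    by (simp add: f1_int_def f_int_def algebra_simps)
  also have "\<dots> = - LA x - UB x - tau x * g1 x / (a + b)"
    unfolding ml_mu_ode[OF x] by simp
  also have "\<dots> = (P_lower p 1 x + P_upper p 1 x) * g x - mean - (P_lower p 2 x - P_upper p 2 x + tau x / (a + b)) * g1 x"
    using integral_upper_eq[OF pg_integrable, of x] x
    by (simp add: LA_def UB_def mean_def algebra_simps del: P_lower.simps P_upper.simps One_nat_def)
  \<comment> \<open>The difference of the two iterated integrals is \<open>x\<close> minus the Beta
    mean \<open>a / (a + b)\<close>, so \<open>g1\<close> drops out.\<close>
  also have "P_lower p 2 x - P_upper p 2 x + tau x / (a + b) = 0"
  proof -
    have "P_lower p 1 x + P_upper p 1 x = 1" using P_sum[of x] x by auto
    moreover have "(a + b) * (P_lower p 2 x - P_upper p 2 x) = - tau x * (P_lower p 1 x + P_upper p 1 x)"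
      unfolding right_diff_distrib P_lower_2[OF x] P_upper_2[OF x] by (simp add: algebra_simps del: P_lower.simps P_upper.simps One_nat_def)
    ultimately have "(a + b) * (P_lower p 2 x - P_upper p 2 x) = - tau x" by simp
    then show ?thesis using a b by (simp add: field_simps)
  qed
  finally show ?thesis using P_sum[of x] x by simp
qed

lemma f1_int_bound: assumes x: "x \<in> I" shows "\<bar>f1_int x\<bar> \<le> c_const a b 1 2 * B"
proof -
  have "\<bar>f1_int x\<bar> \<le> \<bar>mu 1 x\<bar> * \<bar>LA x\<bar> + \<bar>ml 1 x\<bar> * \<bar>UB x\<bar>"
    unfolding f1_int_def by (simp only: abs_mult[symmetric] abs_triangle_ineq4)
  also have "\<dots> \<le> \<bar>mu 1 x\<bar> * (B * P_lower p 3 x) + \<bar>ml 1 x\<bar> * (B * P_upper p 3 x)"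
    by (intro add_mono mult_left_mono LA_bound UB_bound x abs_ge_zero)
  also have "\<dots> = U p eta 1 2 x * B"
    by (simp add: U_def algebra_simps del: P_lower.simps P_upper.simps One_nat_def)
  also have "\<dots> \<le> c_const a b 1 2 * B"
    using g2_bound[OF x] by (intro mult_right_mono c_const_upper x) auto
  finally show ?thesis .
qed

lemma f2_bound: assumes x: "x \<in> I" shows "\<bar>f2 x\<bar> \<le> c_const a b 2 2 * B"
proof -
  have "\<bar>f2 x\<bar> \<le> \<bar>mu 2 x\<bar> * \<bar>LA x\<bar> + \<bar>ml 2 x\<bar> * \<bar>UB x\<bar>"
    unfolding f2_def by (simp only: abs_mult[symmetric] abs_triangle_ineq4)
  also have "\<dots> \<le> \<bar>mu 2 x\<bar> * (B * P_lower p 3 x) + \<bar>ml 2 x\<bar> * (B * P_upper p 3 x)"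
    by (intro add_mono mult_left_mono LA_bound UB_bound x abs_ge_zero)
  also have "\<dots> = U p eta 2 2 x * B"
    by (simp add: U_def algebra_simps del: P_lower.simps P_upper.simps One_nat_def)
  also have "\<dots> \<le> c_const a b 2 2 * B"
    using g2_bound[OF x] by (intro mult_right_mono c_const_upper x) auto
  finally show ?thesis .
qed

text \<open>By \<open>stein_cubic\<close> the local term of \<open>f3\<close> can be absorbed as
  \<open>g2 x * P_lower p 3 x\<close> and \<open>g2 x * P_upper p 3 x\<close> into the two
  integrals. Then only the oscillation of \<open>g2\<close> about \<open>g2 x\<close> enters, which
  \<open>K\<close> controls.\<close>

lemma f3_bound:
  assumes x: "x \<in> I" and K: "\<And>x y. x \<in> I \<Longrightarrow> y \<in> I \<Longrightarrow> \<bar>g2 x - g2 y\<bar> \<le> K * \<bar>x - y\<bar>"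
  shows "\<bar>f3 x\<bar> \<le> c_const a b 3 3 * K"
proof -
  have e: "f3 x = mu 3 x * (LA x - g2 x * P_lower p 3 x) - ml 3 x * (UB x - g2 x * P_upper p 3 x)"
  proof -
    have "f3 x - (mu 3 x * (LA x - g2 x * P_lower p 3 x) - ml 3 x * (UB x - g2 x * P_upper p 3 x))
      = g2 x * ((mu 3 x * P_lower p 3 x + mu 2 x * P_lower p 2 x) - (ml 3 x * P_upper p 3 x - ml 2 x * P_upper p 2 x))"
      by (simp add: f3_def algebra_simps del: P_lower.simps P_upper.simps One_nat_def)
    then show ?thesis unfolding stein_cubic[OF x] by simp
  qed
  have "\<bar>f3 x\<bar> \<le> \<bar>mu 3 x\<bar> * \<bar>LA x - g2 x * P_lower p 3 x\<bar> + \<bar>ml 3 x\<bar> * \<bar>UB x - g2 x * P_upper p 3 x\<bar>"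
    unfolding e by (simp only: abs_mult[symmetric] abs_triangle_ineq4)
  also have "\<dots> \<le> \<bar>mu 3 x\<bar> * (K * P_lower p 4 x) + \<bar>ml 3 x\<bar> * (K * P_upper p 4 x)"
    using LA_lipschitz_bound[OF x K] UB_lipschitz_bound[OF x K] by (intro add_mono mult_left_mono abs_ge_zero)
  also have "\<dots> = U p eta 3 3 x * K"
    by (simp add: U_def algebra_simps del: P_lower.simps P_upper.simps One_nat_def)
  also have "\<dots> \<le> c_const a b 3 3 * K"
  proof (intro mult_right_mono c_const_upper x)
    have "0 \<le> K * \<bar>1/2 - 1/4\<bar>" using K[of "1/2" "1/4"] by (intro order_trans[OF abs_ge_zero]) auto
    then show "0 \<le> K" by (simp add: zero_le_mult_iff)
  qed
  finally show ?thesis .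
qed

text \<open>At the end points \<open>f\<close> and \<open>f1\<close> are read off the Stein equation and its derivative, where \<open>\<eta>\<close> vanishes.\<close>

definition f :: "real \<Rightarrow> real" where
  "f x = (if x \<in> I then f_int x else (g x - mean) / tau x)"

definition f1 :: "real \<Rightarrow> real" where
  "f1 x = (if x \<in> I then f1_int x else (g1 x + (a + b) * f x) / (tau x + (1 - 2 * x)))"

lemma tau_cont: "continuous_on {0..1} tau"
  unfolding tau_def[abs_def] by (intro continuous_intros)

text \<open>\<open>\<tau>\<close> is \<open>a\<close> at 0 and \<open>- b\<close> at 1, hence
  nonzero at both ends, and \<open>f1_int\<close> is bounded, so
  \<open>endpoint_extension_continuous\<close> applies.\<close>

lemma f_cont: "continuous_on {0..1} f"
  unfolding f_def[abs_def]
proof (rule endpoint_extension_continuous[where u' = f1_int and C = "c_const a b 1 2 * B"])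
  show "continuous_on {0..1} (\<lambda>x. g x - mean)" by (intro continuous_intros g_cont)
  show "isCont f_int x" if "x \<in> I" for x using f_int_deriv[OF that] by (rule DERIV_isCont)
qed (use a b f1_int_bound stein_equation_int tau_cont in \<open>simp_all add: tau_def\<close>)

lemma f_deriv: assumes "x \<in> I" shows "(f has_real_derivative f1 x) (at x)"
  using has_field_derivative_transform_within_open[OF f_int_deriv[OF assms], of I f] assms
  by (simp add: f_def f1_def)

lemma f1_deriv: assumes "x \<in> I" shows "(f1 has_real_derivative f2 x) (at x)"
  using has_field_derivative_transform_within_open[OF f1_int_deriv[OF assms], of I f1] assms
  by (simp add: f1_def)

lemma f1_bound: "x \<in> I \<Longrightarrow> \<bar>f1 x\<bar> \<le> c_const a b 1 2 * B"
  using f1_int_bound[of x] by (simp add: f1_def)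

lemma stein_equation: "x \<in> {0..1} \<Longrightarrow> eta x * f1 x + tau x * f x = g x - mean"
  using stein_equation_int[of x] a b
  by (cases "x \<in> I") (auto simp: f_def f1_def eta_def tau_def)

lemma stein_equation_deriv:
  assumes x: "x \<in> I"
  shows "eta x * f2 x + (tau x + (1 - 2 * x)) * f1 x = g1 x + (a + b) * f x"
proof -
  have t: "(tau has_real_derivative - (a + b)) (at x)" and e: "(eta has_real_derivative 1 - 2 * x) (at x)"
    unfolding tau_def[abs_def] eta_def[abs_def] by (auto intro!: derivative_eq_intros)
  have "((\<lambda>x. eta x * f1 x + tau x * f x) has_real_derivative
     eta x * f2 x + (1 - 2 * x) * f1 x + (tau x * f1 x + - (a + b) * f x)) (at x)"
    by (intro DERIV_add DERIV_mult' t e f_deriv f1_deriv x)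
  moreover have "((\<lambda>x. eta x * f1 x + tau x * f x) has_real_derivative g1 x) (at x)"
  proof (rule has_field_derivative_transform_within_open[of _ _ _ I])
    show "((\<lambda>x. g x - mean) has_real_derivative g1 x) (at x)"
      using DERIV_diff[OF g_deriv[OF x] DERIV_const[of mean]] by simp
  qed (use x stein_equation in auto)
  ultimately have "eta x * f2 x + (1 - 2 * x) * f1 x + (tau x * f1 x + - (a + b) * f x) = g1 x"
    by (rule DERIV_unique)
  then show ?thesis by (simp add: algebra_simps)
qed

text \<open>The same extension argument for the differentiated equation, whose coefficient
  \<open>\<tau> + (1 - 2 x)\<close> is \<open>a + 1\<close> at 0 and \<open>- (b + 1)\<close> at
  1.\<close>

lemma f1_cont:
  assumes "continuous_on {0..1} g1"
  shows "continuous_on {0..1} f1"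
proof -
  have "continuous_on {0..1} (\<lambda>x. if x \<in> I then f1 x else (g1 x + (a + b) * f x) / (tau x + (1 - 2 * x)))"
  proof (rule endpoint_extension_continuous[where u' = f2 and C = "c_const a b 2 2 * B"])
    show "isCont f1 x" if "x \<in> I" for x using f1_deriv[OF that] by (rule DERIV_isCont)
    show "eta x * f2 x + (tau x + (1 - 2 * x)) * f1 x = g1 x + (a + b) * f x" if "x \<in> I" for x
      using that by (rule stein_equation_deriv)
  qed (use a b f2_bound in \<open>auto intro!: continuous_intros assms f_cont tau_cont simp: tau_def\<close>)
  moreover have "(\<lambda>x. if x \<in> I then f1 x else (g1 x + (a + b) * f x) / (tau x + (1 - 2 * x))) = f1"
    by (auto simp: f1_def)
  ultimately show ?thesis by (simp only:)
qed

end

section \<open>Taylor bounds and the urn\<close>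

text \<open>The mean value theorem for \<open>w + \<psi>\<close> and \<open>w - \<psi>\<close>,
  where \<open>w\<close> is a primitive of the bound on the derivative.\<close>

lemma growth_bound_right:
  fixes \<psi> :: "real \<Rightarrow> real"
  assumes xy: "x \<le> y" and cont: "continuous_on {x..y} \<psi>"
    and d: "\<And>t. x < t \<Longrightarrow> t < y \<Longrightarrow> (\<psi> has_real_derivative \<psi>' t) (at t)"
    and le: "\<And>t. x < t \<Longrightarrow> t < y \<Longrightarrow> \<bar>\<psi>' t\<bar> \<le> M * (t - x) ^ k"
  shows "\<bar>\<psi> y - \<psi> x\<bar> \<le> M * (y - x) ^ Suc k / Suc k"
proof (cases "x = y")
  case False
  then have "x < y" using xy by simp
  define w where "w t = M * (t - x) ^ Suc k / Suc k" for t
  have wd: "(w has_real_derivative M * (t - x) ^ k) (at t)" for t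
    unfolding w_def by (rule derivative_eq_intros refl | simp)+
  have wc: "continuous_on {x..y} w"
    using wd by (auto intro!: continuous_at_imp_continuous_on DERIV_isCont)
  have pos: "0 \<le> w y + s * \<psi> y - (w x + s * \<psi> x)" if s: "s = 1 \<or> s = - 1" for s
  proof -
    have D: "((\<lambda>t. w t + s * \<psi> t) has_real_derivative M * (t - x) ^ k + s * \<psi>' t) (at t)" if "x < t" "t < y" for t
      by (intro DERIV_add DERIV_cmult wd d that)
    have "continuous_on {x..y} (\<lambda>t. w t + s * \<psi> t)" by (intro continuous_intros wc cont)
    moreover have "(\<lambda>t. w t + s * \<psi> t) differentiable (at t)" if "x < t" "t < y" for t
      using D[OF that] real_differentiable_def by blast
    ultimately obtain l z where z: "x < z" "z < y" "((\<lambda>t. w t + s * \<psi> t) has_real_derivative l) (at z)"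
      "w y + s * \<psi> y - (w x + s * \<psi> x) = (y - x) * l"
      using MVT[OF \<open>x < y\<close>, of "\<lambda>t. w t + s * \<psi> t"] by blast
    have "l = M * (z - x) ^ k + s * \<psi>' z" using z(3) D[OF z(1,2)] by (rule DERIV_unique)
    then have "0 \<le> l" using le[OF z(1,2)] s by auto
    then show ?thesis using z xy by simp
  qed
  show ?thesis using pos[of 1] pos[of "- 1"] by (simp add: w_def abs_le_iff)
qed simp

lemma growth_bound:
  fixes \<psi> :: "real \<Rightarrow> real"
  assumes x: "x \<in> {u..v}" and y: "y \<in> {u..v}" and cont: "continuous_on {u..v} \<psi>"
    and d: "\<And>t. t \<in> {u<..<v} \<Longrightarrow> (\<psi> has_real_derivative \<psi>' t) (at t)"
    and le: "\<And>t. t \<in> {u<..<v} \<Longrightarrow> \<bar>\<psi>' t\<bar> \<le> M * \<bar>t - x\<bar> ^ k"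
  shows "\<bar>\<psi> y - \<psi> x\<bar> \<le> M * \<bar>y - x\<bar> ^ Suc k / Suc k"
proof (cases "x \<le> y")
  case True
  have "\<bar>\<psi> y - \<psi> x\<bar> \<le> M * (y - x) ^ Suc k / Suc k"
  proof (rule growth_bound_right[OF True])
    show "continuous_on {x..y} \<psi>" by (rule continuous_on_subset[OF cont]) (use x y in auto)
    fix t assume t: "x < t" "t < y"
    then have "t \<in> {u<..<v}" using x y by auto
    then show "(\<psi> has_real_derivative \<psi>' t) (at t)" "\<bar>\<psi>' t\<bar> \<le> M * (t - x) ^ k"
      using d le[of t] t by auto
  qed
  then show ?thesis using True by simp
next
  case False
  then have yx: "- x \<le> - y" by simp
  have "\<bar>\<psi> (- (- y)) - \<psi> (- (- x))\<bar> \<le> M * (- y - - x) ^ Suc k / Suc k"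
  proof (rule growth_bound_right[OF yx])
    show "continuous_on {- x..- y} (\<lambda>t. \<psi> (- t))"
      by (rule continuous_on_compose2[OF cont]) (use x y in \<open>auto intro!: continuous_intros\<close>)
    fix t assume t: "- x < t" "t < - y"
    then have t': "- t \<in> {u<..<v}" using x y by auto
    show "((\<lambda>t. \<psi> (- t)) has_real_derivative - \<psi>' (- t)) (at t)"
      using DERIV_chain'[OF DERIV_minus[OF DERIV_ident] d[OF t']] by simp
    show "\<bar>- \<psi>' (- t)\<bar> \<le> M * (t - - x) ^ k"
      using le[OF t'] t by (simp add: add.commute)
  qed
  then show ?thesis using False by simp
qed

lemma lipschitz_bound:
  fixes F :: "real \<Rightarrow> real"
  assumes "x \<in> {u..v}" "y \<in> {u..v}" "continuous_on {u..v} F"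
    "\<And>t. t \<in> {u<..<v} \<Longrightarrow> (F has_real_derivative F1 t) (at t)"
    "\<And>t. t \<in> {u<..<v} \<Longrightarrow> \<bar>F1 t\<bar> \<le> M"
  shows "\<bar>F y - F x\<bar> \<le> M * \<bar>y - x\<bar>"
  using growth_bound[of x u v y F F1 M 0] assms by simp

text \<open>As a function of the evaluation point the remainder has derivative
  \<open>F1 t - F1 x\<close>, at most \<open>M\<close> times the distance;
  \<open>growth_bound\<close> integrates this once more.\<close>

lemma taylor1_bound:
  fixes F :: "real \<Rightarrow> real"
  assumes xy: "x \<in> {u..v}" "y \<in> {u..v}" and c: "continuous_on {u..v} F" "continuous_on {u..v} F1"
    and d: "\<And>t. t \<in> {u<..<v} \<Longrightarrow> (F has_real_derivative F1 t) (at t)"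
      "\<And>t. t \<in> {u<..<v} \<Longrightarrow> (F1 has_real_derivative F2 t) (at t)"
    and M: "\<And>t. t \<in> {u<..<v} \<Longrightarrow> \<bar>F2 t\<bar> \<le> M"
  shows "\<bar>F y - F x - (y - x) * F1 x\<bar> \<le> M * (y - x)\<^sup>2 / 2"
proof -
  have "\<bar>(F y - (y - x) * F1 x) - (F x - (x - x) * F1 x)\<bar> \<le> M * \<bar>y - x\<bar> ^ Suc 1 / Suc 1"
  proof (rule growth_bound[OF xy])
    show "continuous_on {u..v} (\<lambda>t. F t - (t - x) * F1 x)" by (intro continuous_intros c)
    fix t assume t: "t \<in> {u<..<v}"
    show "((\<lambda>t. F t - (t - x) * F1 x) has_real_derivative F1 t - F1 x) (at t)"
      by (rule derivative_eq_intros d[OF t] refl | simp)+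
    show "\<bar>F1 t - F1 x\<bar> \<le> M * \<bar>t - x\<bar> ^ 1"
      using lipschitz_bound[OF xy(1) _ c(2) d(2) M, of t] t by simp
  qed
  then show ?thesis by (simp add: power2_eq_square algebra_simps flip: abs_mult)
qed

lemma taylor2_bound:
  fixes F :: "real \<Rightarrow> real"
  assumes xy: "x \<in> {u..v}" "y \<in> {u..v}" and c: "continuous_on {u..v} F" "continuous_on {u..v} F1" "continuous_on {u..v} F2"
    and d: "\<And>t. t \<in> {u<..<v} \<Longrightarrow> (F has_real_derivative F1 t) (at t)"
      "\<And>t. t \<in> {u<..<v} \<Longrightarrow> (F1 has_real_derivative F2 t) (at t)"
      "\<And>t. t \<in> {u<..<v} \<Longrightarrow> (F2 has_real_derivative F3 t) (at t)"
    and M: "\<And>t. t \<in> {u<..<v} \<Longrightarrow> \<bar>F3 t\<bar> \<le> M"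
  shows "\<bar>F y - F x - (y - x) * F1 x - (y - x)\<^sup>2 / 2 * F2 x\<bar> \<le> M * \<bar>y - x\<bar> ^ 3 / 6"
proof -
  have "\<bar>(F y - (y - x) * F1 x - (y - x)\<^sup>2 / 2 * F2 x) - (F x - (x - x) * F1 x - (x - x)\<^sup>2 / 2 * F2 x)\<bar>
    \<le> M / 2 * \<bar>y - x\<bar> ^ Suc 2 / Suc 2"
  proof (rule growth_bound[OF xy])
    show "continuous_on {u..v} (\<lambda>t. F t - (t - x) * F1 x - (t - x)\<^sup>2 / 2 * F2 x)" by (intro continuous_intros c) auto
    fix t assume t: "t \<in> {u<..<v}"
    show "((\<lambda>t. F t - (t - x) * F1 x - (t - x)\<^sup>2 / 2 * F2 x) has_real_derivative F1 t - F1 x - (t - x) * F2 x) (at t)"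
      by (rule derivative_eq_intros d[OF t] refl | simp)+
    show "\<bar>F1 t - F1 x - (t - x) * F2 x\<bar> \<le> M / 2 * \<bar>t - x\<bar> ^ 2"
      using taylor1_bound[OF xy(1) _ c(2,3) d(2,3) M, of t] t by simp
  qed
  then show ?thesis by (simp add: algebra_simps eval_nat_numeral)
qed

section \<open>The law of the number of red draws\<close>

definition urn_mean :: "real \<Rightarrow> real \<Rightarrow> real \<Rightarrow> nat \<Rightarrow> (nat \<Rightarrow> real) \<Rightarrow> real" where
  "urn_mean r s c n F = measure_pmf.expectation (polya_draws r s c n) (\<lambda>xs. F (count_list xs True))"

lemma set_polya_draws: "set_pmf (polya_draws r s c n) \<subseteq> {xs. length xs = n}"
  by (induction n) (auto simp: set_bind_pmf)

lemma finite_polya_draws: "finite (set_pmf (polya_draws r s c n))"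
proof (rule finite_subset[OF set_polya_draws])
  show "finite {xs :: bool list. length xs = n}"
    using finite_lists_length_eq[of "UNIV :: bool set" n] by simp
qed

lemma urn_mean_cong: "(\<And>k. k \<le> n \<Longrightarrow> F k = G k) \<Longrightarrow> urn_mean r s c n F = urn_mean r s c n G"
  unfolding urn_mean_def using set_polya_draws[of r s c n]
  by (intro integral_cong_AE) (auto simp: AE_measure_pmf_iff subset_iff intro: count_le_length)

lemma urn_mean_mono: "(\<And>k. k \<le> n \<Longrightarrow> F k \<le> G k) \<Longrightarrow> urn_mean r s c n F \<le> urn_mean r s c n G"
  unfolding urn_mean_def using set_polya_draws[of r s c n]
  by (intro integral_mono_AE integrable_measure_pmf_finite finite_polya_draws)
    (auto simp: AE_measure_pmf_iff subset_iff intro: count_le_length)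

lemma urn_mean_linear:
  "urn_mean r s c n (\<lambda>k. F k + G k) = urn_mean r s c n F + urn_mean r s c n G"
  "urn_mean r s c n (\<lambda>k. F k - G k) = urn_mean r s c n F - urn_mean r s c n G"
  "urn_mean r s c n (\<lambda>k. d * F k) = d * urn_mean r s c n F"
  "urn_mean r s c n (\<lambda>k. d) = d"
  unfolding urn_mean_def by (simp_all add: integrable_measure_pmf_finite finite_polya_draws)

lemma urn_mean_abs_le:
  assumes "\<And>k. k \<le> n \<Longrightarrow> \<bar>F k\<bar> \<le> G k"
  shows "\<bar>urn_mean r s c n F\<bar> \<le> urn_mean r s c n G"
proof -
  have "urn_mean r s c n F \<le> urn_mean r s c n G" by (intro urn_mean_mono) (use assms in \<open>force simp: abs_le_iff\<close>)
  moreover have "urn_mean r s c n (\<lambda>k. - 1 * F k) \<le> urn_mean r s c n G"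
    by (intro urn_mean_mono) (use assms in \<open>force simp: abs_le_iff\<close>)
  ultimately show ?thesis unfolding urn_mean_linear by simp
qed

context
  fixes r s c a b :: real
  assumes rsc: "0 < r" "0 < s" "0 < c" and ab: "a = r / c" "b = s / c"
begin

text \<open>Condition on the first \<open>n\<close> draws; dividing numerator and denominator by
  \<open>c\<close> turns the probability of red into \<open>(a + k) / (a + b + n)\<close>.\<close>

lemma urn_mean_Suc:
  "urn_mean r s c (Suc n) F = urn_mean r s c n (\<lambda>k. (a + k) / (a + b + n) * F (Suc k) + (b + n - k) / (a + b + n) * F k)"
proof -
  let ?S = "set_pmf (polya_draws r s c n)"
  have "urn_mean r s c (Suc n) F = (\<Sum>xs\<in>?S. pmf (polya_draws r s c n) xs *\<^sub>R
      measure_pmf.expectation (map_pmf (\<lambda>x. x # xs) (bernoulli_pmf ((r + c * real (count_list xs True)) / (r + s + c * real n))))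
        (\<lambda>xs. F (count_list xs True)))"
    unfolding urn_mean_def polya_draws.simps
    by (rule pmf_expectation_bind) (auto simp: finite_polya_draws)
  also have "\<dots> = (\<Sum>xs\<in>?S. pmf (polya_draws r s c n) xs *\<^sub>R
     ((a + count_list xs True) / (a + b + n) * F (Suc (count_list xs True)) + (b + n - count_list xs True) / (a + b + n) * F (count_list xs True)))"
  proof (intro sum.cong refl arg_cong[where f = "\<lambda>z. _ *\<^sub>R z"])
    fix xs assume "xs \<in> ?S"
    then have k: "count_list xs True \<le> n" using set_polya_draws[of r s c n] count_le_length[of xs True] by auto
    let ?k = "real (count_list xs True)" and ?p = "(r + c * real (count_list xs True)) / (r + s + c * real n)"
    have pos: "0 < r + s + c * real n" using rsc by (simp add: add_pos_nonneg)
    have ab': "r = a * c" "s = b * c" using ab rsc by simp_all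
    have pos': "0 < a + b + real n" using rsc by (simp add: ab add_pos_pos add_pos_nonneg)
    have p: "?p = (a + ?k) / (a + b + n)"
    proof -
      have "?p = (c * (a + ?k)) / (c * (a + b + n))" by (simp add: ab' algebra_simps)
      then show ?thesis using rsc by simp
    qed
    have "c * ?k \<le> c * real n" using rsc k by simp
    then have "r + c * ?k \<le> r + s + c * real n" using rsc by linarith
    moreover have "0 \<le> r + c * ?k" using rsc by simp
    \<comment> \<open>The expectation formula for \<open>bernoulli_pmf\<close> is applied with a
      parameter in \<open>[0,1]\<close>; this rests on at most \<open>n\<close> draws having been
      red.\<close>
    ultimately have "0 \<le> ?p" "?p \<le> 1" using pos by simp_all
    then have "measure_pmf.expectation (map_pmf (\<lambda>x. x # xs) (bernoulli_pmf ?p)) (\<lambda>xs. F (count_list xs True))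
      = F (Suc (count_list xs True)) * ?p + F (count_list xs True) * (1 - ?p)"
      by simp
    also have "1 - ?p = (b + n - ?k) / (a + b + n)"
      unfolding p using pos' by (simp add: field_simps)
    finally show "measure_pmf.expectation (map_pmf (\<lambda>x. x # xs) (bernoulli_pmf ?p)) (\<lambda>xs. F (count_list xs True))
      = (a + ?k) / (a + b + n) * F (Suc (count_list xs True)) + (b + n - ?k) / (a + b + n) * F (count_list xs True)"
      unfolding p by (simp add: mult.commute)
  qed
  also have "\<dots> = urn_mean r s c n (\<lambda>k. (a + k) / (a + b + n) * F (Suc k) + (b + n - k) / (a + b + n) * F k)"
    unfolding urn_mean_def by (rule integral_measure_pmf[symmetric]) (auto simp: finite_polya_draws)
  finally show ?thesis .
qed

text \<open>The summed detailed balance of the Beta-binomial law. The induction keeps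
  \<open>G\<close> arbitrary because one step of the urn replaces it by two other functions. At
  \<open>k = 0\<close> the truncated index \<open>k - 1\<close> meets the factor
  \<open>k\<close>.\<close>

lemma urn_stein_identity:
  fixes G :: "nat \<Rightarrow> real"
  shows "urn_mean r s c n (\<lambda>k. (real n - real k) * (a + real k) * G k - real k * (b + real n - real k) * G (k - 1)) = 0"
proof (induction n arbitrary: G)
  case 0
  have "urn_mean r s c 0 (\<lambda>k. (real 0 - k) * (a + k) * G k - k * (b + real 0 - k) * G (k - 1)) = urn_mean r s c 0 (\<lambda>k. 0)"
    by (rule urn_mean_cong) auto
  then show ?case by (simp add: urn_mean_linear)
next
  case (Suc n)
  have pos': "0 < a + b + real n" using rsc by (simp add: ab add_pos_pos add_pos_nonneg)
  \<comment> \<open>\<open>H1\<close> and \<open>H2\<close> absorb one linear factor each from the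
    two terms, so that averaging the identity of order \<open>n + 1\<close> over the next draw gives
    the sum of two identities of order \<open>n\<close>.\<close>
  define H1 where "H1 k = (a + real k + 1) * G (Suc k)" for k
  define H2 where "H2 k = (b + real n - real k) * G k" for k
  let ?T = "\<lambda>n G k. (real n - real k) * (a + real k) * G k - real k * (b + real n - real k) * G (k - 1)"
  have "urn_mean r s c (Suc n) (?T (Suc n) G)
    = urn_mean r s c n (\<lambda>k. (a + k) / (a + b + n) * ?T (Suc n) G (Suc k) + (b + n - k) / (a + b + n) * ?T (Suc n) G k)"
    by (rule urn_mean_Suc)
  also have "\<dots> = urn_mean r s c n (\<lambda>k. 1 / (a + b + n) * (?T n H1 k + ?T n H2 k))"
  proof (rule urn_mean_cong)
    fix k assume "k \<le> n"
    have "(a + k) * ?T (Suc n) G (Suc k) + (b + n - k) * ?T (Suc n) G k = ?T n H1 k + ?T n H2 k"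
      by (cases k) (simp_all add: H1_def H2_def algebra_simps)
    moreover have "p / (a + b + n) * x + q / (a + b + n) * y = 1 / (a + b + n) * (p * x + q * y)" for p q x y
      by (simp add: add_divide_distrib)
    ultimately show "(a + k) / (a + b + n) * ?T (Suc n) G (Suc k) + (b + n - k) / (a + b + n) * ?T (Suc n) G k
      = 1 / (a + b + n) * (?T n H1 k + ?T n H2 k)"
      by (simp only:)
  qed
  also have "\<dots> = 0"
    unfolding urn_mean_linear(1,3) Suc.IH[of H1] Suc.IH[of H2] by simp
  finally show ?case .
qed

text \<open>The identity with \<open>G = 1\<close> yields the mean \<open>n * a / (a + b)\<close> of
  the count.\<close>

lemma urn_mean_kappa:
  assumes "0 < n"
  shows "urn_mean r s c n (\<lambda>k. a + (b - a) * (k / n)) = 2 * (a * b / (a + b))"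
proof -
  have pos: "0 < a" "0 < b" using rsc ab by simp_all
  have "urn_mean r s c n (\<lambda>k. (real n - k) * (a + k) * 1 - k * (b + n - k) * 1) = 0"
    using urn_stein_identity[of n "\<lambda>k. 1"] by simp
  moreover have "urn_mean r s c n (\<lambda>k. (real n - k) * (a + k) * 1 - k * (b + n - k) * 1)
    = urn_mean r s c n (\<lambda>k. n * a - (a + b) * real k)"
    by (rule urn_mean_cong) (simp add: algebra_simps)
  ultimately have "n * a = (a + b) * urn_mean r s c n real" by (simp add: urn_mean_linear)
  then have m: "urn_mean r s c n real = n * a / (a + b)" using pos by (simp add: field_simps)
  have "urn_mean r s c n (\<lambda>k. a + (b - a) * (k / n)) = urn_mean r s c n (\<lambda>k. a + (b - a) / n * real k)"
    by (rule urn_mean_cong) simp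
  also have "\<dots> = a + (b - a) / n * (n * a / (a + b))"
    unfolding urn_mean_linear m ..
  also have "\<dots> = a + (b - a) * a / (a + b)" using assms by simp
  also have "\<dots> = 2 * (a * b / (a + b))" using pos by (simp add: field_simps)
  finally show ?thesis .
qed

end

section \<open>The Stein operator against the discrete operator of the urn\<close>

lemma central_difference_1:
  fixes f :: "real \<Rightarrow> real"
  assumes d: "0 < d" "0 < w - d" "w + d < 1"
    and f: "\<And>t. t \<in> {0<..<1} \<Longrightarrow> (f has_real_derivative f1 t) (at t)"
      "\<And>t. t \<in> {0<..<1} \<Longrightarrow> (f1 has_real_derivative f2 t) (at t)"
    and M: "\<And>t. t \<in> {0<..<1} \<Longrightarrow> \<bar>f2 t\<bar> \<le> M"
  shows "\<bar>f1 w - (f (w + d) - f (w - d)) / (2 * d)\<bar> \<le> M * d / 2"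
proof -
  have c: "continuous_on {w - d..w + d} f" "continuous_on {w - d..w + d} f1"
    using d by (auto intro!: continuous_at_imp_continuous_on DERIV_isCont[OF f(1)] DERIV_isCont[OF f(2)])
  have T: "\<bar>f y - f w - (y - w) * f1 w\<bar> \<le> M * (y - w)\<^sup>2 / 2" if "y \<in> {w - d..w + d}" for y
    by (rule taylor1_bound[OF _ that c f M]) (use d in auto)
  have "\<bar>f (w + d) - f w - d * f1 w\<bar> \<le> M * d\<^sup>2 / 2" "\<bar>f (w - d) - f w + d * f1 w\<bar> \<le> M * d\<^sup>2 / 2"
    using T[of "w + d"] T[of "w - d"] d by simp_all
  then have le: "\<bar>2 * d * f1 w - (f (w + d) - f (w - d))\<bar> \<le> M * d\<^sup>2"
    by linarith
  have "f1 w - (f (w + d) - f (w - d)) / (2 * d) = (2 * d * f1 w - (f (w + d) - f (w - d))) / (2 * d)"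
    using d by (simp add: field_simps)
  then have "\<bar>f1 w - (f (w + d) - f (w - d)) / (2 * d)\<bar> = \<bar>2 * d * f1 w - (f (w + d) - f (w - d))\<bar> / (2 * d)"
    using d by (simp only: abs_divide)
  also have "\<dots> \<le> M * d\<^sup>2 / (2 * d)"
    by (rule divide_right_mono[OF le]) (use d in simp)
  also have "\<dots> = M * d / 2" using d by (simp add: power2_eq_square)
  finally show ?thesis .
qed

text \<open>The quadratic Taylor terms at \<open>w + d\<close> and \<open>w - d\<close> cancel,
  which leaves an error of order \<open>d\<^sup>2\<close> in place of the order \<open>d\<close> of
  \<open>central_difference_1\<close>.\<close>

lemma central_difference_2:
  fixes f :: "real \<Rightarrow> real"
  assumes d: "0 < d" "0 < w - d" "w + d < 1"
    and f: "\<And>t. t \<in> {0<..<1} \<Longrightarrow> (f has_real_derivative f1 t) (at t)"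
      "\<And>t. t \<in> {0<..<1} \<Longrightarrow> (f1 has_real_derivative f2 t) (at t)"
      "\<And>t. t \<in> {0<..<1} \<Longrightarrow> (f2 has_real_derivative f3 t) (at t)"
    and M: "\<And>t. t \<in> {0<..<1} \<Longrightarrow> \<bar>f3 t\<bar> \<le> M"
  shows "\<bar>f1 w - (f (w + d) - f (w - d)) / (2 * d)\<bar> \<le> M * d\<^sup>2 / 6"
proof -
  have c: "continuous_on {w - d..w + d} f" "continuous_on {w - d..w + d} f1" "continuous_on {w - d..w + d} f2"
    using d by (auto intro!: continuous_at_imp_continuous_on DERIV_isCont[OF f(1)] DERIV_isCont[OF f(2)] DERIV_isCont[OF f(3)])
  have T: "\<bar>f y - f w - (y - w) * f1 w - (y - w)\<^sup>2 / 2 * f2 w\<bar> \<le> M * \<bar>y - w\<bar> ^ 3 / 6" if "y \<in> {w - d..w + d}" for y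
    by (rule taylor2_bound[OF _ that c f M]) (use d in auto)
  have "\<bar>f (w + d) - f w - d * f1 w - d\<^sup>2 / 2 * f2 w\<bar> \<le> M * d ^ 3 / 6"
    "\<bar>f (w - d) - f w + d * f1 w - d\<^sup>2 / 2 * f2 w\<bar> \<le> M * d ^ 3 / 6"
    using T[of "w + d"] T[of "w - d"] d by simp_all
  then have le: "\<bar>2 * d * f1 w - (f (w + d) - f (w - d))\<bar> \<le> M * d ^ 3 / 3"
    by linarith
  have "f1 w - (f (w + d) - f (w - d)) / (2 * d) = (2 * d * f1 w - (f (w + d) - f (w - d))) / (2 * d)"
    using d by (simp add: field_simps)
  then have "\<bar>f1 w - (f (w + d) - f (w - d)) / (2 * d)\<bar> = \<bar>2 * d * f1 w - (f (w + d) - f (w - d))\<bar> / (2 * d)"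
    using d by (simp only: abs_divide)
  also have "\<dots> \<le> M * d ^ 3 / 3 / (2 * d)"
    by (rule divide_right_mono[OF le]) (use d in simp)
  also have "\<dots> = M * d\<^sup>2 / 6" using d by (simp add: power2_eq_square power3_eq_cube)
  finally show ?thesis .
qed

lemma eta_le_quarter: "eta x \<le> 1 / 4"
proof -
  have "0 \<le> (x - 1 / 2)\<^sup>2" by simp
  then show ?thesis by (simp add: eta_def power2_eq_square algebra_simps)
qed

text \<open>The Stein operator at \<open>w = k / n\<close> minus \<open>1 / n\<close> times the
  integrand of \<open>urn_stein_identity\<close> for \<open>G k = f ((k + 1/2) / n)\<close>: a
  central difference error weighted by \<open>\<eta>\<close>, and two shifts of half a lattice step
  weighted by \<open>a\<close> and \<open>b\<close>.\<close>

definition stein_defect :: "real \<Rightarrow> real \<Rightarrow> nat \<Rightarrow> (real \<Rightarrow> real) \<Rightarrow> (real \<Rightarrow> real) \<Rightarrow> real \<Rightarrow> real" where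
  "stein_defect a b n f f1 w = eta w * (f1 w - real n * (f (w + 1 / (2 * real n)) - f (w - 1 / (2 * real n))))
     + a * (1 - w) * (f w - f (w + 1 / (2 * real n))) + b * w * (f (w - 1 / (2 * real n)) - f w)"

lemma urn_stein_defect:
  assumes rsc: "0 < r" "0 < s" "0 < c" and ab: "a = r / c" "b = s / c" and n: "0 < n"
  shows "urn_mean r s c n (\<lambda>k. eta (real k / real n) * f1 (real k / real n) + (a - (a + b) * (real k / real n)) * f (real k / real n))
    = urn_mean r s c n (\<lambda>k. stein_defect a b n f f1 (real k / real n))"
proof -
  note lin = urn_mean_linear[of r s c n]
  \<comment> \<open>The half-step shift places the two values of \<open>?G\<close> symmetrically
    about \<open>k / n\<close>, so a central difference arises.\<close>
  let ?G = "\<lambda>k. f ((real k + 1 / 2) / n)"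
  let ?T = "\<lambda>k. (real n - real k) * (a + real k) * ?G k - real k * (b + real n - real k) * ?G (k - 1)"
  have "urn_mean r s c n (\<lambda>k. eta (real k / real n) * f1 (real k / real n) + (a - (a + b) * (real k / real n)) * f (real k / real n))
    = urn_mean r s c n (\<lambda>k. stein_defect a b n f f1 (real k / real n) + 1 / n * ?T k)"
  proof (rule urn_mean_cong)
    fix k assume "k \<le> n"
    define w where "w = real k / n"
    have k: "real k = n * w" using n by (simp add: w_def)
    have p: "?G k = f (w + 1 / (2 * real n))" using n by (simp add: w_def add_divide_distrib)
    \<comment> \<open>At \<open>k = 0\<close> truncated subtraction gives the wrong point, but the
      factor \<open>real k\<close> is zero.\<close>
    have m: "real k * x * ?G (k - 1) = real k * x * f (w - 1 / (2 * real n))" for x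
    proof (cases k)
      case (Suc j)
      have "(real j + 1 / 2) / n = w - 1 / (2 * real n)" using n unfolding w_def Suc by (simp add: field_simps)
      then show ?thesis using Suc by simp
    qed simp
    have "1 / n * ?T k = (1 - w) * (a + n * w) * f (w + 1 / (2 * real n)) - w * (b + n - n * w) * f (w - 1 / (2 * real n))"
    proof -
      have T: "?T k = (real n - real k) * (a + real k) * f (w + 1 / (2 * real n)) - real k * (b + real n - real k) * f (w - 1 / (2 * real n))"
        by (simp only: p m)
      show ?thesis unfolding T unfolding k using n by (simp add: field_simps)
    qed
    then show "eta (real k / real n) * f1 (real k / real n) + (a - (a + b) * (real k / real n)) * f (real k / real n)
       = stein_defect a b n f f1 (real k / real n) + 1 / n * ?T k"
      unfolding stein_defect_def w_def[symmetric] by (simp add: eta_def algebra_simps)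
  qed
  also have "\<dots> = urn_mean r s c n (\<lambda>k. stein_defect a b n f f1 (real k / real n)) + 1 / n * urn_mean r s c n ?T"
    unfolding lin(1) lin(3) ..
  also have "urn_mean r s c n ?T = 0" using urn_stein_identity[OF rsc ab, of n ?G] .
  finally show ?thesis by simp
qed

text \<open>A shifted point leaves the interval only for \<open>k = n\<close> on the right and
  \<open>k = 0\<close> on the left, exactly where the factor \<open>1 - w\<close> or
  \<open>w\<close> of the corresponding term vanishes.\<close>

lemma lattice_points:
  fixes k n :: nat
  assumes "k \<le> n" "0 < n"
  shows "real k / real n \<in> {0..1::real}" "k < n \<Longrightarrow> real k / real n + 1 / (2 * real n) \<in> {0<..<1::real}"
    "0 < k \<Longrightarrow> real k / real n - 1 / (2 * real n) \<in> {0<..<1::real}"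
proof -
  show "real k / real n \<in> {0..1::real}" using assms by simp
  { assume "k < n"
    then have "2 * real k + 1 < 2 * real n" by linarith
    then show "real k / real n + 1 / (2 * real n) \<in> {0<..<1::real}" using assms by (auto simp: field_simps intro!: add_nonneg_pos) }
  { assume "0 < k"
    then have "1 < 2 * real k" "2 * real k < 1 + 2 * real n" using assms by linarith+
    then show "real k / real n - 1 / (2 * real n) \<in> {0<..<1::real}" using assms by (auto simp: field_simps) }
qed

text \<open>The three terms of the defect are bounded separately with \<open>d = 1 / (2 n)\<close>:
  \<open>\<eta> \<le> 1/4\<close> times \<open>M2 * d / 2\<close> gives the constant 16, and the two
  shifts cost \<open>M1 * d\<close> each, with weights adding up to
  \<open>a + (b - a) * w\<close>.\<close>

lemma stein_defect_bound_1:
  assumes ab: "0 < a" "0 < b" and k: "k \<le> n" "0 < n"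
    and c: "continuous_on {0..1} f"
    and f: "\<And>t. t \<in> {0<..<1} \<Longrightarrow> (f has_real_derivative f1 t) (at t)"
      "\<And>t. t \<in> {0<..<1} \<Longrightarrow> (f1 has_real_derivative f2 t) (at t)"
    and M: "\<And>t. t \<in> {0<..<1} \<Longrightarrow> \<bar>f1 t\<bar> \<le> M1" "\<And>t. t \<in> {0<..<1} \<Longrightarrow> \<bar>f2 t\<bar> \<le> M2"
  shows "\<bar>stein_defect a b n f f1 (real k / real n)\<bar> \<le> M2 / (16 * real n) + M1 / (2 * real n) * (a + (b - a) * (real k / real n))"
proof -
  define w d where "w = real k / n" and "d = 1 / (2 * real n)"
  have d: "0 < d" "1 / (2 * d) = real n" using k by (simp_all add: d_def)
  have w: "w \<in> {0..1}" using lattice_points(1)[OF k] by (simp add: w_def)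
  have M0: "0 \<le> M1" "0 \<le> M2" using M[of "1/2"] by auto
  have L: "\<bar>f y - f w\<bar> \<le> M1 * \<bar>y - w\<bar>" if "y \<in> {0..1}" for y
    by (rule lipschitz_bound[OF w that c f(1) M(1)])
  have 1: "\<bar>eta w * (f1 w - real n * (f (w + d) - f (w - d)))\<bar> \<le> M2 / (16 * real n)"
  proof (cases "0 < k \<and> k < n")
    case True
    have "\<bar>f1 w - (f (w + d) - f (w - d)) / (2 * d)\<bar> \<le> M2 * d / 2"
      by (rule central_difference_1[OF d(1) _ _ f M(2)])
        (use True lattice_points(2,3)[OF k] in \<open>auto simp: w_def d_def\<close>)
    moreover have "\<bar>eta w\<bar> \<le> 1 / 4" using eta_le_quarter[of w] w by (simp add: eta_def)
    ultimately have "\<bar>eta w\<bar> * \<bar>f1 w - (f (w + d) - f (w - d)) / (2 * d)\<bar> \<le> 1 / 4 * (M2 * d / 2)"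
      by (intro mult_mono) auto
    then show ?thesis using k by (simp add: d_def abs_mult mult_ac)
  next
    case False
    then have "w = 0 \<or> w = 1" using k by (auto simp: w_def)
    then show ?thesis using M0 by (auto simp: eta_def)
  qed
  have 2: "\<bar>a * (1 - w) * (f w - f (w + d))\<bar> \<le> a * (1 - w) * (M1 * d)"
  proof (cases "k < n")
    case True
    then have "\<bar>f (w + d) - f w\<bar> \<le> M1 * d"
      using L[of "w + d"] lattice_points(2)[OF k True] d by (simp add: w_def d_def)
    then have "\<bar>f w - f (w + d)\<bar> \<le> M1 * d" by (simp only: abs_minus_commute)
    then show ?thesis using ab w by (simp add: abs_mult mult_left_mono)
  next
    case False
    then have "w = 1" using k by (simp add: w_def)
    then show ?thesis by simp
  qed
  have 3: "\<bar>b * w * (f (w - d) - f w)\<bar> \<le> b * w * (M1 * d)"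
  proof (cases "0 < k")
    case True
    then have "\<bar>f (w - d) - f w\<bar> \<le> M1 * d"
      using L[of "w - d"] lattice_points(3)[OF k True] d by (simp add: w_def d_def)
    then show ?thesis using ab w by (simp add: abs_mult mult_left_mono)
  next
    case False
    then have "w = 0" by (simp add: w_def)
    then show ?thesis by simp
  qed
  have "\<bar>stein_defect a b n f f1 w\<bar> \<le> M2 / (16 * real n) + a * (1 - w) * (M1 * d) + b * w * (M1 * d)"
    unfolding stein_defect_def d_def[symmetric] using 1 2 3 by linarith
  also have "\<dots> = M2 / (16 * real n) + M1 / (2 * real n) * (a + (b - a) * w)"
    by (simp add: d_def algebra_simps add_divide_distrib diff_divide_distrib)
  finally show ?thesis by (simp add: w_def)
qed

text \<open>The added term is the first-order part of the two shifts. What remains is quadratic: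
  \<open>1/4\<close> of \<open>M3 * d\<^sup>2 / 6\<close> gives 96, and
  \<open>M2 * d\<^sup>2 / 2\<close> gives 8, with \<open>d = 1 / (2 n)\<close>.\<close>

lemma stein_defect_bound_2:
  assumes ab: "0 < a" "0 < b" and k: "k \<le> n" "0 < n"
    and c: "continuous_on {0..1} f" "continuous_on {0..1} f1"
    and f: "\<And>t. t \<in> {0<..<1} \<Longrightarrow> (f has_real_derivative f1 t) (at t)"
      "\<And>t. t \<in> {0<..<1} \<Longrightarrow> (f1 has_real_derivative f2 t) (at t)"
      "\<And>t. t \<in> {0<..<1} \<Longrightarrow> (f2 has_real_derivative f3 t) (at t)"
    and M: "\<And>t. t \<in> {0<..<1} \<Longrightarrow> \<bar>f2 t\<bar> \<le> M2" "\<And>t. t \<in> {0<..<1} \<Longrightarrow> \<bar>f3 t\<bar> \<le> M3"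
  shows "\<bar>stein_defect a b n f f1 (real k / real n) + 1 / (2 * real n) * ((a + (b - a) * (real k / real n)) * f1 (real k / real n))\<bar>
    \<le> M3 / (96 * (real n)\<^sup>2) + M2 / (8 * (real n)\<^sup>2) * max a b"
proof -
  define w d where "w = real k / n" and "d = 1 / (2 * real n)"
  have d: "0 < d" "1 / (2 * d) = real n" using k by (simp_all add: d_def)
  have w: "w \<in> {0..1}" using lattice_points(1)[OF k] by (simp add: w_def)
  have M0: "0 \<le> M2" "0 \<le> M3" using M[of "1/2"] by auto
  have T: "\<bar>f y - f w - (y - w) * f1 w\<bar> \<le> M2 * (y - w)\<^sup>2 / 2" if "y \<in> {0..1}" for y
    by (rule taylor1_bound[OF w that c f(1,2) M(1)])
  have 1: "\<bar>eta w * (f1 w - real n * (f (w + d) - f (w - d)))\<bar> \<le> M3 / (96 * (real n)\<^sup>2)"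
  proof (cases "0 < k \<and> k < n")
    case True
    have "\<bar>f1 w - (f (w + d) - f (w - d)) / (2 * d)\<bar> \<le> M3 * d\<^sup>2 / 6"
      by (rule central_difference_2[OF d(1) _ _ f M(2)])
        (use True lattice_points(2,3)[OF k] in \<open>auto simp: w_def d_def\<close>)
    moreover have "\<bar>eta w\<bar> \<le> 1 / 4" using eta_le_quarter[of w] w by (simp add: eta_def)
    ultimately have "\<bar>eta w\<bar> * \<bar>f1 w - (f (w + d) - f (w - d)) / (2 * d)\<bar> \<le> 1 / 4 * (M3 * d\<^sup>2 / 6)"
      by (intro mult_mono) auto
    then show ?thesis using k by (simp add: d_def abs_mult mult_ac power_divide power_mult_distrib)
  next
    case False
    then have "w = 0 \<or> w = 1" using k by (auto simp: w_def)
    then show ?thesis using M0 by (auto simp: eta_def)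
  qed
  have 2: "\<bar>a * (1 - w) * (f w - f (w + d) + d * f1 w)\<bar> \<le> a * (1 - w) * (M2 * d\<^sup>2 / 2)"
  proof (cases "k < n")
    case True
    then have "\<bar>f (w + d) - f w - d * f1 w\<bar> \<le> M2 * d\<^sup>2 / 2"
      using T[of "w + d"] lattice_points(2)[OF k True] d by (simp add: w_def d_def)
    then have "\<bar>f w - f (w + d) + d * f1 w\<bar> \<le> M2 * d\<^sup>2 / 2" by linarith
    then show ?thesis using ab w by (simp add: abs_mult mult_left_mono)
  next
    case False
    then have "w = 1" using k by (simp add: w_def)
    then show ?thesis by simp
  qed
  have 3: "\<bar>b * w * (f (w - d) - f w + d * f1 w)\<bar> \<le> b * w * (M2 * d\<^sup>2 / 2)"
  proof (cases "0 < k")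
    case True
    then have "\<bar>f (w - d) - f w + d * f1 w\<bar> \<le> M2 * d\<^sup>2 / 2"
      using T[of "w - d"] lattice_points(3)[OF k True] d by (simp add: w_def d_def)
    then show ?thesis using ab w by (simp add: abs_mult mult_left_mono)
  next
    case False
    then have "w = 0" by (simp add: w_def)
    then show ?thesis by simp
  qed
  have "stein_defect a b n f f1 w + d * ((a + (b - a) * w) * f1 w)
     = eta w * (f1 w - real n * (f (w + d) - f (w - d))) + a * (1 - w) * (f w - f (w + d) + d * f1 w)
       + b * w * (f (w - d) - f w + d * f1 w)"
    unfolding stein_defect_def d_def[symmetric] by (simp add: algebra_simps)
  then have "\<bar>stein_defect a b n f f1 w + d * ((a + (b - a) * w) * f1 w)\<bar>
    \<le> M3 / (96 * (real n)\<^sup>2) + a * (1 - w) * (M2 * d\<^sup>2 / 2) + b * w * (M2 * d\<^sup>2 / 2)"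
    using 1 2 3 by linarith
  also have "\<dots> = M3 / (96 * (real n)\<^sup>2) + M2 * d\<^sup>2 / 2 * (a * (1 - w) + b * w)"
  proof -
    have "a * (1 - w) * X + b * w * X = X * (a * (1 - w) + b * w)" for X by (simp add: algebra_simps)
    then show ?thesis by (simp only: add.assoc)
  qed
  also have "\<dots> \<le> M3 / (96 * (real n)\<^sup>2) + M2 * d\<^sup>2 / 2 * max a b"
  proof (intro add_left_mono mult_left_mono)
    have "a * (1 - w) + b * w \<le> max a b * (1 - w) + max a b * w"
      using w by (intro add_mono mult_right_mono) auto
    then show "a * (1 - w) + b * w \<le> max a b" by (simp add: algebra_simps)
  qed (use M0 in simp)
  also have "M2 * d\<^sup>2 / 2 = M2 / (8 * (real n)\<^sup>2)"
    by (simp add: d_def power_divide power_mult_distrib)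
  finally show ?thesis by (simp add: w_def d_def)
qed

section \<open>The expansion\<close>

context stein_problem
begin

lemma urn_mean_eq_defect:
  assumes rsc: "0 < r" "0 < s" "0 < c" and ab: "a = r / c" "b = s / c" and n: "0 < n"
  shows "urn_mean r s c n (\<lambda>k. g (real k / real n)) - mean
    = urn_mean r s c n (\<lambda>k. stein_defect a b n f f1 (real k / real n))"
proof -
  have "urn_mean r s c n (\<lambda>k. g (real k / real n) - mean)
    = urn_mean r s c n (\<lambda>k. eta (real k / real n) * f1 (real k / real n) + (a - (a + b) * (real k / real n)) * f (real k / real n))"
  proof (rule urn_mean_cong)
    fix k assume "k \<le> n"
    from stein_equation[OF lattice_points(1)[OF this n]]
    show "g (real k / real n) - mean
      = eta (real k / real n) * f1 (real k / real n) + (a - (a + b) * (real k / real n)) * f (real k / real n)"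
      by (simp only: tau_def)
  qed
  also have "\<dots> = urn_mean r s c n (\<lambda>k. stein_defect a b n f f1 (real k / real n))"
    by (rule urn_stein_defect[OF rsc ab n])
  finally show ?thesis unfolding urn_mean_linear(2) urn_mean_linear(4) .
qed

text \<open>The first-order estimate, for a test function with bounded second derivative: average
  \<open>stein_defect_bound_1\<close>, with \<open>urn_mean_kappa\<close> evaluating the mean of its
  linear weight.\<close>

lemma urn_mean_diff_bound:
  assumes rsc: "0 < r" "0 < s" "0 < c" and ab: "a = r / c" "b = s / c" and n: "0 < n"
  shows "\<bar>urn_mean r s c n (\<lambda>k. g (real k / real n)) - mean\<bar> \<le> D_const a b / n * B"
proof -
  note lin = urn_mean_linear[of r s c n]
  have B0: "0 \<le> B" using g2_bound[of "1/2"] by auto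
  have "\<bar>urn_mean r s c n (\<lambda>k. g (real k / real n)) - mean\<bar> = \<bar>urn_mean r s c n (\<lambda>k. stein_defect a b n f f1 (real k / real n))\<bar>"
    unfolding urn_mean_eq_defect[OF rsc ab n] ..
  also have "\<dots> \<le> urn_mean r s c n (\<lambda>k. c_const a b 2 2 * B / (16 * real n) + c_const a b 1 2 * B / (2 * real n) * (a + (b - a) * (real k / real n)))"
    by (rule urn_mean_abs_le) (rule stein_defect_bound_1[OF a b _ n f_cont f_deriv f1_deriv f1_bound f2_bound])
  also have "\<dots> = c_const a b 2 2 * B / (16 * real n) + c_const a b 1 2 * B / (2 * real n) * (2 * (a * b / (a + b)))"
    by (subst lin(1), subst lin(3), subst urn_mean_kappa[OF rsc ab n], subst lin(4), rule refl)
  also have "\<dots> = (c_const a b 2 2 * (1 / 16) + c_const a b 1 2 * (a * b / (a + b))) / n * B"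
  proof -
    have "X * B / (16 * real n) + Y * B / (2 * real n) * (2 * Q) = (X * (1 / 16) + Y * Q) / n * B" for X Y Q
      using n by (simp add: field_simps)
    then show ?thesis .
  qed
  \<comment> \<open>The coefficient \<open>1/16\<close> obtained here is at most
    \<open>1/12 + max a b / 6\<close>.\<close>
  also have "\<dots> \<le> D_const a b / n * B"
    unfolding D_const_def using B0 a b c_const_nonneg[of 2]
    by (intro mult_right_mono divide_right_mono add_right_mono mult_left_mono) auto
  finally show ?thesis .
qed

text \<open>The Stein operator applied to the derivative \<open>\<tau> f1 - (a + b) f\<close> of
  \<open>\<tau> f\<close> has mean zero; the differentiated Stein equation then trades
  \<open>f2\<close> and \<open>f\<close> for \<open>g1\<close>.\<close>

lemma mean_tau_g1:
  assumes g1: "continuous_on {0..1} g1"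
  shows "integral {0..1} (\<lambda>x. p x * (tau x * g1 x)) = integral {0..1} (\<lambda>x. p x * ((a + (b - a) * x) * f1 x))"
proof -
  note f1c = f1_cont[OF g1]
  have "((\<lambda>x. p x * (eta x * (tau x * f2 x + - (a + b) * f1 x - (a + b) * f1 x) + tau x * (tau x * f1 x - (a + b) * f x))) has_integral 0) {0..1}"
  proof (rule stein_operator_has_integral_0)
    show "continuous_on {0..1} (\<lambda>x. tau x * f1 x - (a + b) * f x)" by (intro continuous_intros tau_cont f1c f_cont)
    fix x assume x: "x \<in> I"
    have "(tau has_real_derivative - (a + b)) (at x)"
      unfolding tau_def[abs_def] by (auto intro!: derivative_eq_intros)
    then show "((\<lambda>x. tau x * f1 x - (a + b) * f x) has_real_derivative tau x * f2 x + - (a + b) * f1 x - (a + b) * f1 x) (at x)"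
      by (intro DERIV_diff DERIV_mult' DERIV_cmult f1_deriv f_deriv x)
  qed
  moreover have "p x * (eta x * (tau x * f2 x + - (a + b) * f1 x - (a + b) * f1 x) + tau x * (tau x * f1 x - (a + b) * f x))
     = p x * (tau x * g1 x) - p x * ((a + (b - a) * x) * f1 x)" for x
  proof (cases "x \<in> I")
    case True
    have "tau x * g1 x = tau x * (eta x * f2 x + (tau x + (1 - 2 * x)) * f1 x - (a + b) * f x)"
      using stein_equation_deriv[OF True] by simp
    \<comment> \<open>This is where the weight \<open>\<kappa>\<close> comes from: it collects the
      coefficients of \<open>f1\<close>.\<close>
    moreover have "a + (b - a) * x = tau x * (1 - 2 * x) + 2 * (a + b) * eta x"
      by (simp add: tau_def eta_def algebra_simps)
    ultimately have "eta x * (tau x * f2 x + - (a + b) * f1 x - (a + b) * f1 x) + tau x * (tau x * f1 x - (a + b) * f x)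
     = tau x * g1 x - (a + (b - a) * x) * f1 x"
      by (simp only:) (simp add: algebra_simps)
    then show ?thesis by (simp add: right_diff_distrib)
  next
    case False
    then have "p x = 0" by (auto simp: beta_density_def)
    then show ?thesis by simp
  qed
  ultimately have 1: "((\<lambda>x. p x * (tau x * g1 x) - p x * ((a + (b - a) * x) * f1 x)) has_integral 0) {0..1}"
    by simp
  have i: "(\<lambda>x. p x * (tau x * g1 x)) integrable_on {0..1}" "(\<lambda>x. p x * ((a + (b - a) * x) * f1 x)) integrable_on {0..1}"
    by (intro set_lebesgue_integral_eq_integral(1) p_mult_integrable continuous_intros tau_cont g1 f1c)+
  show ?thesis using integral_unique[OF 1] integral_diff[OF i] by simp
qed

text \<open>The defect is \<open>- \<kappa> f1 / (2 n)\<close> up to second order. Replacing the urn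
  by the Beta law in that term is a new Stein problem with first-order error, and
  \<open>mean_tau_g1\<close> identifies its limit.\<close>

lemma urn_expansion:
  assumes rsc: "0 < r" "0 < s" "0 < c" and ab: "a = r / c" "b = s / c" and n: "0 < n"
    and g1: "continuous_on {0..1} g1"
    and K: "\<And>x y. x \<in> I \<Longrightarrow> y \<in> I \<Longrightarrow> \<bar>g2 x - g2 y\<bar> \<le> K * \<bar>x - y\<bar>"
  shows "\<bar>urn_mean r s c n (\<lambda>k. g (real k / real n)) - mean + 1 / (2 * real n) * integral {0..1} (\<lambda>x. p x * (tau x * g1 x))\<bar>
    \<le> C2_const a b / (real n)\<^sup>2 * B + C3_const a b / (real n)\<^sup>2 * K"
proof -
  note lin = urn_mean_linear[of r s c n]
  note f1c = f1_cont[OF g1]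
  have B0: "0 \<le> B" using g2_bound[of "1/2"] by auto
  have K0: "0 \<le> K"
  proof -
    have "0 \<le> K * \<bar>1/2 - 1/4\<bar>" using K[of "1/2" "1/4"] by (intro order_trans[OF abs_ge_zero]) auto
    then show ?thesis by (simp add: zero_le_mult_iff)
  qed
  define \<kappa> where "\<kappa> x = a + (b - a) * x" for x
  \<comment> \<open>Bounds the second derivative \<open>\<kappa> f3 + 2 (b - a) f2\<close> of
    \<open>\<kappa> f1\<close>.\<close>
  define B' where "B' = 2 * \<bar>b - a\<bar> * (c_const a b 2 2 * B) + max a b * (c_const a b 3 3 * K)"
  have \<kappa>: "0 \<le> \<kappa> x" "\<kappa> x \<le> max a b" if x: "x \<in> {0..1}" for x
  proof -
    have e: "\<kappa> x = a * (1 - x) + b * x" by (simp add: \<kappa>_def algebra_simps)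
    show "0 \<le> \<kappa> x" unfolding e using x a b by auto
    have "a * (1 - x) + b * x \<le> max a b * (1 - x) + max a b * x"
      using x by (intro add_mono mult_right_mono) auto
    then show "\<kappa> x \<le> max a b" unfolding e by (simp add: algebra_simps)
  qed
  have \<kappa>d: "(\<kappa> has_real_derivative b - a) (at x)" for x
    unfolding \<kappa>_def[abs_def] by (auto intro!: derivative_eq_intros)
  interpret phi: stein_problem a b "\<lambda>x. \<kappa> x * f1 x" "\<lambda>x. \<kappa> x * f2 x + (b - a) * f1 x"
    "\<lambda>x. \<kappa> x * f3 x + (b - a) * f2 x + (b - a) * f2 x" B'
  proof
    show "continuous_on {0..1} (\<lambda>x. \<kappa> x * f1 x)" unfolding \<kappa>_def by (intro continuous_intros f1c)
    show "continuous_on I (\<lambda>x. \<kappa> x * f3 x + (b - a) * f2 x + (b - a) * f2 x)"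
      unfolding \<kappa>_def using f2_deriv by (intro continuous_intros f3_cont continuous_at_imp_continuous_on ballI DERIV_isCont)
    fix x assume x: "x \<in> I"
    show "((\<lambda>x. \<kappa> x * f1 x) has_real_derivative \<kappa> x * f2 x + (b - a) * f1 x) (at x)"
      by (intro DERIV_mult' \<kappa>d f1_deriv x)
    show "((\<lambda>x. \<kappa> x * f2 x + (b - a) * f1 x) has_real_derivative \<kappa> x * f3 x + (b - a) * f2 x + (b - a) * f2 x) (at x)"
      by (intro DERIV_add DERIV_mult' DERIV_cmult \<kappa>d f1_deriv f2_deriv x)
    have "\<bar>\<kappa> x * f3 x + (b - a) * f2 x + (b - a) * f2 x\<bar> \<le> \<bar>\<kappa> x * f3 x\<bar> + 2 * \<bar>(b - a) * f2 x\<bar>" by linarith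
    also have "\<dots> = \<kappa> x * \<bar>f3 x\<bar> + 2 * \<bar>b - a\<bar> * \<bar>f2 x\<bar>" using \<kappa>(1)[of x] x by (simp add: abs_mult)
    also have "\<dots> \<le> max a b * (c_const a b 3 3 * K) + 2 * \<bar>b - a\<bar> * (c_const a b 2 2 * B)"
      using \<kappa>[of x] x a by (intro add_mono mult_mono f3_bound f2_bound K x) auto
    finally show "\<bar>\<kappa> x * f3 x + (b - a) * f2 x + (b - a) * f2 x\<bar> \<le> B'" by (simp add: B'_def)
  qed
  have m: "phi.mean = integral {0..1} (\<lambda>x. p x * (tau x * g1 x))"
    unfolding phi.mean_def unfolding mean_tau_g1[OF g1] \<kappa>_def ..
  have 1: "\<bar>urn_mean r s c n (\<lambda>k. \<kappa> (real k / real n) * f1 (real k / real n)) - integral {0..1} (\<lambda>x. p x * (tau x * g1 x))\<bar> \<le> D_const a b / n * B'"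
    using phi.urn_mean_diff_bound[OF rsc ab n] unfolding m .
  note 2 = urn_mean_eq_defect[OF rsc ab n]
  have "\<bar>urn_mean r s c n (\<lambda>k. stein_defect a b n f f1 (real k / real n) + 1 / (2 * real n) * (\<kappa> (real k / real n) * f1 (real k / real n)))\<bar>
    \<le> urn_mean r s c n (\<lambda>k. c_const a b 3 3 * K / (96 * (real n)\<^sup>2) + c_const a b 2 2 * B / (8 * (real n)\<^sup>2) * max a b)"
    unfolding \<kappa>_def
    by (rule urn_mean_abs_le, rule stein_defect_bound_2[OF a b _ n f_cont f1c f_deriv f1_deriv f2_deriv f2_bound f3_bound[OF _ K]])
  then have 3: "\<bar>urn_mean r s c n (\<lambda>k. stein_defect a b n f f1 (real k / real n)) + 1 / (2 * real n) * urn_mean r s c n (\<lambda>k. \<kappa> (real k / real n) * f1 (real k / real n))\<bar>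
    \<le> c_const a b 3 3 * K / (96 * (real n)\<^sup>2) + c_const a b 2 2 * B / (8 * (real n)\<^sup>2) * max a b"
    unfolding lin(1) lin(3) lin(4) .
  let ?J = "integral {0..1} (\<lambda>x. p x * (tau x * g1 x))" and ?E = "urn_mean r s c n (\<lambda>k. \<kappa> (real k / real n) * f1 (real k / real n))"
  have "\<bar>1 / (2 * real n) * (?E - ?J)\<bar> \<le> 1 / (2 * real n) * (D_const a b / n * B')"
    unfolding abs_mult using mult_left_mono[OF 1, of "1 / (2 * real n)"] by simp
  then have "\<bar>urn_mean r s c n (\<lambda>k. g (real k / real n)) - mean + 1 / (2 * real n) * ?J\<bar>
    \<le> c_const a b 3 3 * K / (96 * (real n)\<^sup>2) + c_const a b 2 2 * B / (8 * (real n)\<^sup>2) * max a b + 1 / (2 * real n) * (D_const a b / n * B')"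
    using 3 unfolding 2 right_diff_distrib by linarith
  also have "\<dots> = (c_const a b 2 2 * (max a b / 8 + D_const a b * \<bar>b - a\<bar>)) / (real n)\<^sup>2 * B
     + (c_const a b 3 3 * (1 / 96 + max a b / 2 * D_const a b)) / (real n)\<^sup>2 * K"
    by (simp add: B'_def power2_eq_square add_divide_distrib algebra_simps)
  \<comment> \<open>Compares \<open>1/8\<close> with \<open>1/6\<close> and \<open>1/96\<close> with
    \<open>1/48 + max a b / 24\<close>.\<close>
  also have "\<dots> \<le> C2_const a b / (real n)\<^sup>2 * B + C3_const a b / (real n)\<^sup>2 * K"
    unfolding C2_const_def C3_const_def M_const_def using B0 K0 a b c_const_nonneg
    by (intro add_mono mult_right_mono divide_right_mono mult_left_mono) auto
  finally show ?thesis .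
qed

end

text \<open>Passes from the law on the restricted Borel space through the density and an indicator
  to Lebesgue measure, where the integral agrees with the gauge integral used above.\<close>

lemma (in beta_stein) beta_expectation:
  assumes Z: "beta_distributed M a b Z" and u: "continuous_on {0..1} u"
  shows "(\<integral>\<omega>. u (Z \<omega>) \<partial>M) = integral {0..1} (\<lambda>x. p x * u x)"
proof -
  let ?N = "restrict_space lborel {0..1::real}"
  have u_N: "u \<in> borel_measurable ?N"
    using borel_measurable_continuous_on_restrict[OF u] by (simp add: measurable_def space_restrict_space sets_restrict_space)
  have "p \<in> borel_measurable borel"
    unfolding beta_density_def[abs_def] by measurable
  moreover have "(\<lambda>x. indicator {0..1} x *\<^sub>R u x) \<in> borel_measurable borel"
    by (rule borel_measurable_continuous_on_indicator[OF _ u]) simp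
  ultimately have "(\<lambda>x. p x * (indicator {0..1} x *\<^sub>R u x)) \<in> borel_measurable borel"
    by (rule borel_measurable_times)
  then have m: "(\<lambda>x. indicator {0..1} x *\<^sub>R (p x * u x)) \<in> borel_measurable lborel"
    by (simp add: mult_ac)
  have "(\<integral>\<omega>. u (Z \<omega>) \<partial>M) = (\<integral>x. p x * u x \<partial>?N)"
    by (rule distributed_integral[symmetric])
      (use Z u_N p_nonneg in \<open>auto simp: beta_distributed_def\<close>)
  also have "\<dots> = (\<integral>x. indicator {0..1} x *\<^sub>R (p x * u x) \<partial>lborel)"
    by (rule integral_restrict_space) simp
  also have "\<dots> = (\<integral>x. indicator {0..1} x *\<^sub>R (p x * u x) \<partial>lebesgue)"
    by (rule integral_completion[symmetric]) (rule m)
  also have "\<dots> = integral {0..1} (\<lambda>x. p x * u x)"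
    using set_lebesgue_integral_eq_integral(2)[OF p_mult_integrable[OF u]] by (simp add: set_lebesgue_integral_def)
  finally show ?thesis .
qed

lemma differentiable_on_Icc_imp_deriv01:
  assumes "u differentiable_on {0..1}" "x \<in> {0<..<1}"
  shows "(u has_real_derivative deriv01 u x) (at x)"
proof -
  have "u differentiable (at x within {0..1})" using assms by (auto simp: differentiable_on_def)
  then have "(u has_vector_derivative deriv01 u x) (at x within {0..1})"
    unfolding deriv01_def by (simp only: vector_derivative_works)
  then show ?thesis
    using assms by (simp add: at_within_Icc_at has_real_derivative_iff_has_vector_derivative)
qed

theorem theorem4p1:
  fixes r s c a b :: real
    and M :: "'w measure" and Z :: "'w \<Rightarrow> real"
    and h :: "real \<Rightarrow> real" and n :: nat
  assumes "r > 0" and "s > 0" and "c > 0"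
    and "a = r / c" and "b = s / c"
    and "prob_space M" and "beta_distributed M a b Z"
    and "C2_1 h"
    and "n \<ge> 1"
  shows "\<bar>measure_pmf.expectation (polya_draws r s c n) (\<lambda>xs. h (red_proportion n xs))
           - (\<integral>\<omega>. h (Z \<omega>) \<partial>M)
           - 1 / real n * (\<integral>\<omega>. e1 a b (Z \<omega>) * deriv01 h (Z \<omega>) \<partial>M)\<bar>
         \<le> C2_const a b / (real n)\<^sup>2 * ess_norm ((deriv01 ^^ 2) h)
           + C3_const a b / (real n)\<^sup>2 * ess_norm ((deriv01 ^^ 3) h)"
proof -
  let ?h1 = "deriv01 h" and ?h2 = "(deriv01 ^^ 2) h"
  have h2: "?h2 = deriv01 ?h1" and h3: "(deriv01 ^^ 3) h = deriv01 ?h2"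
    by (simp_all add: eval_nat_numeral)
  obtain L where h: "h differentiable_on {0..1}" "?h1 differentiable_on {0..1}"
      "continuous_on {0..1} ?h2" "L-lipschitz_on {0..1} ?h2"
    using assms(8) unfolding C2_1_def by blast
  note cont = differentiable_imp_continuous_on[OF h(1)] differentiable_imp_continuous_on[OF h(2)]
  have ab: "0 < a" "0 < b" using assms by simp_all
  interpret stein_problem a b h ?h1 ?h2 "ess_norm ?h2"
  proof
    show "continuous_on {0<..<1} ?h2" by (rule continuous_on_subset[OF h(3)]) auto
    fix x :: real assume x: "x \<in> {0<..<1}"
    show "(h has_real_derivative ?h1 x) (at x)" by (rule differentiable_on_Icc_imp_deriv01[OF h(1) x])
    show "(?h1 has_real_derivative ?h2 x) (at x)"
      unfolding h2 by (rule differentiable_on_Icc_imp_deriv01[OF h(2) x])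
    show "\<bar>?h2 x\<bar> \<le> ess_norm ?h2" by (rule ess_norm_continuous[OF h(3)]) (use x in auto)
  qed (use ab cont in auto)
  have n: "0 < n" using assms by simp
  \<comment> \<open>The only use of the third derivative: its essential norm serves as Lipschitz
    constant of the second.\<close>
  have K: "\<bar>?h2 x - ?h2 y\<bar> \<le> ess_norm ((deriv01 ^^ 3) h) * \<bar>x - y\<bar>" if "x \<in> I" "y \<in> I" for x y
    unfolding h3 by (rule lipschitz_ess_norm_deriv01[OF h(4)]) (use that in auto)
  let ?J = "integral {0..1} (\<lambda>x. p x * (tau x * ?h1 x))"
  have W: "measure_pmf.expectation (polya_draws r s c n) (\<lambda>xs. h (red_proportion n xs))
      = urn_mean r s c n (\<lambda>k. h (real k / real n))"
    by (simp add: urn_mean_def red_proportion_def)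
  have Z: "(\<integral>\<omega>. h (Z \<omega>) \<partial>M) = mean"
    unfolding mean_def by (rule beta_expectation[OF assms(7) cont(1)])
  have "continuous_on {0..1} (\<lambda>x. e1 a b x * ?h1 x)"
    unfolding e1_def by (intro continuous_intros cont) auto
  from beta_expectation[OF assms(7) this]
  have "(\<integral>\<omega>. e1 a b (Z \<omega>) * ?h1 (Z \<omega>) \<partial>M) = integral {0..1} (\<lambda>x. p x * (e1 a b x * ?h1 x))" .
  \<comment> \<open>\<open>e1 = - \<tau> / 2\<close>, so the correction term is the integral of
    \<open>urn_expansion\<close> up to the factor \<open>- 1/2\<close>.\<close>
  also have "(\<lambda>x. p x * (e1 a b x * ?h1 x)) = (\<lambda>x. - (1 / 2) * (p x * (tau x * ?h1 x)))"
    by (auto simp: e1_def tau_def field_simps)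
  finally have e: "(\<integral>\<omega>. e1 a b (Z \<omega>) * ?h1 (Z \<omega>) \<partial>M) = - (1 / 2) * ?J"
    unfolding integral_mult_right .
  have "X - Y - 1 / real n * (- (1 / 2) * J) = X - Y + 1 / (2 * real n) * J" for X Y J :: real
    using n by (simp add: field_simps)
  then show ?thesis
    unfolding W Z e using urn_expansion[OF assms(1-5) n cont(2) K] by (simp only:)
qed

end
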